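(* Let $z_1,z_2\in A_1\setminus K$, and consider $z_1\otimes z_2\in A_1\otimes A_1=A_2$. (a) If $z_1$ or $z_2$ is nilpotent (in $A_1$), then $z_1\otimes z_2$ is nilpotent in $A_2$, and $z_1\otimes z_2$ is strictly nilpotent if and only if both $z_1$ and $z_2$ are strictly nilpotent. (b) If neither $z_1$ nor $z_2$ is nilpotent, then $z_1\otimes z_2\in\Omega_0'(A_2)$. (c) If $z_1$ or $z_2$ is not nilpotent, then $C(z_1\otimes z_2)=C(z_1)\otimes C(z_2)$, which is commutative. If both $z_1$ and $z_2$ are semisimple, then $C(z_1\otimes z_2)=K[z_1]\otimes K[z_2]$.
   Context: $K$ is an algebraically closed field of characteristic zero. $A_n$ is the $n$-th Weyl algebra over $K$ ($A_1$ is generated by $p,q$ with $[q,p]=1$), and $A_2=A_1\otimes_K A_1$. For $A=A_1$ or $A_2$ and $z\in A$ put $ad_z(w)=[z,w]=zw-wz$ and $Ev(z)=\{\lambda\in K\mid \exists x\in A\setminus\{0\},\ ad_z(x)=\lambda x\}$, $F(z)=\{x\in A\mid \dim_K K[ad_z](x)<\infty\}$, $N(z)=\{x\in A\mid \exists m,\ ad_z^m(x)=0\}$, $C(z)=\{x\in A\mid ad_z(x)=0\}$, $D(z)=\bigoplus_{\lambda\in Ev(z)}\{x\in A\mid ad_z(x)=\lambda x\}$. For $z_i$ these are formed in $A_1$; for $z_1\otimes z_2$ in $A_2$. Types: if $Ev(z)=\{0\}$, $z\in\Omega_0'(A)$ if $C(z)=F(z)\subsetneq A$; $z\in\Omega_1(A)$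 (strictly nilpotent) if $C(z)\subsetneq N(z)=A$; $z\in\Omega_1'(A)$ if $C(z)\subsetneq N(z)\subsetneq A$. If $Ev(z)\supsetneq\{0\}$, $z\in\Omega_2(A)$ if $D(z)=F(z)=A$; $z\in\Omega_2'(A)$ if $D(z)=F(z)\subsetneq A$. Nilpotent means in $\Omega_1(A)\cup\Omega_1'(A)$; semisimple means in $\Omega_2(A)\cup\Omega_2'(A)$. *)

theory Defs
  imports "HOL-Library.Poly_Mapping" "HOL-Computational_Algebra.Polynomial"
begin

definition ad :: "'a::ring_1 \<Rightarrow> 'a \<Rightarrow> 'a"
  where "ad z w = z * w - w * z"

locale k_algebra = vector_space scale
  for scale :: "'k::field \<Rightarrow> 'a::ring_1 \<Rightarrow> 'a" +
  assumes scale_mult_left: "scale c x * y = scale c (x * y)"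
    and scale_mult_right: "x * scale c y = scale c (x * y)"
begin

definition scalars :: "'a set"
  where "scalars = range (\<lambda>c. scale c 1)"

text \<open>The unital subalgebra \<open>K[z]\<close> generated by one element.\<close>

definition polynomials_in :: "'a \<Rightarrow> 'a set"
  where "polynomials_in z = local.span (range (\<lambda>i::nat. z ^ i))"

definition Ev :: "'a \<Rightarrow> 'k set"
  where "Ev z = {c. \<exists>x. x \<noteq> 0 \<and> ad z x = scale c x}"

text \<open>\<open>K[ad z](x)\<close> is the span of the iterates \<open>(ad z)\<^sup>m x\<close>; it is finite-dimensional iff it is
  spanned by a finite set.\<close>

definition F :: "'a \<Rightarrow> 'a set"
  where "F z = {x. \<exists>B. finite B \<and> local.span (range (\<lambda>m::nat. (ad z ^^ m) x)) = local.span B}"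

definition N :: "'a \<Rightarrow> 'a set"
  where "N z = {x. \<exists>m::nat. (ad z ^^ m) x = 0}"

definition C :: "'a \<Rightarrow> 'a set"
  where "C z = {x. ad z x = 0}"

text \<open>Eigenspaces for distinct eigenvalues are independent, so their direct sum is the span of
  their union.\<close>

definition D :: "'a \<Rightarrow> 'a set"
  where "D z = local.span (\<Union>c\<in>Ev z. {x. ad z x = scale c x})"

definition Omega0' :: "'a set"
  where "Omega0' = {z. Ev z = {0} \<and> C z = F z \<and> F z \<subset> UNIV}"

definition Omega1 :: "'a set"
  where "Omega1 = {z. Ev z = {0} \<and> C z \<subset> N z \<and> N z = UNIV}"

definition Omega1' :: "'a set"
  where "Omega1' = {z. Ev z = {0} \<and> C z \<subset> N z \<and> N z \<subset> UNIV}"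

definition Omega2 :: "'a set"
  where "Omega2 = {z. {0} \<subset> Ev z \<and> D z = F z \<and> F z = UNIV}"

definition Omega2' :: "'a set"
  where "Omega2' = {z. {0} \<subset> Ev z \<and> D z = F z \<and> F z \<subset> UNIV}"

definition strictly_nilpotent :: "'a \<Rightarrow> bool"
  where "strictly_nilpotent z \<longleftrightarrow> z \<in> Omega1"

definition nilpotent :: "'a \<Rightarrow> bool"
  where "nilpotent z \<longleftrightarrow> z \<in> Omega1 \<union> Omega1'"

definition semisimple :: "'a \<Rightarrow> bool"
  where "semisimple z \<longleftrightarrow> z \<in> Omega2 \<union> Omega2'"

end

lemma poly_mapping_single_induct [case_names zero single add]:
  assumes "P 0"
    and "\<And>k v. P (Poly_Mapping.single k v)"
    and "\<And>x y. P x \<Longrightarrow> P y \<Longrightarrow> P (x + y)"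
  shows "P (x :: 'b \<Rightarrow>\<^sub>0 'c::comm_monoid_add)"
proof (induction x rule: update_induct)
  case const
  show ?case by (rule assms(1))
next
  case (update f a b)
  have "Poly_Mapping.update a b f = f + Poly_Mapping.single a b"
    using update(1)
    by (intro poly_mapping_eqI)
      (auto simp: lookup_update lookup_add lookup_single when_def in_keys_iff)
  with assms(2,3) update(3) show ?case by simp
qed

definition lin_ext :: "('k::field \<Rightarrow> 'v::ab_group_add \<Rightarrow> 'v) \<Rightarrow> ('b \<Rightarrow> 'v) \<Rightarrow> ('b \<Rightarrow>\<^sub>0 'k) \<Rightarrow> 'v"
  where "lin_ext s f x = (\<Sum>k\<in>Poly_Mapping.keys x. s (Poly_Mapping.lookup x k) (f k))"

context vector_space
begin

lemma lin_ext_zero [simp]: "lin_ext scale f 0 = 0"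
  by (simp add: lin_ext_def)

lemma lin_ext_add: "lin_ext scale f (x + y) = lin_ext scale f x + lin_ext scale f y"
  unfolding lin_ext_def
  by (rule setsum_keys_plus_distrib) (simp_all add: scale_left_distrib)

lemma lin_ext_single [simp]: "lin_ext scale f (Poly_Mapping.single k v) = scale v (f k)"
  by (simp add: lin_ext_def)

lemma lin_ext_diff: "lin_ext scale f (x - y) = lin_ext scale f x - lin_ext scale f y"
  using lin_ext_add[of f "x - y" y] by (simp add: algebra_simps)

lemma lin_ext_scale:
  "lin_ext scale f (Poly_Mapping.single (0::'m::monoid_add) c * x) = scale c (lin_ext scale f x)"
  by (induction x rule: poly_mapping_single_induct)
    (simp_all add: mult_single lin_ext_add distrib_left scale_right_distrib)

end

lemma single_zero_commute:
  "Poly_Mapping.single (0::'m::monoid_add) c * x = x * Poly_Mapping.single 0 (c::'k::field)"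
  by (induction x rule: poly_mapping_single_induct)
    (simp_all add: mult_single distrib_left distrib_right mult.commute)

lemma vector_space_field: "vector_space ((*) :: 'k::field \<Rightarrow> 'k \<Rightarrow> 'k)"
  by unfold_locales (simp_all add: distrib_left distrib_right mult.assoc)

lemma vector_space_poly: "vector_space (smult :: 'k::field \<Rightarrow> 'k poly \<Rightarrow> 'k poly)"
  by unfold_locales (simp_all add: smult_add_right smult_add_left)

lemmas lin_ext_field =
  vector_space.lin_ext_zero[OF vector_space_field] vector_space.lin_ext_add[OF vector_space_field]
  vector_space.lin_ext_single[OF vector_space_field] vector_space.lin_ext_diff[OF vector_space_field]
  vector_space.lin_ext_scale[OF vector_space_field]

lemmas lin_ext_poly =
  vector_space.lin_ext_zero[OF vector_space_poly] vector_space.lin_ext_add[OF vector_space_poly]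
  vector_space.lin_ext_single[OF vector_space_poly] vector_space.lin_ext_diff[OF vector_space_poly]
  vector_space.lin_ext_scale[OF vector_space_poly]

lemma minus_diff_eq_minus_diff: "(a - b) - (c - d) = (a - c) - (b - d)" for a :: "'v::ab_group_add"
  by simp

datatype weyl_gen = Gen_p | Gen_q

text \<open>Words are the free monoid, written additively because the keys of the monoid algebra
  \<^typ>\<open>'m::monoid_add \<Rightarrow>\<^sub>0 'k::field\<close> are an additive monoid. So \<open>weyl_gen word \<Rightarrow>\<^sub>0 'k\<close> is the free
  associative algebra on two generators.\<close>

datatype 'a word = Word (letters: "'a list")

instantiation word :: (type) monoid_add
begin

definition "0 = Word []"
definition "u + v = Word (letters u @ letters v)"

instance
  by standard (simp_all add: zero_word_def plus_word_def)

end

definition free_gen :: "weyl_gen \<Rightarrow> (weyl_gen word \<Rightarrow>\<^sub>0 'k::field)"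
  where "free_gen g = Poly_Mapping.single (Word [g]) 1"

text \<open>The two-sided ideal generated by \<open>q p - p q - 1\<close>.\<close>

inductive_set weyl_ideal :: "(weyl_gen word \<Rightarrow>\<^sub>0 'k::field) set" where
  zero: "0 \<in> weyl_ideal"
| relation: "free_gen Gen_q * free_gen Gen_p - free_gen Gen_p * free_gen Gen_q - 1 \<in> weyl_ideal"
| add: "x \<in> weyl_ideal \<Longrightarrow> y \<in> weyl_ideal \<Longrightarrow> x + y \<in> weyl_ideal"
| mult: "x \<in> weyl_ideal \<Longrightarrow> a * x * b \<in> weyl_ideal"

lemma weyl_ideal_left: "x \<in> weyl_ideal \<Longrightarrow> a * x \<in> weyl_ideal"
  using weyl_ideal.mult[of x a 1] by simp

lemma weyl_ideal_right: "x \<in> weyl_ideal \<Longrightarrow> x * b \<in> weyl_ideal"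
  using weyl_ideal.mult[of x 1 b] by simp

lemma weyl_ideal_uminus: "x \<in> weyl_ideal \<Longrightarrow> - x \<in> weyl_ideal"
  using weyl_ideal_left[of x "- 1"] by simp

lemma weyl_ideal_diff: "x \<in> weyl_ideal \<Longrightarrow> y \<in> weyl_ideal \<Longrightarrow> x - y \<in> weyl_ideal"
  using weyl_ideal.add[OF _ weyl_ideal_uminus, of x y] by simp

text \<open>The action on \<open>K[X]\<close> by \<open>p \<mapsto> X\<close>, \<open>q \<mapsto> d/dX\<close> shows that the ideal is proper.\<close>

fun gen_action :: "weyl_gen \<Rightarrow> 'k::field poly \<Rightarrow> 'k poly" where
  "gen_action Gen_p f = pCons 0 f"
| "gen_action Gen_q f = pderiv f"

definition word_action :: "weyl_gen word \<Rightarrow> 'k::field poly \<Rightarrow> 'k poly"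
  where "word_action w f = foldr gen_action (letters w) f"

definition free_action :: "(weyl_gen word \<Rightarrow>\<^sub>0 'k::field) \<Rightarrow> 'k poly \<Rightarrow> 'k poly"
  where "free_action x f = lin_ext smult (\<lambda>w. word_action w f) x"

lemma gen_action_linear:
  "gen_action g (f + h) = gen_action g f + gen_action g h"
  "gen_action g (smult c f) = smult c (gen_action g f)"
  by (cases g; simp add: pderiv_add pderiv_smult)+

lemma gen_action_zero: "gen_action g 0 = 0"
  by (cases g) simp_all

lemma foldr_gen_action_linear:
  "foldr gen_action gs (f + h) = foldr gen_action gs f + foldr gen_action gs h"
  "foldr gen_action gs (smult c f) = smult c (foldr gen_action gs f)"
  "foldr gen_action gs 0 = 0"
  by (induction gs) (simp_all add: gen_action_linear gen_action_zero)

lemma word_action_linear: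
  "word_action w (f + h) = word_action w f + word_action w h"
  "word_action w (smult c f) = smult c (word_action w f)"
  "word_action w 0 = 0"
  by (simp_all add: word_action_def foldr_gen_action_linear)

lemma word_action_plus: "word_action (v + w) f = word_action v (word_action w f)"
  by (simp add: word_action_def plus_word_def)

lemma free_action_simps [simp]:
  "free_action 0 f = 0"
  "free_action (x + y) f = free_action x f + free_action y f"
  "free_action (x - y) f = free_action x f - free_action y f"
  "free_action (Poly_Mapping.single w c) f = smult c (word_action w f)"
  by (simp_all add: free_action_def lin_ext_poly)

lemma free_action_one [simp]: "free_action 1 f = f"
  by (simp flip: single_one add: word_action_def zero_word_def)

lemma free_action_zero_right: "free_action x 0 = 0"
  by (simp add: free_action_def lin_ext_def word_action_linear)

lemma word_action_free_action:
  "word_action w (free_action y f) = free_action (Poly_Mapping.single w 1 * y) f"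
  by (induction y rule: poly_mapping_single_induct)
    (simp_all add: mult_single word_action_linear word_action_plus distrib_left)

lemma free_action_scale:
  "free_action (Poly_Mapping.single 0 c * x) f = smult c (free_action x f)"
  by (simp add: free_action_def lin_ext_poly)

lemma free_action_mult [simp]: "free_action (x * y) f = free_action x (free_action y f)"
proof (induction x rule: poly_mapping_single_induct)
  case (single w c)
  have "Poly_Mapping.single w c * y = Poly_Mapping.single 0 c * (Poly_Mapping.single w 1 * y)"
    by (simp flip: mult.assoc add: mult_single)
  then show ?case
    by (simp only: free_action_scale word_action_free_action free_action_simps)
qed (simp_all add: distrib_right)

lemma free_action_ideal: "x \<in> weyl_ideal \<Longrightarrow> free_action x f = 0"
proof (induction x arbitrary: f rule: weyl_ideal.induct)
  case relation
  show ?case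
    by (simp add: free_gen_def word_action_def pderiv_pCons)
qed (simp_all add: free_action_zero_right)

definition weyl_rel :: "(weyl_gen word \<Rightarrow>\<^sub>0 'k::field) \<Rightarrow> (weyl_gen word \<Rightarrow>\<^sub>0 'k) \<Rightarrow> bool"
  where "weyl_rel x y \<longleftrightarrow> x - y \<in> weyl_ideal"

lemma weyl_rel_equivp: "equivp weyl_rel"
proof (rule equivpI)
  show "reflp weyl_rel"
    by (simp add: reflp_def weyl_rel_def weyl_ideal.zero)
  show "symp weyl_rel"
    using weyl_ideal_uminus by (fastforce simp: symp_def weyl_rel_def)
  show "transp weyl_rel"
    using weyl_ideal.add by (fastforce simp: transp_def weyl_rel_def)
qed

quotient_type (overloaded) 'k weyl = "weyl_gen word \<Rightarrow>\<^sub>0 'k::field" / weyl_rel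
  by (rule weyl_rel_equivp)

instantiation weyl :: (field) ring_1
begin

lift_definition zero_weyl :: "'a weyl" is 0 .

lift_definition one_weyl :: "'a weyl" is 1 .

lift_definition plus_weyl :: "'a weyl \<Rightarrow> 'a weyl \<Rightarrow> 'a weyl" is "(+)"
  unfolding weyl_rel_def add_diff_add by (rule weyl_ideal.add)

lift_definition uminus_weyl :: "'a weyl \<Rightarrow> 'a weyl" is uminus
  unfolding weyl_rel_def minus_diff_minus by (rule weyl_ideal_uminus)

lift_definition minus_weyl :: "'a weyl \<Rightarrow> 'a weyl \<Rightarrow> 'a weyl" is "(-)"
  unfolding weyl_rel_def minus_diff_eq_minus_diff by (rule weyl_ideal_diff)

lift_definition times_weyl :: "'a weyl \<Rightarrow> 'a weyl \<Rightarrow> 'a weyl" is "(*)"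
proof -
  fix x x' y y' :: "weyl_gen word \<Rightarrow>\<^sub>0 'a"
  assume "weyl_rel x x'" "weyl_rel y y'"
  then have "(x - x') * y + x' * (y - y') \<in> weyl_ideal"
    by (simp add: weyl_rel_def weyl_ideal.add weyl_ideal_left weyl_ideal_right)
  then show "weyl_rel (x * y) (x' * y')"
    by (simp add: weyl_rel_def algebra_simps)
qed

lemma weyl_zero_neq_one: "(0::'a weyl) \<noteq> 1"
proof (transfer, rule notI)
  assume "weyl_rel (0 :: weyl_gen word \<Rightarrow>\<^sub>0 'a) 1"
  then have "free_action (0 - 1 :: weyl_gen word \<Rightarrow>\<^sub>0 'a) 1 = 0"
    unfolding weyl_rel_def by (rule free_action_ideal)
  then show False by (simp only: free_action_simps free_action_one) simp
qed

instance
proof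
  fix a b c :: "'a weyl"
  show "a + b + c = a + (b + c)" "a + b = b + a" "0 + a = a" "- a + a = 0" "a - b = a + - b"
    "a * b * c = a * (b * c)" "(a + b) * c = a * c + b * c" "a * (b + c) = a * b + a * c"
    "1 * a = a" "a * 1 = a"
    by (transfer; simp add: weyl_rel_def weyl_ideal.zero mult.assoc distrib_left distrib_right)+
  show "(0::'a weyl) \<noteq> 1" by (rule weyl_zero_neq_one)
qed

end

lift_definition scale1 :: "'k::field \<Rightarrow> 'k weyl \<Rightarrow> 'k weyl" is
  "\<lambda>c x. Poly_Mapping.single 0 c * x"
  unfolding weyl_rel_def right_diff_distrib[symmetric] by (rule weyl_ideal_left)

global_interpretation A1: k_algebra "scale1 :: 'k::field \<Rightarrow> 'k weyl \<Rightarrow> 'k weyl"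
  apply standard
       apply (transfer; simp add: algebra_simps weyl_rel_def weyl_ideal.zero single_add)
      apply (transfer; simp add: algebra_simps weyl_rel_def weyl_ideal.zero single_add)
     apply (transfer; simp add: mult_single weyl_rel_def weyl_ideal.zero flip: mult.assoc)
    apply (transfer; simp add: weyl_rel_def weyl_ideal.zero)
   apply (transfer; simp add: weyl_rel_def weyl_ideal.zero mult.assoc)
  apply (transfer; simp add: weyl_rel_def weyl_ideal.zero single_zero_commute mult.assoc)
  done

lift_definition weyl_p :: "'k::field weyl" is "free_gen Gen_p" .

lift_definition weyl_q :: "'k::field weyl" is "free_gen Gen_q" .

lemma weyl_relation: "weyl_q * weyl_p - weyl_p * weyl_q = (1 :: 'k::field weyl)"
  by transfer (simp add: weyl_rel_def weyl_ideal.relation)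

text \<open>The monoid \<open>A\<^sub>1 \<times> A\<^sub>1\<close> with componentwise multiplication, again written additively. Its monoid
  algebra is the free vector space on \<open>A\<^sub>1 \<times> A\<^sub>1\<close> with \<open>(a, b) (a', b') = (a a', b b')\<close>, and the
  tensor product is its quotient by the subspace generated by the bilinearity relations.\<close>

datatype 'a formal_tensor = Formal 'a 'a

instantiation formal_tensor :: (monoid_mult) monoid_add
begin

definition "0 = Formal 1 1"

fun plus_formal_tensor :: "'a formal_tensor \<Rightarrow> 'a formal_tensor \<Rightarrow> 'a formal_tensor" where
  "Formal a b + Formal c d = Formal (a * c) (b * d)"

instance
proof
  fix u v w :: "'a formal_tensor"
  show "u + v + w = u + (v + w)"
    by (cases u; cases v; cases w) (simp add: mult.assoc)
  show "0 + u = u" "u + 0 = u"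
    by (cases u; simp add: zero_formal_tensor_def)+
qed

end

abbreviation formal :: "'k weyl \<Rightarrow> 'k weyl \<Rightarrow> ('k weyl formal_tensor \<Rightarrow>\<^sub>0 'k::field)"
  where "formal a b \<equiv> Poly_Mapping.single (Formal a b) 1"

inductive_set tensor_null :: "('k weyl formal_tensor \<Rightarrow>\<^sub>0 'k::field) set" where
  zero: "0 \<in> tensor_null"
| add: "x \<in> tensor_null \<Longrightarrow> y \<in> tensor_null \<Longrightarrow> x + y \<in> tensor_null"
| scale: "x \<in> tensor_null \<Longrightarrow> Poly_Mapping.single 0 c * x \<in> tensor_null"
| add_left: "formal (a + a') b - formal a b - formal a' b \<in> tensor_null"
| add_right: "formal a (b + b') - formal a b - formal a b' \<in> tensor_null"
| scale_left: "formal (scale1 c a) b - Poly_Mapping.single (Formal a b) c \<in> tensor_null"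
| scale_right: "formal a (scale1 c b) - Poly_Mapping.single (Formal a b) c \<in> tensor_null"

lemma tensor_null_uminus: "x \<in> tensor_null \<Longrightarrow> - x \<in> tensor_null"
  using tensor_null.scale[of x "- 1"] by (simp add: single_uminus)

lemma tensor_null_diff: "x \<in> tensor_null \<Longrightarrow> y \<in> tensor_null \<Longrightarrow> x - y \<in> tensor_null"
  using tensor_null.add[OF _ tensor_null_uminus, of x y] by simp

lemma single_split:
  "Poly_Mapping.single k c = Poly_Mapping.single 0 c * Poly_Mapping.single k (1::'k::field)"
  for k :: "'m::monoid_add"
  by (simp add: mult_single)

lemma scale_mult_commute:
  "x * (Poly_Mapping.single 0 c * y) = Poly_Mapping.single 0 c * (x * y)"
  for x :: "'m::monoid_add \<Rightarrow>\<^sub>0 'k::field"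
  by (simp only: mult.assoc[symmetric] single_zero_commute[of c x, symmetric])

lemma tensor_null_formal_left: "x \<in> tensor_null \<Longrightarrow> formal u v * x \<in> tensor_null"
proof (induction x rule: tensor_null.induct)
  case (scale x c)
  then show ?case
    unfolding scale_mult_commute by (intro tensor_null.scale)
next
  case (add x y)
  then show ?case
    unfolding distrib_left by (intro tensor_null.add)
next
  case (add_left a a' b)
  show ?case
    using tensor_null.add_left[of "u * a" "u * a'" "v * b"]
    by (simp add: right_diff_distrib mult_single distrib_left)
next
  case (add_right a b b')
  show ?case
    using tensor_null.add_right[of "u * a" "v * b" "v * b'"]
    by (simp add: right_diff_distrib mult_single distrib_left)
next
  case (scale_left c a b)
  show ?case
    using tensor_null.scale_left[of c "u * a" "v * b"]
    by (simp add: right_diff_distrib mult_single A1.scale_mult_right)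
next
  case (scale_right a c b)
  show ?case
    using tensor_null.scale_right[of "u * a" c "v * b"]
    by (simp add: right_diff_distrib mult_single A1.scale_mult_right)
qed (simp add: tensor_null.zero)

lemma tensor_null_formal_right: "x \<in> tensor_null \<Longrightarrow> x * formal u v \<in> tensor_null"
proof (induction x rule: tensor_null.induct)
  case (scale x c)
  then show ?case
    unfolding mult.assoc by (intro tensor_null.scale)
next
  case (add x y)
  then show ?case
    unfolding distrib_right by (intro tensor_null.add)
next
  case (add_left a a' b)
  show ?case
    using tensor_null.add_left[of "a * u" "a' * u" "b * v"]
    by (simp add: left_diff_distrib mult_single distrib_right)
next
  case (add_right a b b')
  show ?case
    using tensor_null.add_right[of "a * u" "b * v" "b' * v"]
    by (simp add: left_diff_distrib mult_single distrib_right)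
next
  case (scale_left c a b)
  show ?case
    using tensor_null.scale_left[of c "a * u" "b * v"]
    by (simp add: left_diff_distrib mult_single A1.scale_mult_left)
next
  case (scale_right a c b)
  show ?case
    using tensor_null.scale_right[of "a * u" c "b * v"]
    by (simp add: left_diff_distrib mult_single A1.scale_mult_left)
qed (simp add: tensor_null.zero)

lemma tensor_null_left: "x \<in> tensor_null \<Longrightarrow> y * x \<in> tensor_null"
proof (induction y rule: poly_mapping_single_induct)
  case (single k c)
  obtain u v where k: "k = Formal u v" by (cases k)
  have "Poly_Mapping.single k c * x = Poly_Mapping.single 0 c * (formal u v * x)"
    by (simp only: k single_split[of "Formal u v" c] mult.assoc)
  with single show ?case
    by (simp only: tensor_null.scale tensor_null_formal_left)
next
  case (add y z)
  then show ?case
    unfolding distrib_right by (intro tensor_null.add)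
qed (simp add: tensor_null.zero)

lemma tensor_null_right: "x \<in> tensor_null \<Longrightarrow> x * y \<in> tensor_null"
proof (induction y rule: poly_mapping_single_induct)
  case (single k c)
  obtain u v where k: "k = Formal u v" by (cases k)
  have "x * Poly_Mapping.single k c = Poly_Mapping.single 0 c * (x * formal u v)"
    by (simp only: k single_split[of "Formal u v" c] scale_mult_commute)
  with single show ?case
    by (simp only: tensor_null.scale tensor_null_formal_right)
next
  case (add y z)
  then show ?case
    unfolding distrib_left by (intro tensor_null.add)
qed (simp add: tensor_null.zero)

text \<open>The functional \<open>a \<otimes> b \<mapsto> \<phi>(a) \<phi>(b)\<close>, where \<open>\<phi>(a)\<close> is the constant coefficient of \<open>a\<close> acting on
  \<open>1 \<in> K[X]\<close>, shows that the tensor product is not zero.\<close>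

lift_definition weyl_functional :: "'k::field weyl \<Rightarrow> 'k" is "\<lambda>x. coeff (free_action x 1) 0"
proof -
  fix x y :: "weyl_gen word \<Rightarrow>\<^sub>0 'k"
  assume "weyl_rel x y"
  then have "free_action (x - y) 1 = 0"
    unfolding weyl_rel_def by (rule free_action_ideal)
  then show "coeff (free_action x 1) 0 = coeff (free_action y 1) 0" by simp
qed

lemma weyl_functional_simps [simp]:
  "weyl_functional (a + b) = weyl_functional a + weyl_functional b"
  "weyl_functional (scale1 c a) = c * weyl_functional a"
  "weyl_functional 1 = 1"
  by (transfer, simp add: word_action_def zero_word_def)+

definition tensor_functional :: "('k weyl formal_tensor \<Rightarrow>\<^sub>0 'k::field) \<Rightarrow> 'k"
  where "tensor_functional =
    lin_ext (*) (\<lambda>k. case k of Formal a b \<Rightarrow> weyl_functional a * weyl_functional b)"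

lemma tensor_functional_null: "x \<in> tensor_null \<Longrightarrow> tensor_functional x = 0"
  unfolding tensor_functional_def
  by (induction x rule: tensor_null.induct)
    (simp_all add: lin_ext_field algebra_simps)

definition tensor_rel ::
  "('k weyl formal_tensor \<Rightarrow>\<^sub>0 'k::field) \<Rightarrow> ('k weyl formal_tensor \<Rightarrow>\<^sub>0 'k) \<Rightarrow> bool"
  where "tensor_rel x y \<longleftrightarrow> x - y \<in> tensor_null"

lemma tensor_rel_equivp: "equivp tensor_rel"
proof (rule equivpI)
  show "reflp tensor_rel"
    by (simp add: reflp_def tensor_rel_def tensor_null.zero)
  show "symp tensor_rel"
    using tensor_null_uminus by (fastforce simp: symp_def tensor_rel_def)
  show "transp tensor_rel"
    using tensor_null.add by (fastforce simp: transp_def tensor_rel_def)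
qed

quotient_type (overloaded) 'k weyl2 = "'k weyl formal_tensor \<Rightarrow>\<^sub>0 'k::field" / tensor_rel
  by (rule tensor_rel_equivp)

instantiation weyl2 :: (field) ring_1
begin

lift_definition zero_weyl2 :: "'a weyl2" is 0 .

lift_definition one_weyl2 :: "'a weyl2" is 1 .

lift_definition plus_weyl2 :: "'a weyl2 \<Rightarrow> 'a weyl2 \<Rightarrow> 'a weyl2" is "(+)"
  unfolding tensor_rel_def add_diff_add by (rule tensor_null.add)

lift_definition uminus_weyl2 :: "'a weyl2 \<Rightarrow> 'a weyl2" is uminus
  unfolding tensor_rel_def minus_diff_minus by (rule tensor_null_uminus)

lift_definition minus_weyl2 :: "'a weyl2 \<Rightarrow> 'a weyl2 \<Rightarrow> 'a weyl2" is "(-)"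
  unfolding tensor_rel_def minus_diff_eq_minus_diff by (rule tensor_null_diff)

lift_definition times_weyl2 :: "'a weyl2 \<Rightarrow> 'a weyl2 \<Rightarrow> 'a weyl2" is "(*)"
proof -
  fix x x' y y' :: "'a weyl formal_tensor \<Rightarrow>\<^sub>0 'a"
  assume "tensor_rel x x'" "tensor_rel y y'"
  then have "(x - x') * y + x' * (y - y') \<in> tensor_null"
    by (simp add: tensor_rel_def tensor_null.add tensor_null_left tensor_null_right)
  then show "tensor_rel (x * y) (x' * y')"
    by (simp add: tensor_rel_def algebra_simps)
qed

lemma weyl2_zero_neq_one: "(0::'a weyl2) \<noteq> 1"
proof (transfer, rule notI)
  assume "tensor_rel (0 :: 'a weyl formal_tensor \<Rightarrow>\<^sub>0 'a) 1"
  then have "tensor_functional (0 - 1 :: 'a weyl formal_tensor \<Rightarrow>\<^sub>0 'a) = 0"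
    unfolding tensor_rel_def by (rule tensor_functional_null)
  moreover have "tensor_functional (0 - 1 :: 'a weyl formal_tensor \<Rightarrow>\<^sub>0 'a) = - 1"
    unfolding tensor_functional_def lin_ext_field(4) single_one[symmetric]
    by (simp add: zero_formal_tensor_def lin_ext_field)
  ultimately show False by simp
qed

instance
proof
  fix a b c :: "'a weyl2"
  show "a + b + c = a + (b + c)" "a + b = b + a" "0 + a = a" "- a + a = 0" "a - b = a + - b"
    "a * b * c = a * (b * c)" "(a + b) * c = a * c + b * c" "a * (b + c) = a * b + a * c"
    "1 * a = a" "a * 1 = a"
    by (transfer; simp add: tensor_rel_def tensor_null.zero mult.assoc distrib_left distrib_right)+
  show "(0::'a weyl2) \<noteq> 1" by (rule weyl2_zero_neq_one)
qed

end

lift_definition scale2 :: "'k::field \<Rightarrow> 'k weyl2 \<Rightarrow> 'k weyl2" is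
  "\<lambda>c x. Poly_Mapping.single 0 c * x"
  unfolding tensor_rel_def right_diff_distrib[symmetric] by (rule tensor_null.scale)

global_interpretation A2: k_algebra "scale2 :: 'k::field \<Rightarrow> 'k weyl2 \<Rightarrow> 'k weyl2"
  apply standard
       apply (transfer; simp add: algebra_simps tensor_rel_def tensor_null.zero single_add)
      apply (transfer; simp add: algebra_simps tensor_rel_def tensor_null.zero single_add)
     apply (transfer; simp add: mult_single tensor_rel_def tensor_null.zero flip: mult.assoc)
    apply (transfer; simp add: tensor_rel_def tensor_null.zero)
   apply (transfer; simp add: tensor_rel_def tensor_null.zero mult.assoc)
  apply (transfer; simp add: tensor_rel_def tensor_null.zero single_zero_commute mult.assoc)
  done

lift_definition tensor :: "'k::field weyl \<Rightarrow> 'k weyl \<Rightarrow> 'k weyl2"  (infixl \<open>\<otimes>\<^sub>K\<close> 70) is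
  "\<lambda>a b. formal a b" .

lemma tensor_bilinear:
  "(a + a') \<otimes>\<^sub>K b = a \<otimes>\<^sub>K b + a' \<otimes>\<^sub>K b"
  "a \<otimes>\<^sub>K (b + b') = a \<otimes>\<^sub>K b + a \<otimes>\<^sub>K b'"
  "scale1 c a \<otimes>\<^sub>K b = scale2 c (a \<otimes>\<^sub>K b)"
  "a \<otimes>\<^sub>K scale1 c b = scale2 c (a \<otimes>\<^sub>K b)"
  by (transfer; simp add: tensor_rel_def mult_single tensor_null.intros flip: diff_diff_eq)+

lemma tensor_mult: "(a \<otimes>\<^sub>K b) * (c \<otimes>\<^sub>K d) = (a * c) \<otimes>\<^sub>K (b * d)"
  by transfer (simp add: tensor_rel_def mult_single tensor_null.zero)

lemma tensor_one: "1 \<otimes>\<^sub>K 1 = 1"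
  by transfer (simp flip: single_one add: zero_formal_tensor_def tensor_rel_def tensor_null.zero)

text \<open>The image of \<open>U \<otimes> V\<close> in \<open>A\<^sub>1 \<otimes> A\<^sub>1\<close>, for subspaces \<open>U\<close> and \<open>V\<close> of \<open>A\<^sub>1\<close>. Over a field this image
  is the tensor product of the two subspaces.\<close>

definition tensor_subspace :: "'k::field weyl set \<Rightarrow> 'k weyl set \<Rightarrow> 'k weyl2 set"
  where "tensor_subspace U V = A2.span {u \<otimes>\<^sub>K v | u v. u \<in> U \<and> v \<in> V}"

end

(*
  The Weyl algebra embeds into a division ring of formal pseudo-differential operators, in which the
  centralizer of an operator of positive order is commutative and has at most one dimension in each
  order.

  Suppose that ad z has an eigenvector y with a non-zero eigenvalue. If ad z also had a nilpotent
  vector outside C(z), then the Weyl algebra would have cubic growth; hence N(z) = C(z). Moreover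
  conjugation s by y acts on the centralizer of z, and s - 1 lowers the order. The algebra generated by
  the conjugates of C(z) has no elements of negative order, because a power of y multiplies it into
  the Weyl algebra. So s - 1 is locally nilpotent on it, its invariants are scalars, and C(z) = K[z].

  In the second factor, left and right multiplication by z2 agree on leading coefficients, so that
  modulo lower order the adjoint action of z1 (x) z2 is that of z1 on the first factor. By symmetry
  N(z1 (x) z2) = N(z1) (x) N(z2), and the only eigenvalue is 0.
*)
theory Submission
  imports Defs "HOL-Computational_Algebra.Formal_Laurent_Series"
begin

subsection \<open>Symbols of pseudo-differential operators\<close>

text \<open>Every order argument rests on one computation: if \<open>Z\<close> and \<open>U\<close>
  have leading coefficients \<open>f\<close> and \<open>g\<close> in orders \<open>n\<close> and
  \<open>m\<close>, the coefficient of \<open>[Z, U]\<close> in order \<open>n + m - 1\<close> is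
  \<open>n f g' - m f' g\<close>. For an eigenvector \<open>U\<close> this is a linear first-order
  differential equation for \<open>g\<close>, whose solution is unique up to scalars; hence the
  bound of one dimension in each order. It needs \<open>n >= 1\<close>, but a polynomial in
  \<open>p\<close> has order 0 as a differential operator, so a second embedding exchanges the roles
  of the generators. Division is needed for the inverse of \<open>y\<close> and for negative powers
  inside a centralizer. The obstacle with an eigenvector is that conjugates of C(z) leave the Weyl
  algebra, where orders could drop for ever. Once they are bounded below, \<open>s\<close> acts on
  K[z] as z -> z + l, so \<open>s - 1\<close> is a difference operator, and K[z] is recovered by
  subtracting powers of z. For tensors, N(z1) is used rather than C(z1) because it contains every
  \<open>w\<close> with \<open>[z1, w]\<close> in N(z1); C is found inside N afterwards.\<close>

text \<open>A symbol \<open>\<Sum>\<^sub>i \<xi>\<^sup>i b\<^sub>i\<close> with coefficients \<open>b\<^sub>i\<close> in \<open>K((x))\<close>, written to the right of the powers of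
  \<open>\<xi> = d/dx\<close>, is a Laurent series in \<open>\<xi>\<^sup>-\<^sup>1\<close>: its exponents are the negatives of the orders \<open>i\<close>.\<close>

definition co :: "'k::field_char_0 fls fls \<Rightarrow> int \<Rightarrow> 'k fls"
  where "co b i = fls_nth b (- i)"

definition dle :: "'k::field_char_0 fls fls \<Rightarrow> int \<Rightarrow> bool"
  where "dle b m \<longleftrightarrow> (\<forall>i>m. co b i = 0)"

definition sderiv :: "'k::field_char_0 fls fls \<Rightarrow> 'k fls fls"
  where "sderiv b = Abs_fls (\<lambda>e. fls_deriv (fls_nth b e))"

text \<open>The formal derivative in \<open>xi\<close>: with \<open>e = - i\<close> the factor
  \<open>1 - e\<close> is \<open>i + 1\<close>, the exponent that comes down from
  \<open>xi^(i+1)\<close>.\<close>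

definition sderiv_xi :: "'k::field_char_0 fls fls \<Rightarrow> 'k fls fls"
  where "sderiv_xi b = Abs_fls (\<lambda>e. of_int (1 - e) * fls_nth b (e - 1))"

definition mono :: "int \<Rightarrow> 'k::field_char_0 fls \<Rightarrow> 'k fls fls"
  where "mono i h = fls_shift i (fls_const h)"

text \<open>Multiplication by \<open>\<xi>\<close> from the right, since \<open>b\<^sub>i \<xi> = \<xi> b\<^sub>i - b\<^sub>i'\<close>.\<close>

definition right_xi :: "'k::field_char_0 fls fls \<Rightarrow> 'k fls fls"
  where "right_xi b = fls_shift 1 b - sderiv b"

lemma fls_bounded_below: obtains n where "\<And>e. e < n \<Longrightarrow> fls_nth b e = 0"
  using fls_eq0_below_subdegree by blast

lemma co_simps [simp]:
  "co (a + b) i = co a i + co b i" "co (a - b) i = co a i - co b i" "co (- a) i = - co a i"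
  "co 0 i = 0" "co 1 i = (if i = 0 then 1 else 0)"
  "co (b * fls_const h) i = co b i * h" "co (fls_const h * b) i = h * co b i"
  "co (fls_const h) i = (if i = 0 then h else 0)"
  "co (mono j h) i = (if i = j then h else 0)"
  "co (fls_shift j b) i = co b (i - j)"
  by (auto simp: co_def mono_def)

lemma co_sderiv [simp]: "co (sderiv b) i = fls_deriv (co b i)"
proof -
  obtain n where "\<And>e. e < n \<Longrightarrow> fls_nth b e = 0" using fls_bounded_below[of b] by blast
  then show ?thesis
    unfolding sderiv_def co_def by (subst nth_Abs_fls_lower_bound[of n]) auto
qed

lemma co_sderiv_xi [simp]: "co (sderiv_xi b) i = of_int (i + 1) * co b (i + 1)"
proof -
  obtain n where n: "\<And>e. e < n \<Longrightarrow> fls_nth b e = 0" using fls_bounded_below[of b] by blast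
  then show ?thesis
    unfolding sderiv_xi_def co_def by (subst nth_Abs_fls_lower_bound[of n]) (auto simp: algebra_simps minus_diff_commute)
qed

lemma co_right_xi [simp]: "co (right_xi b) i = co b (i - 1) - fls_deriv (co b i)"
  by (simp add: right_xi_def)

lemma co_eqI: "(\<And>i. co a i = co b i) \<Longrightarrow> a = b"
  by (rule fls_eqI) (metis co_def minus_minus)

lemma dle_ex: obtains m where "dle b m"
proof -
  obtain n where "\<And>e. e < n \<Longrightarrow> fls_nth b e = 0" using fls_bounded_below[of b] by blast
  then have "dle b (- n)" by (auto simp: dle_def co_def)
  then show thesis by (rule that)
qed

lemma dle_mono: "dle b m \<Longrightarrow> m \<le> n \<Longrightarrow> dle b n"
  by (auto simp: dle_def)

lemma dle_pred:
  assumes "dle b m" "co b m = 0"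
  shows "dle b (m - 1)"
  unfolding dle_def
proof (intro allI impI)
  fix i assume "m - 1 < i"
  with assms show "co b i = 0" by (cases "i = m") (simp_all add: dle_def)
qed

text \<open>A Laurent series in \<open>xi^-1\<close> has some bound on its orders, so stripping
  vanishing top coefficients reaches \<open>m\<close> after finitely many steps.\<close>

lemma dle_descend:
  assumes step: "\<And>j. j > m \<Longrightarrow> dle b j \<Longrightarrow> co b j = 0"
  shows "dle b m"
proof -
  have "dle b (m + int k) \<Longrightarrow> dle b m" for k
  proof (induction k)
    case (Suc k)
    have "dle b (m + int (Suc k) - 1)"
      by (rule dle_pred[OF Suc.prems step[OF _ Suc.prems]]) simp
    then show ?case using Suc.IH by simp
  qed simp
  moreover obtain M where "dle b M" by (rule dle_ex[of b])
  then have "dle b (m + int (nat (M - m)))" by (rule dle_mono) simp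
  ultimately show ?thesis by blast
qed

lemma dle_add: "dle a m \<Longrightarrow> dle b m \<Longrightarrow> dle (a + b) m"
  by (auto simp: dle_def)

lemma dle_diff: "dle a m \<Longrightarrow> dle b m \<Longrightarrow> dle (a - b) m"
  by (auto simp: dle_def)

text \<open>A pseudo-differential operator is encoded by its left multiplication on symbols, that is, by a
  bounded map that commutes with right multiplications. The ring structure is then composition, and
  no product formula for symbols is needed.\<close>

definition pdo_op :: "('k::field_char_0 fls fls \<Rightarrow> 'k fls fls) \<Rightarrow> bool"
  where "pdo_op T \<longleftrightarrow> (\<forall>a b. T (a + b) = T a + T b) \<and>
    (\<forall>b h. T (b * fls_const h) = T b * fls_const h) \<and>
    (\<forall>b. T (right_xi b) = right_xi (T b)) \<and>
    (\<exists>N. \<forall>b m. dle b m \<longrightarrow> dle (T b) (m + N))"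

lemma pdo_opI:
  assumes "\<And>a b. T (a + b) = T a + T b" "\<And>b h. T (b * fls_const h) = T b * fls_const h"
    "\<And>b. T (right_xi b) = right_xi (T b)" "\<And>b m. dle b m \<Longrightarrow> dle (T b) (m + N)"
  shows "pdo_op T"
  using assms unfolding pdo_op_def by blast

lemma right_xi_add: "right_xi (a + b) = right_xi a + right_xi b"
  by (rule co_eqI) simp

lemma right_xi_minus: "right_xi (- a) = - right_xi a"
  by (rule co_eqI) simp

lemma right_xi_mono: "right_xi (mono i 1) = mono (i + 1) 1"
  by (rule co_eqI) auto

lemma dle_right_xi:
  assumes "dle (right_xi b) (m + 1)"
  shows "dle b m"
proof (rule dle_descend)
  fix j assume "j > m" "dle b j"
  then have "co (right_xi b) (j + 1) = 0" "co b (j + 1) = 0"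
    using assms unfolding dle_def by (simp_all del: co_right_xi)
  then show "co b j = 0" by simp
qed

section \<open>Leading coefficients, injectivity and surjectivity of an operator\<close>

context
  fixes T :: "'k::field_char_0 fls fls \<Rightarrow> 'k fls fls"
  assumes T: "pdo_op T"
begin

lemma op_add: "T (a + b) = T a + T b"
  and op_scale: "T (b * fls_const h) = T b * fls_const h"
  and op_right_xi: "T (right_xi b) = right_xi (T b)"
  using T by (auto simp: pdo_op_def)

lemma op_zero: "T 0 = 0"
  using op_add[of 0 0] by simp

lemma op_diff: "T (a - b) = T a - T b"
  using op_add[of "a - b" b] by (simp add: algebra_simps)

lemma op_bounded: obtains N where "\<And>b m. dle b m \<Longrightarrow> dle (T b) (m + N)"
  using T by (auto simp: pdo_op_def)

text \<open>\<open>T (xi^i)\<close> is \<open>T 1\<close> times \<open>xi^i\<close>, and moving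
  \<open>xi^i\<close> to the left of a coefficient \<open>a\<close> gives
  \<open>xi^i a - i xi^(i-1) a'\<close> plus lower terms. For negative \<open>i\<close> one divides
  by \<open>xi\<close> on the right, which \<open>dle_right_xi\<close> permits.\<close>

lemma op_mono:
  assumes "dle (T 1) n"
  shows "dle (T (mono i 1)) (n + i) \<and> co (T (mono i 1)) (n + i) = co (T 1) n \<and>
    co (T (mono i 1)) (n + i - 1) = co (T 1) (n - 1) - of_int i * fls_deriv (co (T 1) n)"
proof (induction i rule: int_induct[of _ 0])
  case base
  have "mono 0 1 = (1 :: 'k fls fls)" by (rule co_eqI) simp
  with assms show ?case by simp
next
  case (step1 i)
  have "T (mono (i + 1) 1) = right_xi (T (mono i 1))"
    by (simp flip: right_xi_mono add: op_right_xi)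
  moreover have "n + (i + 1) - 1 = n + i" by simp
  ultimately show ?case using step1 by (auto simp: dle_def algebra_simps)
next
  case (step2 i)
  define b where "b = T (mono (i - 1) 1)"
  have "T (mono i 1) = right_xi b"
    using op_right_xi[of "mono (i - 1) 1"] by (simp add: b_def right_xi_mono)
  with step2 have r: "dle (right_xi b) (n + i)" "co (right_xi b) (n + i) = co (T 1) n"
    "co (right_xi b) (n + i - 1) = co (T 1) (n - 1) - of_int i * fls_deriv (co (T 1) n)"
    by auto
  have "dle b (n + i - 1)" by (rule dle_right_xi) (use r(1) in simp)
  then have top: "co b j = 0" if "j > n + i - 1" for j using that by (simp add: dle_def)
  have "dle b (n + i - 1)" by fact
  moreover have "co b (n + i - 1) = co (T 1) n" using r(2) top by simp
  moreover have "co b (n + i - 2) = co (T 1) (n - 1) - of_int (i - 1) * fls_deriv (co (T 1) n)"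
    using r(3) \<open>co b (n + i - 1) = co (T 1) n\<close> by (simp add: algebra_simps)
  ultimately show ?case by (simp add: b_def algebra_simps)
qed


lemma op_dle:
  assumes n: "dle (T 1) n" and b: "dle b m"
  shows "dle (T b) (n + m)"
proof -
  obtain N where N: "\<And>b m. dle b m \<Longrightarrow> dle (T b) (m + N)" using op_bounded by blast
  \<comment> \<open>The bound \<open>N\<close> is crude but uniform. \<open>K\<close> counts the top
    terms to be split off before it excludes order \<open>l\<close>; each term split off obeys the
    sharp bound by \<open>op_mono\<close>.\<close>
  have *: "co (T b) l = 0" if "dle b m" "l > n + m" "l > m + N - int K" for K l b m
    using that
  proof (induction K arbitrary: b m)
    case 0
    then show ?case using N[of b m] by (simp add: dle_def)
  next
    case (Suc K)
    define c where "c = b - mono m 1 * fls_const (co b m)"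
    have c: "dle c (m - 1)" using Suc.prems(1) by (auto simp: c_def dle_def)
    have "b = mono m 1 * fls_const (co b m) + c" by (simp add: c_def)
    then have "T b = T (mono m 1) * fls_const (co b m) + T c"
      using op_add op_scale by metis
    moreover have "co (T c) l = 0" using Suc.IH[OF c] Suc.prems by simp
    moreover have "co (T (mono m 1)) l = 0"
      using op_mono[OF n, of m] Suc.prems by (simp add: dle_def)
    ultimately show ?case by simp
  qed
  show ?thesis unfolding dle_def
  proof (intro allI impI)
    fix l assume "l > n + m"
    then show "co (T b) l = 0" using *[OF b, of l "nat (m + N - l) + 1"] by simp
  qed
qed

lemma op_top:
  assumes n: "dle (T 1) n" and b: "dle b m"
  shows "co (T b) (n + m) = co (T 1) n * co b m"
    and "co (T b) (n + m - 1) = co (T 1) n * co b (m - 1) +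
      (co (T 1) (n - 1) - of_int m * fls_deriv (co (T 1) n)) * co b m"
proof -
  \<comment> \<open>Without its two top terms \<open>b\<close> has order at most
    \<open>m - 2\<close>, too low to influence order \<open>n + m - 1\<close> of the image.\<close>
  define c where "c = b - mono m 1 * fls_const (co b m) - mono (m - 1) 1 * fls_const (co b (m - 1))"
  have c: "dle c (m - 2)" using b by (auto simp: c_def dle_def)
  have Tc: "dle (T c) (n + (m - 2))" by (rule op_dle[OF n c])
  have "b = mono m 1 * fls_const (co b m) + mono (m - 1) 1 * fls_const (co b (m - 1)) + c"
    by (simp add: c_def)
  then have eq: "T b = T (mono m 1) * fls_const (co b m)
      + T (mono (m - 1) 1) * fls_const (co b (m - 1)) + T c"
    using op_add op_scale by metis
  note 1 = op_mono[OF n, of m] and 2 = op_mono[OF n, of "m - 1"]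
  have "n + (m - 1) = n + m - 1" by simp
  with 1 2 Tc show "co (T b) (n + m) = co (T 1) n * co b m"
    and "co (T b) (n + m - 1) = co (T 1) n * co b (m - 1) +
      (co (T 1) (n - 1) - of_int m * fls_deriv (co (T 1) n)) * co b m"
    unfolding eq by (simp_all add: dle_def)
qed

lemma op_eq_0:
  assumes "T 1 = 0"
  shows "T b = 0"
proof (rule co_eqI)
  fix i
  obtain m where m: "dle b m" by (rule dle_ex[of b])
  have "dle (T 1) (i - 1 - m)" using assms by (simp add: dle_def)
  from op_dle[OF this m] show "co (T b) i = co 0 i" by (simp add: dle_def)
qed

lemma op_injective:
  assumes n: "dle (T 1) n" "co (T 1) n \<noteq> 0" and b: "dle (T b) (n + m)"
  shows "dle b m"
proof (rule dle_descend)
  fix j assume "j > m" "dle b j"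
  then have "co (T b) (n + j) = 0" using b by (simp add: dle_def)
  with op_top(1)[OF n(1) \<open>dle b j\<close>] n(2) show "co b j = 0" by simp
qed

lemma op_surjective:
  assumes n: "dle (T 1) n" "co (T 1) n \<noteq> 0"
  obtains b where "T b = c"
proof -
  obtain m where m: "dle c m" by (rule dle_ex[of c])
  \<comment> \<open>Each step cancels the top coefficient of the current error, dividing by the
    leading coefficient of \<open>T 1\<close> in the field K((x)).\<close>
  define nxt where "nxt k s = s + mono (m - int k - n) (co (c - T s) (m - int k) / co (T 1) n)"
    for k :: nat and s
  define s where "s = rec_nat 0 nxt"
  have s: "s 0 = 0" "s (Suc k) = nxt k (s k)" for k by (simp_all add: s_def)
  have step: "dle (c - T (s k)) (m - int k)" for k
  proof (induction k)
    case 0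
    then show ?case using m by (simp add: s op_zero)
  next
    case (Suc k)
    let ?d = "mono (m - int k - n) (co (c - T (s k)) (m - int k) / co (T 1) n)"
    have d: "dle ?d (m - int k - n)" by (simp add: dle_def)
    have eq: "c - T (s (Suc k)) = c - T (s k) - T ?d"
      by (simp add: s nxt_def op_add)
    have "dle (T ?d) (m - int k)" using op_dle[OF n(1) d] by simp
    then have "dle (c - T (s (Suc k))) (m - int k)"
      unfolding eq by (rule dle_diff[OF Suc.IH])
    moreover have "co (T ?d) (m - int k) = co (c - T (s k)) (m - int k)"
      using op_top(1)[OF n(1) d] n(2) by simp
    then have "co (c - T (s (Suc k))) (m - int k) = 0" unfolding eq co_simps(2) by simp
    ultimately have "dle (c - T (s (Suc k))) (m - int k - 1)" by (rule dle_pred)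
    then show ?case by (simp add: algebra_simps)
  qed
  have s_ge: "co (s k) i = 0" if "i > m - n" for k i
    using that by (induction k) (simp_all add: s nxt_def)
  have s_stable: "co (s (Suc k + l)) i = co (s (Suc k)) i" if "i \<ge> m - n - int k" for k l i
    using that by (induction l) (simp_all add: s nxt_def)
  \<comment> \<open>The coefficient at \<open>xi^i\<close> is set in step \<open>m - n - i\<close>
    and never changes afterwards, so the approximations converge coefficientwise to
    \<open>b\<close>; here \<open>e = - i\<close>.\<close>
  define b where "b = Abs_fls (\<lambda>e. co (s (Suc (nat (m - n + e)))) (- e))"
  have b: "co b i = co (s (Suc (nat (m - n - i)))) i" for i
    unfolding b_def co_def[of "Abs_fls _"]
    by (subst nth_Abs_fls_lower_bound[of "n - m"]) (auto simp: s_ge)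
  have rem: "dle (b - s (Suc k)) (m - n - int k - 1)" for k
  proof -
    have "co b i = co (s (Suc k)) i" if i: "i > m - n - int k - 1" for i
    proof (cases "i > m - n")
      case True
      then show ?thesis by (simp add: b s_ge)
    next
      case False
      with i have "nat (m - n - i) \<le> k" by simp
      then obtain l where "k = nat (m - n - i) + l" by (auto simp: le_iff_add)
      then show ?thesis using s_stable[of "nat (m - n - i)" i l] False by (simp add: b)
    qed
    then show ?thesis by (simp add: dle_def)
  qed
  have "T b = c"
  proof (rule co_eqI)
    fix i
    define k where "k = nat (m - i)"
    have "dle (T (b - s (Suc k))) (n + (m - n - int k - 1))"
      by (rule op_dle[OF n(1) rem])
    moreover have "dle (c - T (s (Suc k))) (m - int (Suc k))" by (rule step)
    moreover have "i > m - int (Suc k)" by (simp add: k_def)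
    ultimately show "co (T b) i = co c i"
      by (simp add: op_diff dle_def)
  qed
  then show thesis by (rule that)
qed

end

subsection \<open>The division ring of pseudo-differential operators\<close>

typedef (overloaded) 'k pdo = "{T :: 'k::field_char_0 fls fls \<Rightarrow> 'k fls fls. pdo_op T}"
  morphisms app Abs_pdo
proof
  show "(\<lambda>b. b) \<in> {T :: 'k fls fls \<Rightarrow> 'k fls fls. pdo_op T}"
    by (auto intro: pdo_opI[where N = 0])
qed

setup_lifting type_definition_pdo

lemma pdo_op_app: "pdo_op (app T)"
  using app[of T] by simp

instantiation pdo :: (field_char_0) ring_1
begin

lift_definition zero_pdo :: "'a pdo" is "\<lambda>b. 0"
  by (rule pdo_opI[where N = 0]) (auto intro!: co_eqI simp: dle_def)

lift_definition one_pdo :: "'a pdo" is "\<lambda>b. b"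
  by (rule pdo_opI[where N = 0]) auto

lift_definition plus_pdo :: "'a pdo \<Rightarrow> 'a pdo \<Rightarrow> 'a pdo" is "\<lambda>T U b. T b + U b"
proof -
  fix T U :: "'a fls fls \<Rightarrow> 'a fls fls"
  assume T: "pdo_op T" and U: "pdo_op U"
  obtain M where M: "\<And>b m. dle b m \<Longrightarrow> dle (T b) (m + M)" using op_bounded[OF T] by blast
  obtain N where N: "\<And>b m. dle b m \<Longrightarrow> dle (U b) (m + N)" using op_bounded[OF U] by blast
  have "dle (T b + U b) (m + max M N)" if "dle b m" for b m
    by (rule dle_add[OF dle_mono[OF M[OF that]] dle_mono[OF N[OF that]]]) simp_all
  then show "pdo_op (\<lambda>b. T b + U b)"
    by (intro pdo_opI[where N = "max M N"])
      (simp_all add: op_add[OF T] op_add[OF U] op_scale[OF T] op_scale[OF U]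
        op_right_xi[OF T] op_right_xi[OF U] right_xi_add distrib_right)
qed

lift_definition uminus_pdo :: "'a pdo \<Rightarrow> 'a pdo" is "\<lambda>T b. - T b"
proof -
  fix T :: "'a fls fls \<Rightarrow> 'a fls fls"
  assume T: "pdo_op T"
  obtain M where M: "\<And>b m. dle b m \<Longrightarrow> dle (T b) (m + M)"
    using op_bounded[OF T] by blast
  then have "dle (- T b) (m + M)" if "dle b m" for b m
    using that by (simp add: dle_def)
  then show "pdo_op (\<lambda>b. - T b)"
    by (intro pdo_opI[where N = M])
      (simp_all add: op_add[OF T] op_scale[OF T] op_right_xi[OF T] right_xi_minus)
qed

definition minus_pdo :: "'a pdo \<Rightarrow> 'a pdo \<Rightarrow> 'a pdo"
  where "minus_pdo T U = T + - U"

lift_definition times_pdo :: "'a pdo \<Rightarrow> 'a pdo \<Rightarrow> 'a pdo" is "\<lambda>T U b. T (U b)"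
proof -
  fix T U :: "'a fls fls \<Rightarrow> 'a fls fls"
  assume T: "pdo_op T" and U: "pdo_op U"
  obtain M where M: "\<And>b m. dle b m \<Longrightarrow> dle (T b) (m + M)" using op_bounded[OF T] by blast
  obtain N where N: "\<And>b m. dle b m \<Longrightarrow> dle (U b) (m + N)" using op_bounded[OF U] by blast
  have "dle (T (U b)) (m + (N + M))" if "dle b m" for b m
    using M[OF N[OF that]] by (simp add: add.assoc)
  then show "pdo_op (\<lambda>b. T (U b))"
    by (intro pdo_opI[where N = "N + M"])
      (simp_all add: op_add[OF T] op_add[OF U] op_scale[OF T] op_scale[OF U]
        op_right_xi[OF T] op_right_xi[OF U])
qed

instance
proof
  fix a b c :: "'a pdo"
  show "a + b + c = a + (b + c)" "a + b = b + a" "0 + a = a" "- a + a = 0"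
    "a * b * c = a * (b * c)" "(a + b) * c = a * c + b * c" "1 * a = a" "a * 1 = a"
    by (transfer; simp add: fun_eq_iff algebra_simps)+
  show "a * (b + c) = a * b + a * c"
    by transfer (simp add: fun_eq_iff op_add)
  show "a - b = a + - b"
    by (rule minus_pdo_def)
  show "(0 :: 'a pdo) \<noteq> 1"
    by (transfer, rule notI, drule fun_cong[of _ _ 1]) simp
qed

end

lemma app_simps [simp]:
  "app 0 b = 0" "app 1 b = b" "app (T + U) b = app T b + app U b"
  "app (- T) b = - app T b" "app (T * U) b = app T (app U b)"
  by (simp_all add: zero_pdo.rep_eq one_pdo.rep_eq plus_pdo.rep_eq uminus_pdo.rep_eq
      times_pdo.rep_eq)

lemma app_diff [simp]: "app (T - U) b = app T b - app U b"
  using app_simps(3)[of "T - U" U b] by simp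

lift_definition scaleD :: "'k::field_char_0 \<Rightarrow> 'k pdo \<Rightarrow> 'k pdo" is
  "\<lambda>c T b. fls_const (fls_const c) * T b"
proof -
  fix c and T :: "'k fls fls \<Rightarrow> 'k fls fls"
  assume T: "pdo_op T"
  obtain M where M: "\<And>b m. dle b m \<Longrightarrow> dle (T b) (m + M)"
    using op_bounded[OF T] by blast
  then have "dle (fls_const (fls_const c) * T b) (m + M)" if "dle b m" for b m
    using that by (simp add: dle_def)
  moreover have "fls_const (fls_const c) * right_xi b = right_xi (fls_const (fls_const c) * b)" for b
    by (rule co_eqI) (simp add: right_diff_distrib)
  ultimately show "pdo_op (\<lambda>b. fls_const (fls_const c) * T b)"
    by (intro pdo_opI[where N = M])
      (simp_all add: op_add[OF T] op_scale[OF T] op_right_xi[OF T] distrib_left mult.assoc)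
qed

lemma app_scaleD [simp]: "app (scaleD c T) b = fls_const (fls_const c) * app T b"
  by (simp add: scaleD.rep_eq)

lemma app_const_commute: "app T (fls_const (fls_const c) * b) = fls_const (fls_const c) * app T b"
  using op_scale[OF pdo_op_app[of T], of b "fls_const c"] by (simp add: mult.commute)

lemma pdo_eqI: "(\<And>b. app T b = app U b) \<Longrightarrow> T = U"
  by (meson app_inject ext)

global_interpretation PD: k_algebra "scaleD :: 'k::field_char_0 \<Rightarrow> 'k pdo \<Rightarrow> 'k pdo"
  by standard
    (rule pdo_eqI; simp add: app_const_commute distrib_left distrib_right mult.assoc
      flip: fls_plus_const fls_const_mult_const)+

text \<open>An operator is a left multiplication, so its symbol is its value at 1.\<close>

definition cf :: "'k::field_char_0 pdo \<Rightarrow> int \<Rightarrow> 'k fls"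
  where "cf T i = co (app T 1) i"

definition ord_le :: "'k::field_char_0 pdo \<Rightarrow> int \<Rightarrow> bool"
  where "ord_le T m \<longleftrightarrow> (\<forall>i>m. cf T i = 0)"

lemma cf_simps [simp]:
  "cf (T + U) i = cf T i + cf U i" "cf (T - U) i = cf T i - cf U i" "cf (- T) i = - cf T i"
  "cf 0 i = 0" "cf 1 i = (if i = 0 then 1 else 0)" "cf (scaleD c T) i = fls_const c * cf T i"
  by (simp_all add: cf_def)

lemma cf_sum [simp]: "cf (\<Sum>x\<in>A. f x) i = (\<Sum>x\<in>A. cf (f x) i)"
  by (induction A rule: infinite_finite_induct) simp_all

lemma ord_le_dle: "ord_le T m \<longleftrightarrow> dle (app T 1) m"
  by (simp add: ord_le_def dle_def cf_def)

lemma ord_le_ex: obtains m where "ord_le T m"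
  using dle_ex[of "app T 1"] by (auto simp: ord_le_dle)

lemma ord_le_mono: "ord_le T m \<Longrightarrow> m \<le> n \<Longrightarrow> ord_le T n"
  by (auto simp: ord_le_def)

lemma ord_le_diff: "ord_le T m \<Longrightarrow> ord_le U m \<Longrightarrow> ord_le (T - U) m"
  by (auto simp: ord_le_def)

lemma ord_le_scale: "ord_le T m \<Longrightarrow> ord_le (scaleD c T) m"
  by (auto simp: ord_le_def)

lemma ord_le_zero: "ord_le 0 m"
  by (simp add: ord_le_def)

lemma ord_le_one: "ord_le 1 0"
  by (simp add: ord_le_def)

lemma ord_le_pred: "ord_le T m \<Longrightarrow> cf T m = 0 \<Longrightarrow> ord_le T (m - 1)"
  unfolding ord_le_dle cf_def by (rule dle_pred)

lemma pdo_eq_0_iff: "T = 0 \<longleftrightarrow> (\<forall>m. ord_le T m)"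
proof
  assume *: "\<forall>m. ord_le T m"
  have "cf T i = 0" for i using *[rule_format, of "i - 1"] by (simp add: ord_le_def)
  then have "app T 1 = 0" by (intro co_eqI) (simp add: cf_def)
  then show "T = 0" by (intro pdo_eqI) (simp add: op_eq_0[OF pdo_op_app])
qed (simp add: ord_le_zero)

lemma ord_le_mult: "ord_le T n \<Longrightarrow> ord_le U m \<Longrightarrow> ord_le (T * U) (n + m)"
  by (simp add: ord_le_dle op_dle[OF pdo_op_app])

lemma cf_mult:
  assumes "ord_le T n" "ord_le U m"
  shows "cf (T * U) (n + m) = cf T n * cf U m"
    and "cf (T * U) (n + m - 1) =
      cf T n * cf U (m - 1) + (cf T (n - 1) - of_int m * fls_deriv (cf T n)) * cf U m"
  using op_top[OF pdo_op_app, of T n "app U 1" m] assms by (simp_all add: ord_le_dle cf_def)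

text \<open>The zero operator has no order.\<close>

definition has_ord :: "'k::field_char_0 pdo \<Rightarrow> int \<Rightarrow> bool"
  where "has_ord T m \<longleftrightarrow> ord_le T m \<and> cf T m \<noteq> 0"

lemma has_ord_ex:
  assumes "T \<noteq> 0"
  obtains m where "has_ord T m"
proof (rule ccontr)
  assume "\<not> thesis"
  then have *: "\<And>m. \<not> has_ord T m" using that by blast
  obtain M where M: "ord_le T M" by (rule ord_le_ex[of T])
  have "ord_le T (M - int k)" for k
  proof (induction k)
    case (Suc k)
    with * have "cf T (M - int k) = 0" by (auto simp: has_ord_def)
    with Suc show ?case using ord_le_pred[of T "M - int k"] by (simp add: algebra_simps)
  qed (simp add: M)
  then have "ord_le T m" for m
    by (rule ord_le_mono[of T "M - int (nat (M - m))"]) simp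
  with assms show False by (simp add: pdo_eq_0_iff)
qed

lemma has_ord_nonzero: "has_ord T m \<Longrightarrow> T \<noteq> 0"
  by (auto simp: has_ord_def)

lemma has_ord_le: "has_ord T m \<Longrightarrow> ord_le T n \<Longrightarrow> m \<le> n"
  by (auto simp: has_ord_def ord_le_def not_le[symmetric])

lemma has_ord_unique: "has_ord T m \<Longrightarrow> has_ord T n \<Longrightarrow> m = n"
  by (meson has_ord_def has_ord_le order_antisym)

lemma has_ord_mult: "has_ord T n \<Longrightarrow> has_ord U m \<Longrightarrow> has_ord (T * U) (n + m)"
  by (simp add: has_ord_def ord_le_mult cf_mult)

lemma has_ord_one: "has_ord 1 0"
  by (simp add: has_ord_def ord_le_one)

lemma has_ord_power: "has_ord T n \<Longrightarrow> has_ord (T ^ k) (int k * n)"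
proof (induction k)
  case (Suc k)
  then show ?case using has_ord_mult[of T n "T ^ k" "int k * n"] by (simp add: algebra_simps)
qed (simp add: has_ord_one)

instance pdo :: (field_char_0) ring_1_no_zero_divisors
proof
  fix a b :: "'a pdo"
  assume "a \<noteq> 0" "b \<noteq> 0"
  then obtain n m where "has_ord a n" "has_ord b m" by (metis has_ord_ex)
  then show "a * b \<noteq> 0" using has_ord_mult has_ord_nonzero by blast
qed

lemma pdo_inverse:
  fixes T :: "'k::field_char_0 pdo"
  assumes "T \<noteq> 0"
  obtains U where "T * U = 1" "U * T = 1"
proof -
  obtain n where n: "has_ord T n" by (rule has_ord_ex[OF assms])
  note T = pdo_op_app[of T]
  have n': "dle (app T 1) n" "co (app T 1) n \<noteq> 0"
    using n by (auto simp: has_ord_def ord_le_dle cf_def)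
  have inj: "a = b" if "app T a = app T b" for a b
  proof (rule co_eqI)
    fix i
    have "app T (a - b) = 0" using that by (simp add: op_diff[OF T])
    then have "dle (app T (a - b)) (n + (i - 1))" by (simp add: dle_def)
    then have "dle (a - b) (i - 1)" by (rule op_injective[OF T n'])
    then show "co a i = co b i" by (simp add: dle_def)
  qed
  define V where "V c = (SOME b. app T b = c)" for c
  have V: "app T (V c) = c" for c
    unfolding V_def by (rule someI_ex) (use op_surjective[OF T n'] in blast)
  have "pdo_op V"
  proof (rule pdo_opI[where N = "- n"])
    fix b :: "'k fls fls" and m assume "dle b m"
    then have "dle (app T (V b)) (n + (m + - n))" by (simp add: V)
    then show "dle (V b) (m + - n)" by (rule op_injective[OF T n'])
  qed (rule inj, simp add: V op_add[OF T] op_scale[OF T] op_right_xi[OF T])+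
  then have app_V: "app (Abs_pdo V) = V" by (simp add: Abs_pdo_inverse)
  show thesis
  proof (rule that[of "Abs_pdo V"])
    show "T * Abs_pdo V = 1" by (rule pdo_eqI) (simp add: app_V V)
    show "Abs_pdo V * T = 1" by (rule pdo_eqI, rule inj) (simp add: app_V V)
  qed
qed

lift_definition q_hat :: "'k::field_char_0 pdo" is "fls_shift 1"
  by (rule pdo_opI[where N = 1]) (auto intro!: co_eqI simp: dle_def)

text \<open>Left multiplication by \<open>x\<close>: with coefficients on the right,
  \<open>x xi^i = xi^i x - i xi^(i-1)\<close>, and the correction is the derivative in
  \<open>xi\<close>.\<close>

lift_definition p_hat :: "'k::field_char_0 pdo" is "\<lambda>b. fls_const fls_X * b - sderiv_xi b"
  by (rule pdo_opI[where N = 0]) (auto intro!: co_eqI simp: dle_def algebra_simps)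

lemma weyl_relation_hat: "q_hat * p_hat - p_hat * q_hat = (1 :: 'k::field_char_0 pdo)"
  by (auto intro!: pdo_eqI co_eqI simp: q_hat.rep_eq p_hat.rep_eq algebra_simps)

lemma ord_le_hat: "ord_le q_hat 1" "ord_le p_hat 0" "cf p_hat 0 = fls_X" "cf q_hat 1 = 1"
  "cf q_hat i = (if i = 1 then 1 else 0)" "cf p_hat i = (if i = 0 then fls_X else 0)"
  by (auto simp: ord_le_def cf_def q_hat.rep_eq p_hat.rep_eq eq_neg_iff_add_eq_0[symmetric])

lemma cf_q_hat_p_hat: "cf (q_hat ^ i * p_hat ^ j) l = (if l = int i then fls_X ^ j else 0)"
proof -
  have p: "co (app (p_hat ^ j) 1) l = (if l = 0 then fls_X ^ j else 0)" for l :: int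
    by (induction j arbitrary: l) (auto simp: p_hat.rep_eq eq_neg_iff_add_eq_0[symmetric])
  have q: "co (app (q_hat ^ i) b) l = co b (l - int i)" for b :: "'a fls fls" and l
    by (induction i arbitrary: l b) (auto simp: q_hat.rep_eq algebra_simps)
  show ?thesis by (simp add: cf_def p q)
qed

subsection \<open>Centralizers of operators of positive order\<close>

lemma ad_add: "ad z (x + y) = ad z x + ad z y"
  and ad_diff: "ad z (x - y) = ad z x - ad z y"
  and ad_minus: "ad z (- x) = - ad z x"
  and ad_zero [simp]: "ad z 0 = 0"
  and ad_one [simp]: "ad z 1 = 0"
  and ad_self [simp]: "ad z z = 0"
  and ad_mult: "ad z (x * y) = ad z x * y + x * ad z y"
  by (simp_all add: ad_def algebra_simps)

lemma ad_eq_0_iff: "ad z x = 0 \<longleftrightarrow> z * x = x * z"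
  by (simp add: ad_def)

lemma ad_swap: "ad x z = - ad z x"
  by (simp add: ad_def)

lemma ad_iter_add: "(ad z ^^ m) (x + y) = (ad z ^^ m) x + (ad z ^^ m) y"
  by (induction m) (simp_all add: ad_add)

lemma ad_iter_zero [simp]: "(ad z ^^ m) 0 = 0"
  by (induction m) simp_all

lemma ad_iter_eq_0_mono: "(ad z ^^ m) x = 0 \<Longrightarrow> m \<le> n \<Longrightarrow> (ad z ^^ n) x = 0"
  using funpow_add[of "n - m" m "ad z"] by simp

lemma ad_iter_mult_right: "ad z c = 0 \<Longrightarrow> (ad z ^^ m) (x * c) = (ad z ^^ m) x * c"
  by (induction m) (simp_all add: ad_mult)

lemma ad_iter_mult_left: "ad z c = 0 \<Longrightarrow> (ad z ^^ m) (c * x) = c * (ad z ^^ m) x"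
  by (induction m) (simp_all add: ad_mult)

text \<open>In the Leibniz expansion of the \<open>(a + b)\<close>-th iterate every other term
  applies \<open>ad z\<close> too often to one factor. The binomial coefficient arises by Pascal's
  rule, with separate treatment of \<open>a = 0\<close> and \<open>b = 0\<close>.\<close>

lemma ad_iter_mult_top:
  assumes "(ad z ^^ Suc a) u = 0" "(ad z ^^ Suc b) v = 0"
  shows "(ad z ^^ Suc (a + b)) (u * v) = 0"
    and "(ad z ^^ (a + b)) (u * v) = of_nat ((a + b) choose a) * ((ad z ^^ a) u * (ad z ^^ b) v)"
proof -
  have "(ad z ^^ n) (u * v) = of_nat (n choose a) * ((ad z ^^ a) u * (ad z ^^ b) v)"
    if "n = a + b" "(ad z ^^ Suc a) u = 0" "(ad z ^^ Suc b) v = 0" for n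
    using that
  proof (induction n arbitrary: a b u v)
    case (Suc n)
    have "(ad z ^^ n) (ad z u * v) =
      of_nat (if a = 0 then 0 else n choose (a - 1)) * ((ad z ^^ a) u * (ad z ^^ b) v)"
    proof (cases a)
      case (Suc a')
      then show ?thesis
        using Suc.IH[of a' b "ad z u" v] Suc.prems by (simp add: funpow_swap1)
    qed (use Suc.prems in simp)
    moreover have "(ad z ^^ n) (u * ad z v) =
      of_nat (if b = 0 then 0 else n choose a) * ((ad z ^^ a) u * (ad z ^^ b) v)"
    proof (cases b)
      case (Suc b')
      then show ?thesis
        using Suc.IH[of a b' u "ad z v"] Suc.prems by (simp add: funpow_swap1)
    qed (use Suc.prems in simp)
    moreover have "(ad z ^^ Suc n) (u * v) = (ad z ^^ n) (ad z u * v) + (ad z ^^ n) (u * ad z v)"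
      by (simp add: ad_mult ad_iter_add funpow_swap1)
    moreover have "(if a = 0 then 0 else n choose (a - 1)) + (if b = 0 then 0 else n choose a)
        = Suc n choose a"
      using Suc.prems(1) by (cases a; cases b) (auto simp: binomial_eq_0)
    ultimately show ?case by (simp flip: distrib_right of_nat_add)
  qed simp
  from this[OF refl assms]
  show top: "(ad z ^^ (a + b)) (u * v) = of_nat ((a + b) choose a) * ((ad z ^^ a) u * (ad z ^^ b) v)" .
  have "ad z (of_nat k * w) = of_nat k * ad z w" for k :: nat and w
    by (induction k) (simp_all add: distrib_right ad_add)
  then show "(ad z ^^ Suc (a + b)) (u * v) = 0"
    using assms by (simp add: top ad_mult)
qed

text \<open>The preceding lemma applied to \<open>x * x^i\<close>: the binomial factors
  \<open>1 + i choose 1\<close> multiply up to the factorial.\<close>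

lemma ad_iter_power_top:
  fixes x :: "'a::ring_1"
  assumes "ad z (ad z x) = 0"
  shows "(ad z ^^ Suc i) (x ^ i) = 0 \<and> (ad z ^^ i) (x ^ i) = of_nat (fact i) * ad z x ^ i"
proof (induction i)
  case (Suc i)
  have 1: "(ad z ^^ Suc 1) x = 0" using assms by simp
  have "u * (of_nat k * w) = of_nat k * (u * w)" for u w :: 'a and k
    by (metis mult.assoc mult_of_nat_commute)
  then have "of_nat (Suc i) * (ad z x * (of_nat (fact i) * ad z x ^ i))
      = of_nat (fact (Suc i)) * ad z x ^ Suc i"
    by (simp flip: mult.assoc of_nat_mult add: of_nat_mult[of "Suc i", symmetric] del: of_nat_Suc)
  moreover have "1 + i choose 1 = Suc i" "(ad z ^^ 1) x = ad z x" by simp_all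
  ultimately show ?case
    using ad_iter_mult_top[OF 1 conjunct1[OF Suc.IH]] conjunct2[OF Suc.IH]
    by (metis plus_1_eq_Suc power_Suc)
qed simp

context vector_space
begin

text \<open>Families rather than sets, because the monomials that are counted later are not known to
  be distinct; a repetition is itself a relation.\<close>

lemma dependent_family:
  assumes fin: "finite I" "finite B" and card: "card B < card I"
    and sp: "\<And>i. i \<in> I \<Longrightarrow> f i \<in> span B"
  obtains a where "\<exists>i\<in>I. a i \<noteq> 0" "(\<Sum>i\<in>I. scale (a i) (f i)) = 0"
proof (cases "inj_on f I")
  case True
  have "dependent (f ` I)"
  proof (rule ccontr)
    assume "independent (f ` I)"
    with independent_span_bound[OF fin(2)] sp have "card (f ` I) \<le> card B" by blast
    with card True show False by (simp add: card_image)
  qed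
  then obtain u where u: "\<exists>v\<in>f ` I. u v \<noteq> 0" "(\<Sum>v\<in>f ` I. scale (u v) v) = 0"
    using dependent_finite[of "f ` I"] fin by blast
  then show thesis
    using that[of "u \<circ> f"] True by (simp add: sum.reindex)
next
  case False
  then obtain i j where ij: "i \<in> I" "j \<in> I" "i \<noteq> j" "f i = f j" by (auto simp: inj_on_def)
  let ?a = "\<lambda>k. if k = i then 1 else if k = j then - 1 else 0 :: 'a"
  have "(\<Sum>k\<in>I. scale (?a k) (f k)) = (\<Sum>k\<in>{i, j}. scale (?a k) (f k))"
    using ij fin by (intro sum.mono_neutral_right) auto
  also have "\<dots> = 0" using ij by simp
  finally have "(\<Sum>k\<in>I. scale (?a k) (f k)) = 0" .
  moreover have "\<exists>k\<in>I. ?a k \<noteq> 0" using ij(1) by (intro bexI[of _ i]) simp_all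
  ultimately show thesis by (intro that[of ?a])
qed

end

context k_algebra
begin

lemma ad_scale: "ad z (scale c x) = scale c (ad z x)"
  by (simp add: ad_def scale_mult_left scale_mult_right scale_right_diff_distrib)

lemma ad_scale_left: "ad (scale c z) x = scale c (ad z x)"
  by (simp add: ad_def scale_mult_left scale_mult_right scale_right_diff_distrib)

lemma ad_iter_scale: "(ad z ^^ m) (scale c x) = scale c ((ad z ^^ m) x)"
  by (induction m) (simp_all add: ad_scale)

lemma ad_sum: "ad z (\<Sum>i\<in>I. f i) = (\<Sum>i\<in>I. ad z (f i))"
  by (induction I rule: infinite_finite_induct) (simp_all add: ad_add)

lemma of_nat_conv_scale: "of_nat n * x = scale (of_nat n) x"
  by (induction n) (simp_all add: distrib_right scale_left_distrib)

lemma in_C_iff: "x \<in> C z \<longleftrightarrow> z * x = x * z"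
  by (simp add: C_def ad_eq_0_iff)

lemma C_0 [simp]: "0 \<in> C z"
  and C_1 [simp]: "1 \<in> C z"
  and C_self [simp]: "z \<in> C z"
  and C_add: "x \<in> C z \<Longrightarrow> y \<in> C z \<Longrightarrow> x + y \<in> C z"
  and C_diff: "x \<in> C z \<Longrightarrow> y \<in> C z \<Longrightarrow> x - y \<in> C z"
  and C_scale: "x \<in> C z \<Longrightarrow> scale c x \<in> C z"
  and C_mult: "x \<in> C z \<Longrightarrow> y \<in> C z \<Longrightarrow> x * y \<in> C z"
  by (simp_all add: C_def ad_add ad_diff ad_scale ad_mult)

lemma C_power: "x \<in> C z \<Longrightarrow> x ^ k \<in> C z"
  by (induction k) (simp_all add: C_mult)

lemma C_subspace: "subspace (C z)"
  by (rule subspaceI) (simp_all add: C_add C_scale)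

lemma C_subset_N: "C z \<subseteq> N z"
  by (auto simp: C_def N_def intro: exI[of _ 1])

lemma N_subspace: "subspace (N z)"
proof (rule subspaceI)
  fix x y assume "x \<in> N z" "y \<in> N z"
  then obtain m n where "(ad z ^^ m) x = 0" "(ad z ^^ n) y = 0" by (auto simp: N_def)
  then have "(ad z ^^ (m + n)) x = 0" "(ad z ^^ (m + n)) y = 0"
    using ad_iter_eq_0_mono le_add1 le_add2 by blast+
  then have "(ad z ^^ (m + n)) (x + y) = 0" by (simp add: ad_iter_add)
  then show "x + y \<in> N z" by (auto simp: N_def)
qed (auto simp: N_def ad_iter_scale)

lemma ad_in_N_iff: "ad z x \<in> N z \<longleftrightarrow> x \<in> N z"
proof
  assume "ad z x \<in> N z"
  then obtain m where "(ad z ^^ m) (ad z x) = 0" by (auto simp: N_def)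
  then have "(ad z ^^ Suc m) x = 0" by (simp add: funpow_swap1)
  then show "x \<in> N z" unfolding N_def by blast
next
  assume "x \<in> N z"
  then obtain m where "(ad z ^^ m) x = 0" by (auto simp: N_def)
  then have "(ad z ^^ m) (ad z x) = 0" by (simp flip: funpow_swap1)
  then show "ad z x \<in> N z" unfolding N_def by blast
qed

lemma N_mult_C: "x \<in> N z \<Longrightarrow> c \<in> C z \<Longrightarrow> x * c \<in> N z" "x \<in> N z \<Longrightarrow> c \<in> C z \<Longrightarrow> c * x \<in> N z"
  by (auto simp: N_def C_def ad_iter_mult_right ad_iter_mult_left) (metis mult_zero_left, metis mult_zero_right)

lemma zero_in_Ev: "(1 :: 'a) \<noteq> 0 \<Longrightarrow> 0 \<in> Ev z"
  by (auto simp: Ev_def intro!: exI[of _ 1])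

end

section \<open>Leading coefficients of commutators and Schur's theorem\<close>

lemma fls_wronskian:
  fixes g h :: "'k::field_char_0 fls"
  assumes "fls_deriv g * h = fls_deriv h * g" "h \<noteq> 0"
  obtains c where "g = fls_const c * h"
proof -
  define u where "u = g / h"
  have g: "g = u * h" using assms by (simp add: u_def)
  have "fls_deriv u * (h * h) = 0" using assms(1) by (simp add: g algebra_simps)
  then have "fls_deriv u = 0" using assms(2) by simp
  then obtain c where "u = fls_const c" by (auto simp: fls_deriv_eq_0_iff)
  with g that show thesis by blast
qed

text \<open>Coefficients commute, so all contributions of the second coefficients cancel in the
  difference of the two products; the Poisson bracket of the leading terms remains.\<close>

lemma cf_commutator:
  assumes "ord_le Z n" "ord_le U m"
  shows "cf (ad Z U) (n + m - 1) =
    of_int n * cf Z n * fls_deriv (cf U m) - of_int m * fls_deriv (cf Z n) * cf U m"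
proof -
  have "m + n - 1 = n + m - 1" by simp
  then show ?thesis
    using cf_mult(2)[OF assms] cf_mult(2)[OF assms(2,1)] by (simp add: ad_def algebra_simps)
qed

text \<open>Both leading coefficients solve the same linear first-order differential equation, so
  their Wronskian vanishes and they are proportional over the constants.\<close>

lemma eigen_symbol_unique:
  assumes Z: "has_ord Z n" "n \<ge> 1"
    and U: "ad Z U = scaleD l U" "ord_le U m" and V: "ad Z V = scaleD l V" "has_ord V m"
  obtains k where "ord_le (U - scaleD k V) (m - 1)"
proof -
  \<comment> \<open>The multiple of \<open>W\<close> by \<open>l\<close> reaches order
    \<open>n + m - 1\<close> only if \<open>n = 1\<close>; for larger \<open>n\<close> the
    eigenvalue does not enter the equation.\<close>
  define f c where "f = cf Z n" and "c = (if n = 1 then fls_const l else 0)"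
  have eq: "of_int n * f * fls_deriv (cf W m) = of_int m * fls_deriv f * cf W m + c * cf W m"
    if "ad Z W = scaleD l W" "ord_le W m" for W
  proof -
    have "cf (ad Z W) (n + m - 1) = c * cf W m"
      using that Z(2) by (auto simp: c_def ord_le_def)
    with cf_commutator[of Z n W m] that(2) Z(1) show ?thesis
      by (simp add: has_ord_def f_def algebra_simps)
  qed
  define g h where "g = cf U m" and "h = cf V m"
  have h: "h \<noteq> 0" "ord_le V m" using V(2) by (auto simp: has_ord_def h_def)
  have "of_int n * f * (fls_deriv g * h - fls_deriv h * g) =
      (of_int n * f * fls_deriv g) * h - (of_int n * f * fls_deriv h) * g"
    by (simp add: algebra_simps)
  also have "\<dots> = 0"
    using eq[OF U] eq[OF V(1) h(2)] by (simp add: g_def h_def algebra_simps)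
  finally have "fls_deriv g * h = fls_deriv h * g"
    using Z by (simp add: f_def has_ord_def)
  then obtain k where "g = fls_const k * h" using fls_wronskian h(1) by blast
  then have "ord_le (U - scaleD k V) (m - 1)"
    using U(2) h(2) by (intro ord_le_pred ord_le_diff ord_le_scale) (simp_all add: g_def h_def)
  then show thesis by (rule that)
qed

lemma has_ord_inverse:
  assumes "has_ord s g" "s * t = 1"
  shows "has_ord t (- g)"
proof -
  have "t \<noteq> 0" using assms(2) by auto
  then obtain m where "has_ord t m" by (rule has_ord_ex)
  moreover have "g + m = 0"
    using has_ord_mult[OF assms(1) \<open>has_ord t m\<close>] assms(2) has_ord_unique[OF has_ord_one] by auto
  then have "m = - g" by simp
  ultimately show ?thesis by simp
qed

lemma commute_inverse:
  fixes x s t :: "'a::ring_1"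
  assumes "x * s = s * x" "s * t = 1" "t * s = 1"
  shows "x * t = t * x"
proof -
  have "x * t = t * s * (x * t)" using assms by simp
  also have "\<dots> = t * (x * s) * t" by (simp add: assms(1) mult.assoc)
  also have "\<dots> = t * x" by (simp add: assms(2) mult.assoc)
  finally show ?thesis .
qed

text \<open>Schur's theorem: elements of the centralizer are limits of Laurent polynomials in a single
  element of least positive order.\<close>

lemma centralizer_commutative:
  assumes Z: "has_ord Z n" "n \<ge> 1" and xy: "x \<in> PD.C Z" "y \<in> PD.C Z"
  shows "x * y = y * x"
proof -
  define P where "P k \<longleftrightarrow> k > 0 \<and> (\<exists>s\<in>PD.C Z. has_ord s (int k))" for k
  have "P (nat n)" using Z by (auto simp: P_def intro!: bexI[of _ Z])
  define g where "g = (LEAST k. P k)"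
  have "P g" unfolding g_def by (rule LeastI) fact
  have g_min: "g \<le> k" if "P k" for k unfolding g_def by (rule Least_le) fact
  from \<open>P g\<close> obtain s where s: "g > 0" "s \<in> PD.C Z" "has_ord s (int g)" by (auto simp: P_def)
  obtain t where t: "s * t = 1" "t * s = 1" using pdo_inverse has_ord_nonzero[OF s(3)] by blast
  have tC: "t \<in> PD.C Z" using s(2) commute_inverse[OF _ t, of Z] by (simp add: PD.in_C_iff)
  define sp where "sp i = (if i \<ge> 0 then s ^ nat i else t ^ nat (- i))" for i
  have sp_C: "sp i \<in> PD.C Z" for i using s(2) tC by (simp add: sp_def PD.C_power)
  have sp_ord: "has_ord (sp i) (i * int g)" for i
    using has_ord_power[OF s(3), of "nat i"] has_ord_power[OF has_ord_inverse[OF s(3) t(1)], of "nat (- i)"]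
    by (cases "i \<ge> 0") (simp_all add: sp_def)
  \<comment> \<open>Multiplying \<open>r\<close> by the power of \<open>s\<close> with exponent
    \<open>- (m div g)\<close> leaves an element of the centralizer of order \<open>m mod g\<close>,
    which is 0 by the minimality of \<open>g\<close>.\<close>
  have mult: "\<exists>i. m = i * int g" if "r \<in> PD.C Z" "has_ord r m" for r m
  proof -
    have "has_ord (r * sp (- (m div int g))) (m + - (m div int g) * int g)"
      by (rule has_ord_mult[OF that(2) sp_ord])
    moreover have "m + - (m div int g) * int g = int (nat (m mod int g))"
      using s(1) minus_div_mult_eq_mod[of m "int g"] by simp
    ultimately have "has_ord (r * sp (- (m div int g))) (int (nat (m mod int g)))" by simp
    moreover have "r * sp (- (m div int g)) \<in> PD.C Z" using that sp_C by (simp add: PD.C_mult)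
    ultimately have "nat (m mod int g) > 0 \<Longrightarrow> g \<le> nat (m mod int g)"
      by (intro g_min) (auto simp: P_def)
    moreover have "nat (m mod int g) < g" using s(1) by (simp add: nat_less_iff)
    ultimately have "m mod int g = 0" using s(1) pos_mod_sign[of "int g" m] by linarith
    then show ?thesis by (metis dvd_div_mult_self mod_0_imp_dvd)
  qed
  have approx: "\<exists>p\<in>PD.span (range sp). ord_le (r - p) M" if r: "r \<in> PD.C Z" for r M
  proof -
    obtain N where N: "ord_le r N" by (rule ord_le_ex[of r])
    have "\<exists>p\<in>PD.span (range sp). p \<in> PD.C Z \<and> ord_le (r - p) (N - int k)" for k
    proof (induction k)
      case 0
      then show ?case using N by (intro bexI[of _ 0]) (auto simp: PD.span_zero)
    next
      case (Suc k)
      then obtain p where p: "p \<in> PD.span (range sp)" "p \<in> PD.C Z" "ord_le (r - p) (N - int k)"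
        by blast
      show ?case
      proof (cases "cf (r - p) (N - int k) = 0")
        case True
        then show ?thesis using ord_le_pred[OF p(3)] p by (auto simp: algebra_simps)
      next
        case False
        have rp: "r - p \<in> PD.C Z" using r p(2) by (rule PD.C_diff)
        have "has_ord (r - p) (N - int k)" using False p(3) by (simp add: has_ord_def)
        then obtain i where i: "N - int k = i * int g" using mult rp by blast
        have 1: "ad Z (r - p) = scaleD 0 (r - p)" "ad Z (sp i) = scaleD 0 (sp i)"
          using rp sp_C[of i] by (simp_all add: PD.C_def)
        obtain c where c: "ord_le (r - p - scaleD c (sp i)) (N - int k - 1)"
          using eigen_symbol_unique[OF Z 1(1) p(3) 1(2)] sp_ord[of i] i by auto
        have "p + scaleD c (sp i) \<in> PD.span (range sp)"
          by (rule PD.span_add[OF p(1) PD.span_scale[OF PD.span_base[OF rangeI]]])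
        moreover have "p + scaleD c (sp i) \<in> PD.C Z"
          using p(2) sp_C by (intro PD.C_add PD.C_scale)
        moreover have "ord_le (r - (p + scaleD c (sp i))) (N - int (Suc k))"
          using c by (simp add: algebra_simps)
        ultimately show ?thesis by blast
      qed
    qed
    then obtain p where "p \<in> PD.span (range sp)" "ord_le (r - p) (N - int (nat (N - M)))" by blast
    moreover have "N - int (nat (N - M)) \<le> M" by simp
    ultimately show ?thesis using ord_le_mono by blast
  qed
  have span_commute: "w * p = p * w" if "p \<in> PD.span (range sp)" "w * s = s * w" for w p
  proof -
    have "w * sp i = sp i * w" for i
      using that(2) commute_inverse[OF that(2) t] by (simp add: sp_def power_commuting_commutes)
    then have "range sp \<subseteq> PD.C w" by (auto simp: PD.in_C_iff)
    then have "p \<in> PD.C w" using that(1) PD.span_minimal[OF _ PD.C_subspace] by blast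
    then show ?thesis by (simp add: PD.in_C_iff)
  qed
  \<comment> \<open>For a Laurent polynomial \<open>p\<close> in \<open>s\<close> close to
    \<open>r\<close>, \<open>[w, r] = [w, r - p]\<close> has arbitrarily low order, hence is
    zero.\<close>
  have limit: "w * r = r * w" if r: "r \<in> PD.C Z" and w: "\<And>p. p \<in> PD.span (range sp) \<Longrightarrow> w * p = p * w" for w r
  proof -
    obtain m where m: "ord_le w m" by (rule ord_le_ex[of w])
    have "ord_le (ad w r) M" for M
    proof -
      obtain p where p: "p \<in> PD.span (range sp)" "ord_le (r - p) (M - m)"
        using approx[OF r] by blast
      have "ad w r = ad w (r - p)" using w[OF p(1)] by (simp add: ad_diff ad_eq_0_iff[THEN iffD2])
      moreover have "ord_le (ad w (r - p)) M"
        unfolding ad_def using ord_le_mult[OF m p(2)] ord_le_mult[OF p(2) m]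
        by (intro ord_le_diff) (simp_all add: algebra_simps)
      ultimately show ?thesis by simp
    qed
    then have "ad w r = 0" by (subst pdo_eq_0_iff) blast
    then show ?thesis by (simp add: ad_eq_0_iff)
  qed
  \<comment> \<open>The limit argument is used twice. Applied to \<open>w = s\<close> it shows that
    \<open>s\<close> is central in the centralizer; then any \<open>x\<close> there commutes with
    Laurent polynomials in \<open>s\<close>, and \<open>w = x\<close> is allowed.\<close>
  have "s * r = r * s" if "r \<in> PD.C Z" for r
    using limit[OF that, of s] span_commute[of _ s] by simp
  then show ?thesis using limit[OF xy(2), of x] span_commute[of _ x] xy(1) by simp
qed

subsection \<open>Embeddings of the Weyl algebra\<close>

lemma (in vector_space) span_in_subspace:
  "x \<in> span S \<Longrightarrow> subspace V \<Longrightarrow> (\<And>y. y \<in> S \<Longrightarrow> y \<in> V) \<Longrightarrow> x \<in> V"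
  using span_minimal[of S V] by blast

context k_algebra
begin

definition word_eval :: "'a \<Rightarrow> 'a \<Rightarrow> weyl_gen word \<Rightarrow> 'a"
  where "word_eval P Q w = prod_list (map (case_weyl_gen P Q) (letters w))"

definition free_eval :: "'a \<Rightarrow> 'a \<Rightarrow> (weyl_gen word \<Rightarrow>\<^sub>0 'k) \<Rightarrow> 'a"
  where "free_eval P Q x = lin_ext scale (word_eval P Q) x"

text \<open>The homomorphism provided by the presentation of the Weyl algebra. It is independent of
  the representative once \<open>Q * P - P * Q = 1\<close>, the assumption of the context
  below.\<close>

definition weyl_eval :: "'a \<Rightarrow> 'a \<Rightarrow> 'k weyl \<Rightarrow> 'a"
  where "weyl_eval P Q a = free_eval P Q (rep_weyl a)"

lemma word_eval_simps [simp]: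
  "word_eval P Q 0 = 1" "word_eval P Q (v + w) = word_eval P Q v * word_eval P Q w"
  by (simp_all add: word_eval_def zero_word_def plus_word_def)

lemma free_eval_simps [simp]:
  "free_eval P Q 0 = 0" "free_eval P Q (x + y) = free_eval P Q x + free_eval P Q y"
  "free_eval P Q (x - y) = free_eval P Q x - free_eval P Q y"
  "free_eval P Q (Poly_Mapping.single w c) = scale c (word_eval P Q w)"
  by (simp_all add: free_eval_def lin_ext_add lin_ext_diff)

lemma free_eval_mult [simp]: "free_eval P Q (x * y) = free_eval P Q x * free_eval P Q y"
proof (induction x rule: poly_mapping_single_induct)
  case (single v c)
  show ?case
    by (induction y rule: poly_mapping_single_induct)
      (simp_all add: mult_single distrib_left scale_right_distrib scale_mult_left scale_mult_right)
qed (simp_all add: distrib_right)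

lemma free_eval_one [simp]: "free_eval P Q 1 = 1"
  by (simp flip: single_one)

context
  fixes P Q :: 'a
  assumes rel: "Q * P - P * Q = 1"
begin

lemma free_eval_ideal: "x \<in> weyl_ideal \<Longrightarrow> free_eval P Q x = 0"
proof (induction x rule: weyl_ideal.induct)
  case relation
  show ?case using rel by (simp add: free_gen_def word_eval_def)
qed simp_all

lemma weyl_eval_abs: "weyl_eval P Q (abs_weyl x) = free_eval P Q x"
proof -
  have "weyl_rel (rep_weyl (abs_weyl x)) x"
    using Quotient_rep_abs[OF Quotient_weyl] by (simp add: equivp_reflp[OF weyl_rel_equivp])
  then have "free_eval P Q (rep_weyl (abs_weyl x) - x) = 0"
    unfolding weyl_rel_def by (rule free_eval_ideal)
  then show ?thesis by (simp add: weyl_eval_def)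
qed

lemma weyl_eval_simps:
  "weyl_eval P Q (a + b) = weyl_eval P Q a + weyl_eval P Q b"
  "weyl_eval P Q (a * b) = weyl_eval P Q a * weyl_eval P Q b"
  "weyl_eval P Q (scale1 c a) = scale c (weyl_eval P Q a)"
  "weyl_eval P Q 1 = 1" "weyl_eval P Q weyl_p = P" "weyl_eval P Q weyl_q = Q"
proof -
  obtain x y where xy: "a = abs_weyl x" "b = abs_weyl y"
    by (metis Quotient_abs_rep[OF Quotient_weyl])
  show "weyl_eval P Q (a + b) = weyl_eval P Q a + weyl_eval P Q b"
    by (simp add: xy plus_weyl.abs_eq weyl_eval_abs)
  show "weyl_eval P Q (a * b) = weyl_eval P Q a * weyl_eval P Q b"
    by (simp add: xy times_weyl.abs_eq weyl_eval_abs)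
  show "weyl_eval P Q (scale1 c a) = scale c (weyl_eval P Q a)"
    by (simp add: xy scale1.abs_eq weyl_eval_abs scale_mult_left)
  show "weyl_eval P Q 1 = 1"
    by (simp add: one_weyl.abs_eq weyl_eval_abs)
  show "weyl_eval P Q weyl_p = P" "weyl_eval P Q weyl_q = Q"
    by (simp_all add: weyl_p.abs_eq weyl_q.abs_eq weyl_eval_abs free_gen_def word_eval_def)
qed

end

end

lemma weyl_subspace_eq_UNIV:
  fixes S :: "'k::field weyl set"
  assumes S: "A1.subspace S" "1 \<in> S" "\<And>x. x \<in> S \<Longrightarrow> weyl_p * x \<in> S" "\<And>x. x \<in> S \<Longrightarrow> weyl_q * x \<in> S"
  shows "S = UNIV"
proof -
  have single: "abs_weyl (Poly_Mapping.single w c) \<in> S" for w c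
  proof -
    have "abs_weyl (Poly_Mapping.single (Word gs) 1) \<in> S" for gs
    proof (induction gs)
      case Nil
      have "Poly_Mapping.single (Word [] :: weyl_gen word) (1::'k) = 1" by (simp flip: single_one zero_word_def)
      with S(2) show ?case by (simp add: one_weyl.abs_eq)
    next
      case (Cons g gs)
      have "Poly_Mapping.single (Word (g # gs)) (1::'k) = free_gen g * Poly_Mapping.single (Word gs) 1"
        by (simp add: free_gen_def mult_single plus_word_def)
      then have "abs_weyl (Poly_Mapping.single (Word (g # gs)) (1::'k)) =
          (case g of Gen_p \<Rightarrow> weyl_p | Gen_q \<Rightarrow> weyl_q) * abs_weyl (Poly_Mapping.single (Word gs) 1)"
        by (cases g) (simp_all add: times_weyl.abs_eq weyl_p.abs_eq weyl_q.abs_eq)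
      with Cons S(3,4) show ?case by (cases g) simp_all
    qed
    moreover have "abs_weyl (Poly_Mapping.single w c) = scale1 c (abs_weyl (Poly_Mapping.single w 1))"
      by (simp add: scale1.abs_eq mult_single)
    ultimately show ?thesis using S(1) by (cases w) (simp add: A1.subspace_scale)
  qed
  have "abs_weyl x \<in> S" for x
  proof (induction x rule: poly_mapping_single_induct)
    case zero
    then show ?case using A1.subspace_0[OF S(1)] by (simp add: zero_weyl.abs_eq)
  next
    case (add x y)
    then show ?case using A1.subspace_add[OF S(1)] by (simp flip: plus_weyl.abs_eq)
  qed (rule single)
  then show ?thesis by (metis UNIV_eq_I Quotient_abs_rep[OF Quotient_weyl])
qed

text \<open>A pair of generators \<open>u\<close>, \<open>v\<close> together with the embedding that sends them to \<open>d/dx\<close> and \<open>x\<close>.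
  There are two charts: in the first one the order of an element is its degree in \<open>q\<close>, in the
  second one its degree in \<open>p\<close>. Each non-scalar element has positive order in one of them.\<close>

locale weyl_chart =
  fixes u v :: "'k::field_char_0 weyl" and \<psi> :: "'k weyl \<Rightarrow> 'k pdo"
  assumes rel: "u * v - v * u = 1"
    and gens: "weyl_q = u \<and> weyl_p = v \<or> weyl_p = u \<and> weyl_q = - v"
    and hom: "\<psi> (a + b) = \<psi> a + \<psi> b" "\<psi> (a * b) = \<psi> a * \<psi> b" "\<psi> (scale1 c a) = scaleD c (\<psi> a)"
      "\<psi> 1 = 1" "\<psi> u = q_hat" "\<psi> v = p_hat"
begin

lemma hom_zero [simp]: "\<psi> 0 = 0"
  using hom(1)[of 0 0] by simp

lemma hom_diff: "\<psi> (a - b) = \<psi> a - \<psi> b"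
  using hom(1)[of "a - b" b] by simp

lemma hom_sum: "\<psi> (\<Sum>i\<in>I. f i) = (\<Sum>i\<in>I. \<psi> (f i))"
  by (induction I rule: infinite_finite_induct) (simp_all add: hom)

lemma hom_power: "\<psi> (a ^ k) = \<psi> a ^ k"
  by (induction k) (simp_all add: hom)

lemma hom_ad: "\<psi> (ad a b) = ad (\<psi> a) (\<psi> b)"
  by (simp add: ad_def hom hom_diff)

definition box :: "nat \<Rightarrow> nat \<Rightarrow> 'k weyl set"
  where "box a b = A1.span ((\<lambda>(i, j). u ^ i * v ^ j) ` ({..a} \<times> {..b}))"

lemma box_base: "i \<le> a \<Longrightarrow> j \<le> b \<Longrightarrow> u ^ i * v ^ j \<in> box a b"
  unfolding box_def by (rule A1.span_base) force

lemma box_mono: "a \<le> a' \<Longrightarrow> b \<le> b' \<Longrightarrow> box a b \<subseteq> box a' b'"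
  unfolding box_def by (rule A1.span_mono) auto

lemma box_subspace: "A1.subspace (box a b)"
  by (simp add: box_def)

lemma v_power_u: "v * u ^ i = u ^ i * v - of_nat i * u ^ (i - 1)"
proof (induction i)
  case (Suc i)
  have vu: "v * u = u * v - 1" using rel by (simp add: algebra_simps)
  have "v * u ^ Suc i = (v * u) * u ^ i" by (simp add: mult.assoc)
  also have "\<dots> = u * (v * u ^ i) - u ^ i" by (simp add: vu algebra_simps)
  also have "\<dots> = u ^ Suc i * v - (u * (of_nat i * u ^ (i - 1)) + u ^ i)"
    by (simp add: Suc algebra_simps)
  also have "u * (of_nat i * u ^ (i - 1)) = of_nat i * u ^ i"
    by (cases i) (simp_all del: of_nat_Suc, metis mult.assoc mult_of_nat_commute)
  finally show ?case by (simp add: algebra_simps)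
qed simp

lemma box_mult_left:
  assumes S: "x \<in> box a b"
  shows "u * x \<in> box (Suc a) b" "v * x \<in> box a (Suc b)"
proof -
  have "x \<in> {x. u * x \<in> box (Suc a) b \<and> v * x \<in> box a (Suc b)}"
    using S unfolding box_def[of a b]
  proof (rule A1.span_in_subspace)
    show "A1.subspace {x. u * x \<in> box (Suc a) b \<and> v * x \<in> box a (Suc b)}"
      using box_subspace
      by (auto simp: A1.subspace_def distrib_left A1.scale_mult_right)
    fix x assume "x \<in> (\<lambda>(i, j). u ^ i * v ^ j) ` ({..a} \<times> {..b})"
    then obtain i j where ij: "x = u ^ i * v ^ j" "i \<le> a" "j \<le> b" by auto
    have "u * x = u ^ Suc i * v ^ j" by (simp add: ij mult.assoc)
    then have "u * x \<in> box (Suc a) b" using ij by (simp only: box_base Suc_le_mono)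
    moreover have "v * x = u ^ i * v ^ Suc j - scale1 (of_nat i) (u ^ (i - 1) * v ^ j)"
      by (simp add: ij mult.assoc[symmetric] v_power_u left_diff_distrib flip: A1.of_nat_conv_scale)
    moreover have "u ^ i * v ^ Suc j \<in> box a (Suc b)" "u ^ (i - 1) * v ^ j \<in> box a (Suc b)"
      using ij by (auto intro!: box_base simp del: power_Suc)
    ultimately show "x \<in> {x. u * x \<in> box (Suc a) b \<and> v * x \<in> box a (Suc b)}"
      using box_subspace[of a "Suc b"] by (simp add: A1.subspace_diff A1.subspace_scale)
  qed
  then show "u * x \<in> box (Suc a) b" "v * x \<in> box a (Suc b)" by auto
qed

text \<open>Moving \<open>v\<close> to the right of a power of \<open>u\<close> only creates terms
  with smaller exponents, so boxes multiply like monomials. This is the quadratic growth of the Weyl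
  algebra.\<close>

lemma box_mult:
  assumes "x \<in> box a b" "y \<in> box c d"
  shows "x * y \<in> box (a + c) (b + d)"
proof -
  have mon: "u ^ i * (v ^ j * y) \<in> box (i + c) (j + d)" for i j
  proof -
    have v: "v ^ j * y \<in> box c (j + d)"
      by (induction j) (use assms(2) in \<open>auto simp: mult.assoc dest: box_mult_left\<close>)
    show ?thesis
      by (induction i) (use v in \<open>auto simp: mult.assoc dest: box_mult_left\<close>)
  qed
  have "x \<in> {x. x * y \<in> box (a + c) (b + d)}"
    using assms(1) unfolding box_def[of a b]
  proof (rule A1.span_in_subspace)
    show "A1.subspace {x. x * y \<in> box (a + c) (b + d)}"
      using box_subspace by (auto simp: A1.subspace_def distrib_right A1.scale_mult_left)
    fix x assume "x \<in> (\<lambda>(i, j). u ^ i * v ^ j) ` ({..a} \<times> {..b})"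
    then obtain i j where ij: "x = u ^ i * v ^ j" "i \<le> a" "j \<le> b" by auto
    then show "x \<in> {x. x * y \<in> box (a + c) (b + d)}"
      using mon[of i j] box_mono[of "i + c" "a + c" "j + d" "b + d"] by (auto simp: mult.assoc)
  qed
  then show ?thesis by simp
qed

lemma box_power: "x \<in> box a a \<Longrightarrow> x ^ k \<in> box (k * a) (k * a)"
proof (induction k)
  case 0
  show ?case using box_base[of 0 0 0 0] by simp
qed (auto dest: box_mult)

lemma in_box: obtains a where "x \<in> box a a"
proof -
  define S where "S = (\<Union>a. box a a)"
  have S: "A1.subspace S"
  proof (rule A1.subspaceI)
    fix x y assume "x \<in> S" "y \<in> S"
    then obtain a b where "x \<in> box a a" "y \<in> box b b" by (auto simp: S_def)
    then have "x \<in> box (a + b) (a + b)" "y \<in> box (a + b) (a + b)"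
      using box_mono[of a "a + b" a "a + b"] box_mono[of b "a + b" b "a + b"] by auto
    then have "x + y \<in> box (a + b) (a + b)" by (rule A1.subspace_add[OF box_subspace])
    then show "x + y \<in> S" unfolding S_def by blast
  next
    fix x c assume "x \<in> S"
    then obtain a where "x \<in> box a a" by (auto simp: S_def)
    then have "scale1 c x \<in> box a a" by (rule A1.subspace_scale[OF box_subspace])
    then show "scale1 c x \<in> S" unfolding S_def by blast
  qed (use A1.subspace_0[OF box_subspace] in \<open>auto simp: S_def\<close>)
  have mult: "u * x \<in> S \<and> v * x \<in> S" if x: "x \<in> S" for x
  proof -
    obtain a where "x \<in> box a a" using x by (auto simp: S_def)
    then have "u * x \<in> box (Suc a) (Suc a)" "v * x \<in> box (Suc a) (Suc a)"
      using box_mult_left[of x a a] box_mono[of "Suc a" "Suc a" a "Suc a"] box_mono[of a "Suc a" "Suc a" "Suc a"]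
      by auto
    then show ?thesis by (auto simp: S_def)
  qed
  have "- (v * x) \<in> S" if "x \<in> S" for x
    using mult[OF that] A1.subspace_neg[OF S] by blast
  moreover have "1 \<in> S" using box_base[of 0 0 0 0] by (auto simp: S_def)
  moreover have "weyl_p * x \<in> S" "weyl_q * x \<in> S" if "x \<in> S" for x
    using gens mult[OF that] calculation(1)[OF that] by (metis minus_mult_left)+
  ultimately have "S = UNIV" using weyl_subspace_eq_UNIV[OF S] by blast
  then show thesis using that by (auto simp: S_def)
qed

lemma box_expansion:
  assumes "x \<in> box a b"
  obtains k where "x = (\<Sum>i\<le>a. \<Sum>j\<le>b. scale1 (k i j) (u ^ i * v ^ j))"
proof -
  define S where "S = {x. \<exists>k. x = (\<Sum>i\<le>a. \<Sum>j\<le>b. scale1 (k i j) (u ^ i * v ^ j))}"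
  have "x \<in> S"
    using assms unfolding box_def
  proof (rule A1.span_in_subspace)
    show "A1.subspace S"
    proof (rule A1.subspaceI)
      show "0 \<in> S" by (auto simp: S_def intro!: exI[of _ "\<lambda>_ _. 0"])
      fix x y assume "x \<in> S" "y \<in> S"
      then obtain k l where kl: "x = (\<Sum>i\<le>a. \<Sum>j\<le>b. scale1 (k i j) (u ^ i * v ^ j))"
        "y = (\<Sum>i\<le>a. \<Sum>j\<le>b. scale1 (l i j) (u ^ i * v ^ j))" by (auto simp: S_def)
      show "x + y \<in> S" unfolding S_def kl mem_Collect_eq
        by (rule exI[of _ "\<lambda>i j. k i j + l i j"]) (simp add: A1.scale_left_distrib sum.distrib)
    next
      fix x c assume "x \<in> S"
      then obtain k where k: "x = (\<Sum>i\<le>a. \<Sum>j\<le>b. scale1 (k i j) (u ^ i * v ^ j))"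
        by (auto simp: S_def)
      show "scale1 c x \<in> S" unfolding S_def k mem_Collect_eq
        by (rule exI[of _ "\<lambda>i j. c * k i j"]) (simp add: A1.scale_sum_right)
    qed
    fix x assume "x \<in> (\<lambda>(i, j). u ^ i * v ^ j) ` ({..a} \<times> {..b})"
    then obtain i j where ij: "x = u ^ i * v ^ j" "i \<le> a" "j \<le> b" by auto
    let ?k = "\<lambda>i' j'. if i' = i then (if j' = j then 1 else 0) else 0"
    have "(\<Sum>i'\<le>a. \<Sum>j'\<le>b. scale1 (?k i' j') (u ^ i' * v ^ j'))
        = (\<Sum>i'\<le>a. if i' = i then u ^ i * v ^ j else 0)"
    proof (rule sum.cong)
      fix i'
      have "(\<Sum>j'\<le>b. scale1 (?k i' j') (u ^ i' * v ^ j'))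
          = (\<Sum>j'\<le>b. if j' = j then (if i' = i then u ^ i * v ^ j else 0) else 0)"
        by (rule sum.cong) auto
      then show "(\<Sum>j'\<le>b. scale1 (?k i' j') (u ^ i' * v ^ j'))
          = (if i' = i then u ^ i * v ^ j else 0)" using ij(3) by simp
    qed simp
    also have "\<dots> = x" using ij by simp
    finally have eq: "(\<Sum>i'\<le>a. \<Sum>j'\<le>b. scale1 (?k i' j') (u ^ i' * v ^ j')) = x" .
    show "x \<in> S" unfolding S_def mem_Collect_eq by (rule exI[of _ ?k], rule eq[symmetric])
  qed
  then show thesis using that by (auto simp: S_def)
qed

text \<open>The normally ordered monomial \<open>u^i * v^j\<close> has the symbol
  \<open>xi^i x^j\<close>, so the expansion of \<open>x\<close> can be read off. Injectivity of the
  embedding and non-negativity of orders both follow.\<close>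

lemma cf_expansion:
  assumes "x = (\<Sum>i\<le>a. \<Sum>j\<le>b. scale1 (k i j) (u ^ i * v ^ j))"
  shows "i \<le> a \<Longrightarrow> cf (\<psi> x) (int i) = (\<Sum>j\<le>b. fls_const (k i j) * fls_X ^ j)"
    and "l < 0 \<Longrightarrow> cf (\<psi> x) l = 0"
proof -
  have *: "cf (\<psi> x) l = (\<Sum>i\<le>a. if l = int i then \<Sum>j\<le>b. fls_const (k i j) * fls_X ^ j else 0)" for l
    by (auto simp: assms hom_sum hom hom_power cf_q_hat_p_hat intro!: sum.cong)
  show "i \<le> a \<Longrightarrow> cf (\<psi> x) (int i) = (\<Sum>j\<le>b. fls_const (k i j) * fls_X ^ j)"
    by (simp add: * eq_commute)
  show "l < 0 \<Longrightarrow> cf (\<psi> x) l = 0"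
    unfolding * by (intro sum.neutral) auto
qed

lemma cf_expansion_eq_0:
  assumes "x = (\<Sum>i\<le>a. \<Sum>j\<le>b. scale1 (k i j) (u ^ i * v ^ j))"
    and "cf (\<psi> x) (int i) = 0" "i \<le> a" "j \<le> b"
  shows "k i j = 0"
proof -
  have "0 = fls_nth (\<Sum>j\<le>b. fls_const (k i j) * fls_X ^ j) (int j)"
    using assms cf_expansion(1)[OF assms(1)] by simp
  also have "\<dots> = (\<Sum>j'\<le>b. if j' = j then k i j else 0)"
    unfolding fls_nth_sum by (rule sum.cong) auto
  finally show ?thesis using assms(4) by simp
qed

lemma ord_le_negative:
  assumes "ord_le (\<psi> x) (- 1)"
  shows "x = 0"
proof -
  obtain a where "x \<in> box a a" by (rule in_box[of x])
  then obtain k where k: "x = (\<Sum>i\<le>a. \<Sum>j\<le>a. scale1 (k i j) (u ^ i * v ^ j))"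
    by (rule box_expansion)
  have "k i j = 0" if "i \<le> a" "j \<le> a" for i j
    using cf_expansion_eq_0[OF k _ that] assms by (simp add: ord_le_def)
  then show ?thesis by (simp add: k)
qed

lemma inj: "\<psi> x = 0 \<longleftrightarrow> x = 0"
  using ord_le_negative[of x] by (auto simp: ord_le_zero)

lemma inj_eq: "\<psi> x = \<psi> y \<longleftrightarrow> x = y"
  using inj[of "x - y"] by (simp add: hom_diff)

lemma has_ord_nonneg: "has_ord (\<psi> x) m \<Longrightarrow> m \<ge> 0"
proof (rule ccontr)
  assume m: "has_ord (\<psi> x) m" "\<not> m \<ge> 0"
  then have "x = 0" using ord_le_mono[of "\<psi> x" m "- 1"] by (auto simp: has_ord_def intro: ord_le_negative)
  with m show False by (simp add: has_ord_def)
qed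

lemma ord_le_0_polynomial:
  assumes "ord_le (\<psi> x) 0"
  obtains k b where "x = (\<Sum>j\<le>b. scale1 (k j) (v ^ j))"
proof -
  obtain a where "x \<in> box a a" by (rule in_box[of x])
  then obtain k where k: "x = (\<Sum>i\<le>a. \<Sum>j\<le>a. scale1 (k i j) (u ^ i * v ^ j))"
    by (rule box_expansion)
  have "k i j = 0" if "i \<le> a" "j \<le> a" "i \<noteq> 0" for i j
    using cf_expansion_eq_0[OF k _ that(1,2)] assms that by (simp add: ord_le_def)
  then have "x = (\<Sum>i\<le>a. if i = 0 then \<Sum>j\<le>a. scale1 (k 0 j) (v ^ j) else 0)"
    unfolding k by (intro sum.cong) auto
  then show thesis using that[of "k 0" a] by simp
qed

end

lemma weyl_relation': "weyl_q * weyl_p = weyl_p * weyl_q + (1 :: 'k::field weyl)"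
  using weyl_relation by (simp add: algebra_simps)

interpretation chart_q: weyl_chart weyl_q weyl_p "PD.weyl_eval p_hat q_hat :: 'k::field_char_0 weyl \<Rightarrow> 'k pdo"
  by unfold_locales (simp_all add: weyl_relation PD.weyl_eval_simps[OF weyl_relation_hat])

lemma weyl_relation_hat': "(- p_hat) * q_hat - q_hat * (- p_hat) = (1 :: 'k::field_char_0 pdo)"
  using weyl_relation_hat by (simp add: algebra_simps)

text \<open>The Fourier transform of the first chart: \<open>p\<close> goes to d/dx and
  \<open>q\<close> to \<open>- x\<close>.\<close>

interpretation chart_p: weyl_chart weyl_p "- weyl_q" "PD.weyl_eval q_hat (- p_hat) :: 'k::field_char_0 weyl \<Rightarrow> 'k pdo"
proof unfold_locales
  note e = PD.weyl_eval_simps[OF weyl_relation_hat']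
  have "PD.weyl_eval q_hat (- p_hat) (- a) = - PD.weyl_eval q_hat (- p_hat) a" for a :: "'k weyl"
    using e(3)[of "- 1" a] by simp
  then show "PD.weyl_eval q_hat (- p_hat) (- weyl_q) = (p_hat :: 'k pdo)" by (simp add: e)
qed (simp_all add: PD.weyl_eval_simps[OF weyl_relation_hat'] weyl_relation')

instance weyl :: (field_char_0) ring_1_no_zero_divisors
proof
  fix a b :: "'a weyl"
  assume "a \<noteq> 0" "b \<noteq> 0"
  then show "a * b \<noteq> 0" by (simp flip: chart_q.inj add: chart_q.hom)
qed

text \<open>Order at most 0 in the first chart means a polynomial in \<open>p\<close>; its order in
  the second chart is its degree, which is positive for a non-scalar.\<close>

lemma positive_order_chart:
  fixes z :: "'k::field_char_0 weyl"
  assumes "z \<notin> A1.scalars"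
  obtains u v \<psi> n where "weyl_chart u v \<psi>" "has_ord (\<psi> z) n" "n \<ge> 1"
proof (cases "ord_le (PD.weyl_eval p_hat q_hat z) 0")
  case False
  then have "z \<noteq> 0" by (auto simp: ord_le_zero)
  then obtain n where n: "has_ord (PD.weyl_eval p_hat q_hat z) n"
    using has_ord_ex chart_q.inj by blast
  then have "\<not> n \<le> 0" using False ord_le_mono[of _ n 0] by (auto simp: has_ord_def)
  then show thesis using n by (intro that[OF chart_q.weyl_chart_axioms n]) simp
next
  case True
  then obtain k b where k: "z = (\<Sum>j\<le>b. scale1 (k j) (weyl_p ^ j))"
    by (rule chart_q.ord_le_0_polynomial)
  let ?\<psi> = "PD.weyl_eval q_hat (- p_hat)"
  have cf: "cf (?\<psi> z) (int i) = (if i \<le> b then fls_const (k i) else 0)" for i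
  proof -
    have "cf (?\<psi> z) (int i) = (\<Sum>j\<le>b. if j = i then fls_const (k i) else 0)"
      unfolding k chart_p.hom_sum chart_p.hom chart_p.hom_power cf_sum
    proof (rule sum.cong)
      fix j
      show "cf (scaleD (k j) (q_hat ^ j)) (int i) = (if j = i then fls_const (k i) else 0)"
        using cf_q_hat_p_hat[of j 0 "int i", where 'a='k] by simp
    qed simp
    then show ?thesis by simp
  qed
  have "\<exists>i\<ge>1. cf (?\<psi> z) (int i) \<noteq> 0"
  proof (rule ccontr)
    assume *: "\<not> (\<exists>i\<ge>1. cf (?\<psi> z) (int i) \<noteq> 0)"
    have "k j = 0" if "j \<le> b" "j \<noteq> 0" for j
    proof -
      have "fls_const (k j) = 0" using * that cf[of j] by auto
      then show ?thesis by simp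
    qed
    then have "z = (\<Sum>j\<le>b. if j = 0 then scale1 (k 0) 1 else 0)"
      unfolding k by (intro sum.cong) auto
    then show False using assms by (simp add: A1.scalars_def)
  qed
  then obtain i where i: "i \<ge> 1" "cf (?\<psi> z) (int i) \<noteq> 0" by blast
  then have "?\<psi> z \<noteq> 0" by auto
  then obtain n where n: "has_ord (?\<psi> z) n" by (rule has_ord_ex)
  then have "n \<ge> int i" using i(2) by (auto simp: has_ord_def ord_le_def not_less[symmetric])
  then show thesis using i(1) by (intro that[OF chart_p.weyl_chart_axioms n]) simp
qed

subsection \<open>Nilpotent elements and eigenvectors\<close>

context k_algebra
begin

text \<open>Take the iterate two steps before the first vanishing one; there is room for two steps
  because \<open>x\<close> is not in \<open>C z\<close>.\<close>

lemma nilpotent_step: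
  assumes "x \<in> N z" "x \<notin> C z"
  obtains w where "ad z w \<noteq> 0" "ad z (ad z w) = 0"
proof -
  define m where "m = (LEAST m. (ad z ^^ m) x = 0)"
  have m: "(ad z ^^ m) x = 0" unfolding m_def by (rule LeastI_ex) (use assms(1) in \<open>simp add: N_def\<close>)
  obtain k where k: "m = Suc (Suc k)"
  proof (cases m)
    case 0
    with m assms(2) show ?thesis by simp
  next
    case (Suc k)
    with m assms(2) that show ?thesis by (cases k) (auto simp: C_def)
  qed
  have "(ad z ^^ Suc k) x \<noteq> 0" using not_less_Least[of "Suc k" "\<lambda>m. (ad z ^^ m) x = 0"] k by (auto simp: m_def)
  then show thesis using that[of "(ad z ^^ k) x"] m k by simp
qed

definition ad_minus_scale :: "'a \<Rightarrow> 'k \<Rightarrow> 'a \<Rightarrow> 'a"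
  where "ad_minus_scale z c x = ad z x - scale c x"

lemma ad_minus_scale_linear:
  "ad_minus_scale z c (x + y) = ad_minus_scale z c x + ad_minus_scale z c y"
  "ad_minus_scale z c (scale d x) = scale d (ad_minus_scale z c x)"
  "ad_minus_scale z c 0 = 0"
  by (simp_all add: ad_minus_scale_def ad_add ad_scale scale_right_distrib scale_right_diff_distrib
      mult.commute)

lemma ad_minus_scale_iter:
  "(ad_minus_scale z c ^^ m) 0 = 0"
  "(ad_minus_scale z c ^^ m) (x + y) = (ad_minus_scale z c ^^ m) x + (ad_minus_scale z c ^^ m) y"
  "(ad_minus_scale z c ^^ m) (\<Sum>i\<in>I. f i) = (\<Sum>i\<in>I. (ad_minus_scale z c ^^ m) (f i))"
proof -
  show zero: "(ad_minus_scale z c ^^ m) 0 = 0" for m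
    by (induction m) (simp_all add: ad_minus_scale_linear)
  show add: "(ad_minus_scale z c ^^ m) (x + y) =
      (ad_minus_scale z c ^^ m) x + (ad_minus_scale z c ^^ m) y" for x y
    by (induction m) (simp_all add: ad_minus_scale_linear)
  show "(ad_minus_scale z c ^^ m) (\<Sum>i\<in>I. f i) = (\<Sum>i\<in>I. (ad_minus_scale z c ^^ m) (f i))"
    by (induction I rule: infinite_finite_induct) (simp_all add: zero add)
qed

lemma ad_minus_scale_commute:
  "(ad_minus_scale z c ^^ m) (ad_minus_scale z d x) = ad_minus_scale z d ((ad_minus_scale z c ^^ m) x)"
proof (induction m)
  case (Suc m)
  have "ad_minus_scale z c (ad_minus_scale z d y) = ad_minus_scale z d (ad_minus_scale z c y)" for y
    by (simp add: ad_minus_scale_def ad_diff ad_scale scale_right_diff_distrib mult.commute)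
  with Suc show ?case by simp
qed simp

lemma ad_minus_scale_commute_iter:
  "(ad_minus_scale z c ^^ m) ((ad_minus_scale z d ^^ k) x) =
    (ad_minus_scale z d ^^ k) ((ad_minus_scale z c ^^ m) x)"
  by (induction k) (simp_all add: ad_minus_scale_commute)

lemma generalized_eigen_disjoint:
  assumes "c \<noteq> d" "(ad_minus_scale z c ^^ L) x = 0" "(ad_minus_scale z d ^^ m) x = 0"
  shows "x = 0"
  using assms(2,3)
proof (induction m arbitrary: x)
  case (Suc m)
  have eig: "y = 0" if y: "ad_minus_scale z d y = 0" "(ad_minus_scale z c ^^ L) y = 0" for y
  proof -
    have "ad_minus_scale z c y = scale (d - c) y"
      using y(1) by (simp add: ad_minus_scale_def scale_left_diff_distrib)
    then have "(ad_minus_scale z c ^^ k) y = scale ((d - c) ^ k) y" for k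
      by (induction k) (simp_all add: ad_minus_scale_linear mult.commute)
    with y(2) assms(1) show "y = 0" by simp
  qed
  have "(ad_minus_scale z c ^^ L) (ad_minus_scale z d x) = 0"
    using Suc.prems(1) by (simp add: ad_minus_scale_commute ad_minus_scale_linear)
  moreover have "(ad_minus_scale z d ^^ m) (ad_minus_scale z d x) = 0"
    using Suc.prems(2) by (simp add: funpow_swap1)
  ultimately have "ad_minus_scale z d x = 0" by (rule Suc.IH)
  then show ?case using Suc.prems(1) by (rule eig)
qed simp

text \<open>The \<open>L\<close>-th power of \<open>ad z - c i\<close> removes one summand and,
  commuting with the other such operators, preserves their hypotheses. What survives is annihilated
  for two different eigenvalues, hence zero.\<close>

lemma generalized_eigen_independent:
  assumes "finite J" "inj_on c J" "\<And>j. j \<in> J \<Longrightarrow> (ad_minus_scale z (c j) ^^ L) (f j) = 0"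
    "(\<Sum>j\<in>J. f j) = 0" "j \<in> J"
  shows "f j = 0"
  using assms
proof (induction J arbitrary: f j rule: finite_induct)
  case (insert i J)
  let ?D = "\<lambda>d. ad_minus_scale z d ^^ L"
  have "0 = ?D (c i) (f i + (\<Sum>j\<in>J. f j))"
    using insert by (simp add: ad_minus_scale_iter)
  also have "\<dots> = (\<Sum>j\<in>J. ?D (c i) (f j))"
    using insert.prems(2)[of i] by (simp add: ad_minus_scale_iter)
  finally have sum: "(\<Sum>j\<in>J. ?D (c i) (f j)) = 0" by simp
  have "f j = 0" if j: "j \<in> J" for j
  proof -
    have "?D (c i) (f j) = 0"
    proof (rule insert.IH[where f = "\<lambda>j. ?D (c i) (f j)"])
      show "inj_on c J" using insert.prems(1) by simp
      show "?D (c k) (?D (c i) (f k)) = 0" if "k \<in> J" for k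
        using insert.prems(2)[of k] that ad_minus_scale_commute_iter[where c = "c k" and d = "c i" and x = "f k" and z = z]
        by (simp add: ad_minus_scale_iter)
    qed (use sum j in auto)
    moreover have "?D (c j) (f j) = 0" using insert.prems(2) j by simp
    moreover have "c i \<noteq> c j" using insert.prems(1) insert.hyps(2) j by auto
    ultimately show ?thesis using generalized_eigen_disjoint by blast
  qed
  moreover from this have "f i = 0" using insert.prems(3) insert.hyps by simp
  ultimately show ?case using insert.prems(4) by auto
qed simp

lemma ad_eigen_power:
  assumes "ad z y = scale l y"
  shows "ad z (y ^ j) = scale (of_nat j * l) (y ^ j)"
  by (induction j)
    (simp_all add: ad_mult assms scale_mult_left scale_mult_right scale_left_distrib distrib_right)

lemma ad_minus_scale_iter_mult:
  assumes "ad z y = scale m y"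
  shows "(ad_minus_scale z m ^^ k) (x * y) = (ad z ^^ k) x * y"
  by (induction k) (simp_all add: ad_minus_scale_def ad_mult assms scale_mult_right)

end

lemma pdo_powers_independent:
  assumes e: "has_ord e d" "d \<ge> 1" and sum: "(\<Sum>k<L. scaleD (a k) (e ^ k)) = 0" and k: "k < L"
  shows "a k = 0"
proof (rule ccontr)
  assume "a k \<noteq> 0"
  define A where "A = {k. k < L \<and> a k \<noteq> 0}"
  have A: "finite A" "k \<in> A" using k \<open>a k \<noteq> 0\<close> by (auto simp: A_def)
  define t where "t = Max A"
  have t: "t \<in> A" "\<And>j. j \<in> A \<Longrightarrow> j \<le> t" using A unfolding t_def by (auto intro: Max_in)
  have "0 = cf (\<Sum>k<L. scaleD (a k) (e ^ k)) (int t * d)" by (simp add: sum)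
  also have "\<dots> = (\<Sum>k<L. if k = t then fls_const (a t) * cf (e ^ t) (int t * d) else 0)"
    unfolding cf_sum
  proof (rule sum.cong)
    fix j assume "j \<in> {..<L}"
    then consider "j = t" | "a j = 0" | "j < t"
      using t(2)[of j] by (cases "j = t"; cases "j < t") (auto simp: A_def)
    then show "cf (scaleD (a j) (e ^ j)) (int t * d) =
        (if j = t then fls_const (a t) * cf (e ^ t) (int t * d) else 0)"
    proof cases
      case 2
      then show ?thesis using t(1) by (auto simp: A_def)
    next
      case 3
      then have "int j * d < int t * d" using e(2) by simp
      then show ?thesis using has_ord_power[OF e(1), of j] 3 by (auto simp: has_ord_def ord_le_def)
    qed simp
  qed simp
  also have "\<dots> = fls_const (a t) * cf (e ^ t) (int t * d)" using t(1) by (simp add: A_def)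
  finally show False using has_ord_power[OF e(1), of t] t(1) by (auto simp: has_ord_def A_def)
qed

context weyl_chart
begin

lemma powers_independent:
  assumes "has_ord (\<psi> z) n" "n \<ge> 1" "(\<Sum>k<L. scale1 (a k) (z ^ k)) = 0" "k < L"
  shows "a k = 0"
proof (rule pdo_powers_independent[OF assms(1,2) _ assms(4)])
  have "(\<Sum>k<L. scaleD (a k) (\<psi> z ^ k)) = \<psi> (\<Sum>k<L. scale1 (a k) (z ^ k))"
    by (simp add: hom_sum hom hom_power)
  then show "(\<Sum>k<L. scaleD (a k) (\<psi> z ^ k)) = 0" by (simp add: assms(3))
qed

text \<open>Otherwise the monomials \<open>x\<^sup>i y\<^sup>j z\<^sup>k\<close> would be linearly independent, and the Weyl algebra would
  have at least cubic growth, whereas the boxes show that its growth is quadratic.\<close>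

lemma no_nilpotent_and_eigenvector:
  assumes z: "has_ord (\<psi> z) n" "n \<ge> 1"
    and y: "ad z y = scale1 l y" "l \<noteq> 0" "y \<noteq> 0" and x: "ad z x \<noteq> 0" "ad z (ad z x) = 0"
  shows False
proof -
  obtain d1 d2 d3 where "x \<in> box d1 d1" "y \<in> box d2 d2" "z \<in> box d3 d3" using in_box by metis
  define d where "d = d1 + d2 + d3"
  have d: "x \<in> box d d" "y \<in> box d d" "z \<in> box d d"
    using \<open>x \<in> box d1 d1\<close> \<open>y \<in> box d2 d2\<close> \<open>z \<in> box d3 d3\<close>
      box_mono[of d1 d d1 d] box_mono[of d2 d d2 d] box_mono[of d3 d d3 d] by (auto simp: d_def)
  \<comment> \<open>Chosen so that the \<open>L^3\<close> monomials outnumber the spanning set of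
    the box that contains them: its size is at most \<open>(M + 1)^2\<close>, where
    \<open>M + 1 <= L * (3 * d + 1)\<close> and \<open>(3 * d + 1)^2 < L\<close>.\<close>
  define L where "L = Suc ((3 * d + 1) ^ 2)"
  define M where "M = 3 * L * d"
  define f where "f = (\<lambda>(i, j, k). x ^ i * y ^ j * z ^ k)"
  let ?I = "{..<L} \<times> {..<L} \<times> {..<L}"
  let ?B = "(\<lambda>(i, j). u ^ i * v ^ j) ` ({..M} \<times> {..M})"
  have "M + 1 \<le> L * (3 * d + 1)" by (simp add: M_def L_def algebra_simps)
  then have "(M + 1) ^ 2 \<le> (L * (3 * d + 1)) ^ 2" by (rule power_mono) simp
  also have "\<dots> = L * L * (3 * d + 1) ^ 2" by (simp only: power2_eq_square mult.assoc mult.left_commute)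
  also have "\<dots> < L * L * L" by (intro mult_strict_left_mono) (simp_all add: L_def)
  finally have "(M + 1) ^ 2 < L * L * L" .
  moreover have "card ?B \<le> (M + 1) ^ 2"
    using card_image_le[of "{..M} \<times> {..M}" "\<lambda>(i, j). u ^ i * v ^ j"] by (simp add: power2_eq_square)
  ultimately have card: "card ?B < card ?I" by (simp add: card_cartesian_product mult.assoc)
  have sp: "f t \<in> A1.span ?B" if tI: "t \<in> ?I" for t
  proof -
    obtain i j k where t: "t = (i, j, k)" "i < L" "j < L" "k < L" using tI by (cases t) auto
    have "f t \<in> box (i * d + j * d + k * d) (i * d + j * d + k * d)"
      unfolding f_def t by (simp add: box_mult box_power d)
    moreover have "i * d + j * d + k * d \<le> M"
      using t mult_right_mono[of "i + j + k" "3 * L" d] by (simp add: M_def algebra_simps)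
    ultimately have "f t \<in> box M M" using box_mono by blast
    then show ?thesis by (simp add: box_def)
  qed
  have fin: "finite ?I" "finite ?B" by simp_all
  obtain a where a: "\<exists>t\<in>?I. a t \<noteq> 0" "(\<Sum>t\<in>?I. scale1 (a t) (f t)) = 0"
    using A1.dependent_family[of ?I ?B f, OF fin card sp] by blast
  define P where "P i j = (\<Sum>k<L. scale1 (a (i, j, k)) (z ^ k))" for i j
  have zP: "ad z (P i j) = 0" for i j
  proof -
    have "P i j \<in> A1.C z" unfolding P_def
      by (intro A1.subspace_sum A1.C_subspace A1.C_scale A1.C_power A1.C_self)
    then show ?thesis by (simp add: A1.C_def)
  qed
  \<comment> \<open>The relation is sorted by eigenvalue: \<open>y^j * P i j\<close> is an
    eigenvector for \<open>j l\<close>, and the factors \<open>x^i\<close> with \<open>i < L\<close>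
    make \<open>w j\<close> a generalized one of exponent \<open>L\<close>. Characteristic 0 keeps
    the values \<open>j l\<close> distinct.\<close>
  define w where "w j = (\<Sum>i<L. x ^ i * (y ^ j * P i j))" for j
  have yP: "ad z (y ^ j * P i j) = scale1 (of_nat j * l) (y ^ j * P i j)" for i j
    by (simp add: ad_mult zP A1.ad_eigen_power[OF y(1)] A1.scale_mult_left)
  have D: "(A1.ad_minus_scale z (of_nat j * l) ^^ m) (w j) =
      (\<Sum>i<L. (ad z ^^ m) (x ^ i) * (y ^ j * P i j))" for j m
    unfolding w_def A1.ad_minus_scale_iter by (simp add: A1.ad_minus_scale_iter_mult[OF yP])
  note top = ad_iter_power_top[OF x(2)]
  have nil: "(ad z ^^ m) (x ^ i) = 0" if "i < m" for i m
    using ad_iter_eq_0_mono[OF conjunct1[OF top[of i]], of m] that by simp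
  have "(\<Sum>j<L. w j) = (\<Sum>j<L. \<Sum>i<L. \<Sum>k<L. scale1 (a (i, j, k)) (f (i, j, k)))"
    by (simp add: w_def P_def f_def sum_distrib_left A1.scale_mult_right mult.assoc)
  also have "\<dots> = (\<Sum>i<L. \<Sum>j<L. \<Sum>k<L. scale1 (a (i, j, k)) (f (i, j, k)))"
    by (rule sum.swap)
  also have "\<dots> = (\<Sum>t\<in>?I. scale1 (a t) (f t))"
    by (simp add: sum.cartesian_product case_prod_unfold)
  finally have "(\<Sum>j<L. w j) = 0" using a(2) by simp
  have w0: "w j = 0" if "j < L" for j
  proof (rule A1.generalized_eigen_independent[where J = "{..<L}" and L = L and z = z and
        c = "\<lambda>j. of_nat j * l" and f = w])
    show "inj_on (\<lambda>j. of_nat j * l) {..<L}" using y(2) by (auto intro!: inj_onI)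
    show "(A1.ad_minus_scale z (of_nat j * l) ^^ L) (w j) = 0" for j
      unfolding D by (intro sum.neutral) (simp add: nil)
  qed (use that \<open>(\<Sum>j<L. w j) = 0\<close> in auto)
  have P0: "P i j = 0" if ij: "i < L" "j < L" for i j
  proof (rule ccontr)
    assume "P i j \<noteq> 0"
    define A where "A = {i. i < L \<and> P i j \<noteq> 0}"
    define t where "t = Max A"
    have A: "finite A" "i \<in> A" using ij \<open>P i j \<noteq> 0\<close> by (auto simp: A_def)
    have t: "t \<in> A" "\<And>i. i \<in> A \<Longrightarrow> i \<le> t"
      using A unfolding t_def by (auto intro: Max_in)
    \<comment> \<open>With \<open>t\<close> the largest \<open>i\<close> such that
      \<open>P i j\<close> is non-zero, \<open>t\<close> applications of \<open>ad z\<close> leave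
      only \<open>fact t * (ad z x)^t * y^j * P t j\<close>, a product of non-zero factors.\<close>
    have "0 = (\<Sum>i<L. (ad z ^^ t) (x ^ i) * (y ^ j * P i j))"
      using D[where j = j and m = t] w0[OF ij(2)] by (simp add: A1.ad_minus_scale_iter)
    also have "\<dots> = (\<Sum>i<L. if i = t then (ad z ^^ t) (x ^ t) * (y ^ j * P t j) else 0)"
    proof (rule sum.cong)
      fix i assume "i \<in> {..<L}"
      then consider "i = t" | "P i j = 0" | "i < t"
        using t(2)[of i] by (cases "i = t"; cases "i < t") (auto simp: A_def)
      then show "(ad z ^^ t) (x ^ i) * (y ^ j * P i j) =
          (if i = t then (ad z ^^ t) (x ^ t) * (y ^ j * P t j) else 0)"
        by cases (auto simp: nil)
    qed simp
    also have "\<dots> = of_nat (fact t) * ad z x ^ t * (y ^ j * P t j)"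
      using t(1) conjunct2[OF top[of t]] by (simp add: A_def)
    finally show False
      using x(1) y(3) t(1) by (simp add: A_def A1.of_nat_conv_scale A1.scale_mult_left)
  qed
  have "a t = 0" if t: "t \<in> ?I" for t
  proof -
    obtain i j k where ijk: "t = (i, j, k)" "i < L" "j < L" "k < L" using t by (cases t) auto
    show ?thesis
      using powers_independent[OF z, where a = "\<lambda>k. a (i, j, k)" and L = L and k = k] P0[of i j] ijk
      by (simp add: P_def)
  qed
  with a(1) show False by blast
qed

end

lemma scalar_ad_zero: "z \<in> A1.scalars \<Longrightarrow> ad z x = 0"
  by (auto simp: A1.scalars_def A1.ad_scale_left ad_def A1.scale_mult_left A1.scale_mult_right)

lemma N_eq_C_if_eigenvector:
  fixes z :: "'k::field_char_0 weyl"
  assumes "ad z y = scale1 l y" "l \<noteq> 0" "y \<noteq> 0"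
  shows "A1.N z = A1.C z"
proof (rule ccontr)
  assume "A1.N z \<noteq> A1.C z"
  then obtain x where x: "x \<in> A1.N z" "x \<notin> A1.C z" using A1.C_subset_N by blast
  obtain w where w: "ad z w \<noteq> 0" "ad z (ad z w) = 0" by (rule A1.nilpotent_step[OF x])
  have "z \<notin> A1.scalars" using w(1) scalar_ad_zero by blast
  then obtain u v \<psi> n where "weyl_chart u v \<psi>" "has_ord (\<psi> z) n" "n \<ge> 1"
    by (rule positive_order_chart)
  then show False using weyl_chart.no_nilpotent_and_eigenvector assms w by blast
qed

subsection \<open>Centralizers of elements with a non-zero eigenvalue\<close>

text \<open>By \<open>eigen_symbol_unique\<close> with eigenvalue 0, two elements of the same order
  differ, up to a scalar factor, by one of lower order. So each of the orders
  \<open>0, ..., k - 1\<close> adds at most one basis vector.\<close>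

lemma centralizer_subspace_dimension:
  assumes Z: "has_ord Z n" "n \<ge> 1" and S: "PD.subspace S" "S \<subseteq> PD.C Z"
    and nonneg: "\<And>b m. b \<in> S \<Longrightarrow> has_ord b m \<Longrightarrow> m \<ge> 0"
  obtains B where "finite B" "card B \<le> k" "\<And>b. b \<in> S \<Longrightarrow> ord_le b (int k - 1) \<Longrightarrow> b \<in> PD.span B"
proof -
  have "\<exists>B. finite B \<and> card B \<le> k \<and> (\<forall>b\<in>S. ord_le b (int k - 1) \<longrightarrow> b \<in> PD.span B)"
  proof (induction k)
    case 0
    have "b = 0" if "b \<in> S" "ord_le b (- 1)" for b
    proof (rule ccontr)
      assume "b \<noteq> 0"
      then obtain m where "has_ord b m" by (rule has_ord_ex)
      with nonneg[OF that(1)] has_ord_le[OF _ that(2)] show False by force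
    qed
    then show ?case by (intro exI[of _ "{}"]) auto
  next
    case (Suc k)
    then obtain B where B: "finite B" "card B \<le> k"
      "\<And>b. b \<in> S \<Longrightarrow> ord_le b (int k - 1) \<Longrightarrow> b \<in> PD.span B" by blast
    show ?case
    proof (cases "\<exists>b\<in>S. has_ord b (int k)")
      case False
      then have "b \<in> PD.span B" if "b \<in> S" "ord_le b (int k)" for b
        using that B(3)[OF that(1) ord_le_pred[OF that(2)]] by (auto simp: has_ord_def)
      with B show ?thesis by (intro exI[of _ B]) auto
    next
      case True
      then obtain c where c: "c \<in> S" "has_ord c (int k)" by blast
      have eig: "ad Z b = scaleD 0 b" if "b \<in> S" for b using S(2) that by (auto simp: PD.C_def)
      have "b \<in> PD.span (insert c B)" if b: "b \<in> S" "ord_le b (int k)" for b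
      proof -
        obtain t where t: "ord_le (b - scaleD t c) (int k - 1)"
          by (rule eigen_symbol_unique[OF Z eig[OF b(1)] b(2) eig[OF c(1)] c(2)])
        have "b - scaleD t c \<in> S"
          by (intro PD.subspace_diff[OF S(1)] PD.subspace_scale[OF S(1)] b c)
        then have "b - scaleD t c \<in> PD.span B" using t by (rule B(3))
        then show ?thesis by (auto simp: PD.span_insert)
      qed
      moreover have "card (insert c B) \<le> Suc k" using card_insert_le_m1 B by (simp add: card_insert_if)
      ultimately show ?thesis using B(1) by (intro exI[of _ "insert c B"]) auto
    qed
  qed
  then show thesis using that by blast
qed

locale weyl_eigenvector = weyl_chart u v \<psi> for u v :: "'k::field_char_0 weyl" and \<psi> +
  fixes z y :: "'k weyl" and n m :: int and l :: 'k and Y' :: "'k pdo"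
  assumes z: "has_ord (\<psi> z) n" "n \<ge> 1"
    and y: "has_ord (\<psi> y) m" "ad z y = scale1 l y" "l \<noteq> 0"
    and Y': "\<psi> y * Y' = 1" "Y' * \<psi> y = 1"
begin

abbreviation "Z \<equiv> \<psi> z"
abbreviation "Y \<equiv> \<psi> y"

lemma Y'_simps: "Y * (Y' * a) = a" "Y' * (Y * a) = a"
  by (simp_all add: Y' flip: mult.assoc)

definition \<sigma> :: "'k pdo \<Rightarrow> 'k pdo" where "\<sigma> b = Y' * b * Y"

text \<open>As \<open>\<sigma> Z = Z + l\<close>, this is the difference operator of step
  \<open>l\<close> on polynomials in \<open>Z\<close>.\<close>

definition \<delta> :: "'k pdo \<Rightarrow> 'k pdo" where "\<delta> b = \<sigma> b - b"

lemma \<sigma>_simps: "\<sigma> (a + b) = \<sigma> a + \<sigma> b" "\<sigma> (a * b) = \<sigma> a * \<sigma> b" "\<sigma> (scaleD c a) = scaleD c (\<sigma> a)" "\<sigma> 1 = 1"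
  by (simp_all add: \<sigma>_def distrib_left distrib_right PD.scale_mult_left PD.scale_mult_right Y' Y'_simps mult.assoc)

lemma \<delta>_simps: "\<delta> (a - b) = \<delta> a - \<delta> b" "\<delta> (scaleD c a) = scaleD c (\<delta> a)"
  by (simp_all add: \<delta>_def \<sigma>_def algebra_simps PD.scale_mult_left PD.scale_mult_right PD.scale_right_diff_distrib)

lemma \<delta>_iter_simps:
  "(\<delta> ^^ j) (a - b) = (\<delta> ^^ j) a - (\<delta> ^^ j) b" "(\<delta> ^^ j) (scaleD c a) = scaleD c ((\<delta> ^^ j) a)"
  by (induction j) (simp_all add: \<delta>_simps)

lemma ad_Z_Y: "ad Z Y = scaleD l Y"
  by (simp flip: hom_ad add: y hom)

text \<open>\<open>Y\<close> and its inverse are eigenvectors with opposite eigenvalues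
  \<open>l\<close> and \<open>- l\<close>, which cancel in the conjugate.\<close>

lemma \<sigma>_C: "b \<in> PD.C Z \<Longrightarrow> \<sigma> b \<in> PD.C Z"
proof -
  assume b: "b \<in> PD.C Z"
  have "ad Z (Y' * Y) = ad Z Y' * Y + Y' * ad Z Y" by (rule ad_mult)
  then have "ad Z Y' * Y = - scaleD l 1" by (simp add: Y' ad_Z_Y PD.scale_mult_right eq_neg_iff_add_eq_0)
  moreover have "ad Z Y' = ad Z Y' * Y * Y'" by (simp add: mult.assoc Y')
  ultimately have "ad Z Y' = - scaleD l 1 * Y'" by (simp only:)
  then have "ad Z Y' = - scaleD l Y'" by (simp add: PD.scale_mult_left)
  with b show "\<sigma> b \<in> PD.C Z"
    by (simp add: \<sigma>_def PD.C_def ad_mult ad_Z_Y PD.scale_mult_left PD.scale_mult_right mult.assoc)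
qed

text \<open>\<open>R k\<close> is the algebra generated by \<open>\<sigma>\<^sup>i C(z)\<close> for \<open>i \<le> k\<close>. It becomes integral, that is, part of
  the Weyl algebra, after multiplication by \<open>Y\<^sup>k\<close>; as it is closed under powers, its elements
  cannot have negative order.\<close>

primrec R :: "nat \<Rightarrow> 'k pdo set" where
  "R 0 = \<psi> ` A1.C z"
| "R (Suc k) = PD.span {\<sigma> r * \<psi> c | r c. r \<in> R k \<and> c \<in> A1.C z}"

lemma R_subspace: "PD.subspace (R k)"
proof (cases k)
  case 0
  have "PD.subspace (\<psi> ` A1.C z)"
  proof (rule PD.subspaceI)
    show "0 \<in> \<psi> ` A1.C z" using hom_zero by (metis A1.C_0 imageI)
    show "a + b \<in> \<psi> ` A1.C z" if "a \<in> \<psi> ` A1.C z" "b \<in> \<psi> ` A1.C z" for a b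
      using that by (auto simp flip: hom intro!: imageI A1.C_add)
    show "scaleD c a \<in> \<psi> ` A1.C z" if "a \<in> \<psi> ` A1.C z" for a c
      using that by (auto simp flip: hom intro!: imageI A1.C_scale)
  qed
  then show ?thesis using 0 by simp
qed simp

lemma \<psi>_C: "c \<in> A1.C z \<Longrightarrow> \<psi> c \<in> PD.C Z"
  by (simp add: A1.C_def PD.C_def flip: hom_ad)

lemma R_C: "R k \<subseteq> PD.C Z"
proof (induction k)
  case (Suc k)
  then have "{\<sigma> r * \<psi> c | r c. r \<in> R k \<and> c \<in> A1.C z} \<subseteq> PD.C Z"
    by (auto intro!: PD.C_mult \<sigma>_C \<psi>_C)
  then show ?case by (simp add: PD.span_minimal PD.C_subspace)
qed (auto intro: \<psi>_C)

lemma R_commute: "a \<in> PD.C Z \<Longrightarrow> b \<in> PD.C Z \<Longrightarrow> a * b = b * a"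
  by (rule centralizer_commutative[OF z])

text \<open>Commutativity of the centralizer of \<open>Z\<close> lets \<open>\<psi> c\<close> pass
  \<open>\<sigma> s\<close>, so that products of generators are again generators.\<close>

lemma R_mult: "a \<in> R k \<Longrightarrow> b \<in> R k \<Longrightarrow> a * b \<in> R k"
proof (induction k arbitrary: a b)
  case 0
  then obtain c d where "a = \<psi> c" "b = \<psi> d" "c \<in> A1.C z" "d \<in> A1.C z" by auto
  then show ?case by (auto simp flip: hom intro!: imageI A1.C_mult)
next
  case (Suc k)
  let ?G = "{\<sigma> r * \<psi> c | r c. r \<in> R k \<and> c \<in> A1.C z}"
  have G: "a * b \<in> R (Suc k)" if "a \<in> ?G" "b \<in> ?G" for a b
  proof -
    obtain r c s d where rs: "a = \<sigma> r * \<psi> c" "b = \<sigma> s * \<psi> d" "r \<in> R k" "s \<in> R k" "c \<in> A1.C z" "d \<in> A1.C z"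
      using \<open>a \<in> ?G\<close> \<open>b \<in> ?G\<close> by blast
    have "\<psi> c * \<sigma> s = \<sigma> s * \<psi> c" using rs R_C by (intro R_commute \<psi>_C \<sigma>_C) auto
    then have "a * b = \<sigma> (r * s) * \<psi> (c * d)"
      unfolding rs \<sigma>_simps hom by (metis mult.assoc)
    moreover have "\<sigma> (r * s) * \<psi> (c * d) \<in> ?G" using rs Suc.IH A1.C_mult by blast
    ultimately show ?thesis by (simp add: PD.span_base)
  qed
  have sub: "PD.subspace {a. a * b \<in> R (Suc k)}" "PD.subspace {b. a * b \<in> R (Suc k)}" for a b
    using R_subspace[of "Suc k"]
    by (auto simp: PD.subspace_def distrib_left distrib_right PD.scale_mult_left PD.scale_mult_right)
  have 1: "a * b \<in> R (Suc k)" if "a \<in> ?G" "b \<in> R (Suc k)" for a b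
    using PD.span_in_subspace[of b ?G "{b. a * b \<in> R (Suc k)}"] that G sub by auto
  show ?case
    using PD.span_in_subspace[of a ?G "{a. a * b \<in> R (Suc k)}"] Suc.prems 1 sub by auto
qed

lemma R_one: "1 \<in> R 0"
  using hom(4) by (metis A1.C_1 R.simps(1) imageI)

lemma R_step: "r \<in> R k \<Longrightarrow> \<sigma> r \<in> R (Suc k)"
  using hom(4) A1.C_1[of z] by (auto intro!: PD.span_base exI[of _ r] exI[of _ "1 :: 'k weyl"])

lemma R_mono: "r \<in> R k \<Longrightarrow> r \<in> R (Suc k)"
proof -
  have "R k \<subseteq> R (Suc k)"
  proof (induction k)
    case 0
    have "\<psi> c \<in> {\<sigma> r * \<psi> c | r c. r \<in> R 0 \<and> c \<in> A1.C z}" if "c \<in> A1.C z" for c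
      using R_one that \<sigma>_simps(4) by (metis (mono_tags, lifting) mem_Collect_eq mult_1_left)
    then have "R 0 \<subseteq> {\<sigma> r * \<psi> c | r c. r \<in> R 0 \<and> c \<in> A1.C z}"
      unfolding R.simps(1)[symmetric] by auto
    then show ?case unfolding R.simps(2) using PD.span_superset by blast
  next
    case (Suc k)
    then show ?case unfolding R.simps(2)[of "Suc k"] R.simps(2)[of k] by (intro PD.span_mono) blast
  qed
  then show "r \<in> R k \<Longrightarrow> r \<in> R (Suc k)" by blast
qed

lemma R_integral: "r \<in> R k \<Longrightarrow> Y ^ k * r \<in> range \<psi>"
proof (induction k arbitrary: r)
  case (Suc k)
  have range: "PD.subspace (range \<psi>)"
  proof (rule PD.subspaceI)
    show "0 \<in> range \<psi>" by (rule range_eqI[of _ _ 0]) simp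
  qed (auto simp flip: hom(1,3))
  have "PD.subspace {r. Y ^ Suc k * r \<in> range \<psi>}"
    using range by (auto simp: PD.subspace_def distrib_left PD.scale_mult_right simp del: power_Suc)
  moreover have "Y ^ Suc k * (\<sigma> r * \<psi> c) \<in> range \<psi>" if r: "r \<in> R k" for r c
  proof -
    obtain a where "Y ^ k * r = \<psi> a" using Suc.IH[OF r] by auto
    moreover have "Y ^ Suc k * (\<sigma> r * \<psi> c) = (Y ^ k * r) * Y * \<psi> c"
      by (simp add: \<sigma>_def mult.assoc power_Suc2 Y'_simps del: power_Suc)
    ultimately have "Y ^ Suc k * (\<sigma> r * \<psi> c) = \<psi> (a * y * c)" by (simp add: hom)
    then show ?thesis by simp
  qed
  ultimately show ?case
    using Suc.prems PD.span_in_subspace[of r "{\<sigma> r * \<psi> c | r c. r \<in> R k \<and> c \<in> A1.C z}"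
        "{r. Y ^ Suc k * r \<in> range \<psi>}"] by auto
qed auto

lemma R_nonneg:
  assumes r: "r \<in> R k" "has_ord r d"
  shows "d \<ge> 0"
proof (rule ccontr)
  assume "\<not> d \<ge> 0"
  have m: "m \<ge> 0" by (rule has_ord_nonneg[OF y(1)])
  \<comment> \<open>Multiplication by \<open>Y^k\<close> raises the order by \<open>k * m\<close>;
    the power \<open>Suc j\<close> of an element of negative order lowers it by at least
    \<open>k * m + 1\<close>.\<close>
  define j where "j = nat (int k * m)"
  have "r ^ Suc j \<in> R k"
    by (induction j) (use r(1) R_mult in auto)
  then obtain a where "Y ^ k * r ^ Suc j = \<psi> a" using R_integral by blast
  moreover have "has_ord (Y ^ k * r ^ Suc j) (int k * m + int (Suc j) * d)"
    by (intro has_ord_mult has_ord_power y r)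
  ultimately have "int k * m + int (Suc j) * d \<ge> 0" using has_ord_nonneg by metis
  moreover have "int (Suc j) * d \<le> int (Suc j) * (- 1)"
    using \<open>\<not> d \<ge> 0\<close> by (intro mult_left_mono) auto
  moreover have "int j = int k * m" using m by (simp add: j_def)
  ultimately show False by simp
qed

lemma R_eq_0:
  assumes "r \<in> R k" "ord_le r (- 1)"
  shows "r = 0"
proof (rule ccontr)
  assume "r \<noteq> 0"
  then obtain d where "has_ord r d" by (rule has_ord_ex)
  with R_nonneg[OF assms(1)] has_ord_le[OF _ assms(2)] show False by force
qed

lemma \<delta>_R: "r \<in> R k \<Longrightarrow> \<delta> r \<in> R (Suc k)"
  unfolding \<delta>_def by (intro PD.subspace_diff R_subspace R_step R_mono)

lemma \<delta>_iter_R: "r \<in> R 0 \<Longrightarrow> (\<delta> ^^ j) r \<in> R j"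
  by (induction j) (simp_all add: \<delta>_R del: R.simps)

text \<open>Leading coefficients multiply in the commutative field K((x)), so conjugation leaves the
  leading coefficient unchanged and it cancels in the difference.\<close>

lemma \<delta>_ord: "ord_le b d \<Longrightarrow> ord_le (\<delta> b) (d - 1)"
proof -
  assume b: "ord_le b d"
  have Yo: "ord_le Y m" "ord_le Y' (- m)" using y(1) has_ord_inverse[OF y(1) Y'(1)] by (auto simp: has_ord_def)
  note 1 = ord_le_mult[OF Yo(2) b]
  have "ord_le (\<sigma> b) d" using ord_le_mult[OF 1 Yo(1)] by (simp add: \<sigma>_def)
  moreover have "cf (\<sigma> b) d = cf b d"
  proof -
    have "cf Y' (- m) * cf Y m = 1" using cf_mult(1)[OF Yo(2,1)] Y' by simp
    moreover have "cf (\<sigma> b) d = cf Y' (- m) * cf b d * cf Y m"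
      using cf_mult(1)[OF 1 Yo(1)] cf_mult(1)[OF Yo(2) b] by (simp add: \<sigma>_def)
    ultimately show ?thesis by (simp add: algebra_simps)
  qed
  ultimately show ?thesis unfolding \<delta>_def using b by (intro ord_le_pred ord_le_diff) simp_all
qed

text \<open>The order drops with each step, and an element of some \<open>R k\<close> with negative
  order is zero.\<close>

lemma \<delta>_nilpotent:
  assumes "c \<in> A1.C z"
  obtains j where "(\<delta> ^^ j) (\<psi> c) = 0"
proof -
  obtain d where d: "ord_le (\<psi> c) d" by (rule ord_le_ex[of "\<psi> c"])
  have "ord_le ((\<delta> ^^ j) (\<psi> c)) (d - int j)" for j
    by (induction j) (use d \<delta>_ord in \<open>force simp: algebra_simps\<close>)+
  then have "ord_le ((\<delta> ^^ nat (d + 1)) (\<psi> c)) (- 1)"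
    by (rule ord_le_mono) simp
  moreover have "(\<delta> ^^ nat (d + 1)) (\<psi> c) \<in> R (nat (d + 1))" using assms by (intro \<delta>_iter_R) simp
  ultimately show thesis using that R_eq_0 by blast
qed

text \<open>Translates iterated differences into iterated commutators with \<open>Y\<close>, for
  which the Leibniz lemma on powers is available: \<open>ad Y Z\<close> is a multiple of
  \<open>Y\<close>, so \<open>ad Y\<close> kills it.\<close>

lemma Y_\<delta>: "Y ^ j * (\<delta> ^^ j) b = (- 1) ^ j * (ad Y ^^ j) b"
proof (induction j)
  case (Suc j)
  have "Y * \<delta> a = - ad Y a" for a
    by (simp add: \<delta>_def \<sigma>_def ad_def algebra_simps Y'_simps)
  then have "Y ^ Suc j * (\<delta> ^^ Suc j) b = - (Y ^ j * ad Y ((\<delta> ^^ j) b))"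
    by (simp add: power_Suc2 mult.assoc del: power_Suc)
  also have "\<dots> = - ad Y (Y ^ j * (\<delta> ^^ j) b)"
    by (simp add: ad_mult[of Y "Y ^ j"] ad_eq_0_iff[THEN iffD2] power_commutes)
  also have "\<dots> = (- 1) ^ Suc j * (ad Y ^^ Suc j) b"
    unfolding Suc by (cases "even j") (simp_all add: ad_minus)
  finally show ?case .
qed simp

lemma ad_Y_power: "(ad Y ^^ j) (Z ^ j) = of_nat (fact j) * (- scaleD l Y) ^ j"
  "k < j \<Longrightarrow> (ad Y ^^ j) (Z ^ k) = 0"
proof -
  have 1: "ad Y Z = - scaleD l Y" using ad_swap[of Y Z] ad_Z_Y by simp
  then have "ad Y (ad Y Z) = 0" by (simp add: ad_minus PD.ad_scale)
  note top = ad_iter_power_top[OF this]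
  show "(ad Y ^^ j) (Z ^ j) = of_nat (fact j) * (- scaleD l Y) ^ j" using top[of j] 1 by simp
  show "k < j \<Longrightarrow> (ad Y ^^ j) (Z ^ k) = 0"
    using ad_iter_eq_0_mono[OF conjunct1[OF top[of k]], of j] by simp
qed

lemma Y_nonzero: "Y \<noteq> 0"
  using has_ord_nonzero y(1) by blast

lemma \<delta>_iter_power: "(\<delta> ^^ j) (Z ^ j) = scaleD (of_nat (fact j) * l ^ j) 1"
proof -
  have pow: "(- scaleD l Y) ^ j = (- 1) ^ j * scaleD (l ^ j) (Y ^ j)"
  proof (induction j)
    case (Suc j)
    then show ?case by (cases "even j") (simp_all add: PD.scale_mult_left PD.scale_mult_right mult.commute)
  qed simp
  have "Y ^ j * (\<delta> ^^ j) (Z ^ j) = Y ^ j * scaleD (of_nat (fact j) * l ^ j) 1"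
    unfolding Y_\<delta> ad_Y_power(1) pow PD.of_nat_conv_scale
    by (cases "even j") (simp_all add: PD.scale_mult_right)
  then show ?thesis using Y_nonzero by simp
qed

text \<open>In order 0 a scalar can be subtracted and \<open>R_eq_0\<close> applies. An invariant of
  positive order commutes with \<open>Y\<close>, whereas \<open>ad Y\<close> lowers powers of
  \<open>Z\<close>, so the products \<open>e^i * Z^k\<close> would be independent: quadratic growth,
  where one dimension in each order allows only linear growth.\<close>

lemma \<sigma>_invariant_scalar:
  assumes e: "e \<in> R j" "\<delta> e = 0"
  obtains c where "e = scaleD c 1"
proof (cases "e = 0")
  case True
  then show thesis using that[of 0] by simp
next
  case False
  then obtain d where d: "has_ord e d" by (rule has_ord_ex)
  have "d \<ge> 0" using R_nonneg[OF e(1) d] .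
  have one: "1 \<in> R j" by (induction j) (use R_one R_mono in auto)
  have eC: "e \<in> PD.C Z" using e R_C by blast
  have eig: "ad Z b = scaleD 0 b" if "b \<in> PD.C Z" for b using that by (auto simp: PD.C_def)
  show thesis
  proof (cases "d = 0")
    case True
    then have "ord_le e 0" using d by (simp add: has_ord_def)
    then obtain c where c: "ord_le (e - scaleD c 1) (0 - 1)"
      by (rule eigen_symbol_unique[OF z eig[OF eC] _ eig[OF PD.C_1] has_ord_one])
    moreover have "e - scaleD c 1 \<in> R j"
      by (intro PD.subspace_diff PD.subspace_scale R_subspace e one)
    ultimately have "e - scaleD c 1 = 0" by (intro R_eq_0) simp_all
    then show thesis using that[of c] by simp
  next
    case False
    with \<open>d \<ge> 0\<close> have d1: "d \<ge> 1" by simp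
    have YE: "ad Y e = 0"
      using arg_cong[OF e(2), of "(*) Y"] by (simp add: \<delta>_def \<sigma>_def ad_def right_diff_distrib mult.assoc Y'_simps)
    \<comment> \<open>The \<open>L^2\<close> products have order at most
      \<open>L * (d + n) = D - 1\<close>, and \<open>L = d + n + 1\<close> gives
      \<open>L^2 = L * (d + n) + L > D\<close>.\<close>
    define L where "L = Suc (nat (d + n))"
    define f where "f = (\<lambda>(i, k). e ^ i * Z ^ k)"
    let ?I = "{..<L} \<times> {..<L}"
    define D where "D = nat (int L * (d + n)) + 1"
    obtain B where B: "finite B" "card B \<le> D"
      "\<And>b. b \<in> R j \<Longrightarrow> ord_le b (int D - 1) \<Longrightarrow> b \<in> PD.span B"
      by (rule centralizer_subspace_dimension[OF z R_subspace R_C R_nonneg, where k = D]) auto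
    have ZR: "Z \<in> R j"
    proof (induction j)
      case 0
      show ?case by (auto intro!: imageI)
    qed (rule R_mono)
    have pow: "b ^ i \<in> R j" if "b \<in> R j" for b i
      by (induction i) (use that one R_mult in auto)
    have sp: "f t \<in> PD.span B" if tI: "t \<in> ?I" for t
    proof -
      obtain i k where t: "t = (i, k)" "i < L" "k < L" using tI by (cases t) auto
      have "f t \<in> R j" by (simp add: f_def t R_mult pow e ZR)
      moreover have "ord_le (f t) (int i * d + int k * n)"
        using has_ord_mult[OF has_ord_power[OF d] has_ord_power[OF z(1)]] by (simp add: f_def t has_ord_def)
      then have "ord_le (f t) (int D - 1)"
      proof (rule ord_le_mono)
        have "int i * d \<le> int L * d" "int k * n \<le> int L * n"
          using t d1 z(2) by (auto intro!: mult_right_mono)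
        then show "int i * d + int k * n \<le> int D - 1" by (simp add: D_def distrib_left)
      qed
      ultimately show ?thesis by (rule B(3))
    qed
    have "D < L * L"
    proof -
      define s where "s = nat (d + n)"
      have s: "int s = d + n" "s \<ge> 2" using d1 z(2) by (auto simp: s_def)
      have "int L * (d + n) = int (L * s)" using s by simp
      then have "D = L * s + 1" unfolding D_def by (simp only: nat_int)
      then show ?thesis using s by (simp add: L_def s_def[symmetric])
    qed
    then have card: "card B < card ?I" using B(2) by (simp add: card_cartesian_product)
    have fin: "finite ?I" by simp
    obtain a where a: "\<exists>t\<in>?I. a t \<noteq> 0" "(\<Sum>t\<in>?I. scaleD (a t) (f t)) = 0"
      using PD.dependent_family[of ?I B f, OF fin B(1) card sp] by blast
    define E where "E k = (\<Sum>i<L. scaleD (a (i, k)) (e ^ i))" for k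
    have YEk: "ad Y (E k) = 0" for k
    proof -
      have "E k \<in> PD.C Y" unfolding E_def
        by (intro PD.subspace_sum PD.C_subspace PD.C_scale PD.C_power) (simp add: PD.C_def YE)
      then show ?thesis by (simp add: PD.C_def)
    qed
    have "(\<Sum>k<L. E k * Z ^ k) = (\<Sum>k<L. \<Sum>i<L. scaleD (a (i, k)) (f (i, k)))"
      by (simp add: E_def f_def sum_distrib_right PD.scale_mult_left)
    also have "\<dots> = (\<Sum>i<L. \<Sum>k<L. scaleD (a (i, k)) (f (i, k)))" by (rule sum.swap)
    also have "\<dots> = (\<Sum>t\<in>?I. scaleD (a t) (f t))"
      by (simp add: sum.cartesian_product case_prod_unfold)
    finally have EZ: "(\<Sum>k<L. E k * Z ^ k) = 0" using a(2) by simp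
    have E0: "E k = 0" if k: "k < L" for k
    proof (rule ccontr)
      assume "E k \<noteq> 0"
      define A where "A = {k. k < L \<and> E k \<noteq> 0}"
      define t where "t = Max A"
      have A: "finite A" "k \<in> A" using k \<open>E k \<noteq> 0\<close> by (auto simp: A_def)
      have t: "t \<in> A" "\<And>i. i \<in> A \<Longrightarrow> i \<le> t"
        using A unfolding t_def by (auto intro: Max_in)
      have iter_sum: "(ad Y ^^ t) (\<Sum>k\<in>J. g k) = (\<Sum>k\<in>J. (ad Y ^^ t) (g k))" for g and J :: "nat set"
        by (induction J rule: infinite_finite_induct) (simp_all add: ad_iter_add)
      have "0 = (ad Y ^^ t) (\<Sum>k<L. E k * Z ^ k)" by (simp add: EZ)
      also have "\<dots> = (\<Sum>k<L. E k * (ad Y ^^ t) (Z ^ k))"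
        by (simp add: iter_sum ad_iter_mult_left[OF YEk])
      also have "\<dots> = (\<Sum>k<L. if k = t then E t * (ad Y ^^ t) (Z ^ t) else 0)"
      proof (rule sum.cong)
        fix i assume "i \<in> {..<L}"
        then consider "i = t" | "E i = 0" | "i < t"
          using t(2)[of i] by (cases "i = t"; cases "i < t") (auto simp: A_def)
        then show "E i * (ad Y ^^ t) (Z ^ i) = (if i = t then E t * (ad Y ^^ t) (Z ^ t) else 0)"
          by cases (auto simp: ad_Y_power(2))
      qed simp
      also have "\<dots> = E t * (of_nat (fact t) * (- scaleD l Y) ^ t)"
        using t(1) by (simp add: A_def ad_Y_power(1))
      finally show False
        using t(1) Y_nonzero y(3) by (simp add: A_def PD.of_nat_conv_scale PD.scale_mult_right)
    qed
    have "a t = 0" if tI: "t \<in> ?I" for t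
    proof -
      obtain i k where t: "t = (i, k)" "i < L" "k < L" using tI by (cases t) auto
      show ?thesis
        using pdo_powers_independent[OF d d1, where a = "\<lambda>i. a (i, k)" and L = L and k = i] E0[of k] t
        by (simp add: E_def)
    qed
    with a(1) show thesis by blast
  qed
qed

text \<open>Finite differences: the last non-zero difference of \<open>c\<close> is an invariant,
  hence a scalar \<open>t\<close>. Since the \<open>j\<close>-th difference of \<open>Z^j\<close> is
  \<open>fact j * l^j\<close>, subtracting a multiple of \<open>z^j\<close> shortens the chain of
  differences.\<close>

lemma C_subset_polynomials: "A1.C z \<subseteq> A1.polynomials_in z"
proof -
  have "c \<in> A1.polynomials_in z" if "c \<in> A1.C z" "(\<delta> ^^ j) (\<psi> c) = 0" for c j
    using that
  proof (induction j arbitrary: c)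
    case 0
    then show ?case by (simp add: inj A1.polynomials_in_def A1.span_zero)
  next
    case (Suc j)
    have "(\<delta> ^^ j) (\<psi> c) \<in> R j" using Suc.prems by (intro \<delta>_iter_R) simp
    moreover have "\<delta> ((\<delta> ^^ j) (\<psi> c)) = 0" using Suc.prems(2) by simp
    ultimately obtain t where t: "(\<delta> ^^ j) (\<psi> c) = scaleD t 1" by (rule \<sigma>_invariant_scalar)
    define s where "s = t / (of_nat (fact j) * l ^ j)"
    have "(\<delta> ^^ j) (\<psi> (c - scale1 s (z ^ j))) = 0"
      using y(3) by (simp add: hom_diff hom hom_power \<delta>_iter_simps t \<delta>_iter_power s_def)
    moreover have "c - scale1 s (z ^ j) \<in> A1.C z"
      using Suc.prems(1) by (intro A1.C_diff A1.C_scale A1.C_power A1.C_self)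
    ultimately have "c - scale1 s (z ^ j) \<in> A1.polynomials_in z" by (rule Suc.IH[rotated])
    moreover have "scale1 s (z ^ j) \<in> A1.polynomials_in z"
      unfolding A1.polynomials_in_def by (intro A1.span_scale A1.span_base) simp
    ultimately have "(c - scale1 s (z ^ j)) + scale1 s (z ^ j) \<in> A1.polynomials_in z"
      unfolding A1.polynomials_in_def by (rule A1.span_add)
    then show ?case by simp
  qed
  then show ?thesis using \<delta>_nilpotent by blast
qed

end

lemma C_eq_polynomials_if_eigenvector:
  fixes z :: "'k::field_char_0 weyl"
  assumes y: "ad z y = scale1 l y" "l \<noteq> 0" "y \<noteq> 0"
  shows "A1.C z = A1.polynomials_in z"
proof
  have "ad z y \<noteq> 0" using y by simp
  then have "z \<notin> A1.scalars" using scalar_ad_zero by blast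
  then obtain u v \<psi> n where \<psi>: "weyl_chart u v \<psi>" "has_ord (\<psi> z) n" "n \<ge> 1"
    by (rule positive_order_chart)
  interpret weyl_chart u v \<psi> by fact
  have "\<psi> y \<noteq> 0" using y by (simp add: inj)
  then obtain m Y' where "has_ord (\<psi> y) m" "\<psi> y * Y' = 1" "Y' * \<psi> y = 1"
    using has_ord_ex pdo_inverse by metis
  then interpret weyl_eigenvector u v \<psi> z y n m l Y'
    using \<psi> y by unfold_locales auto
  show "A1.C z \<subseteq> A1.polynomials_in z" by (rule C_subset_polynomials)
  show "A1.polynomials_in z \<subseteq> A1.C z"
    unfolding A1.polynomials_in_def
    by (intro A1.span_minimal A1.C_subspace) (auto intro: A1.C_power)
qed

lemma weyl_centralizer_commutative:
  fixes z :: "'k::field_char_0 weyl"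
  assumes "z \<notin> A1.scalars" "x \<in> A1.C z" "y \<in> A1.C z"
  shows "x * y = y * x"
proof -
  obtain u v \<psi> n where \<psi>: "weyl_chart u v \<psi>" "has_ord (\<psi> z) n" "n \<ge> 1"
    using assms(1) by (rule positive_order_chart)
  interpret weyl_chart u v \<psi> by fact
  have "\<psi> x \<in> PD.C (\<psi> z)" "\<psi> y \<in> PD.C (\<psi> z)"
    using assms by (simp_all add: A1.C_def PD.C_def flip: hom_ad)
  then have "\<psi> (x * y) = \<psi> (y * x)"
    using centralizer_commutative[OF \<psi>(2,3)] by (simp add: hom)
  then show ?thesis by (simp only: inj_eq)
qed

lemma nonscalar_not_central:
  fixes z :: "'k::field_char_0 weyl"
  assumes "z \<notin> A1.scalars"
  obtains w where "ad z w \<noteq> 0"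
proof -
  obtain u v \<psi> n where \<psi>: "weyl_chart u v \<psi>" "has_ord (\<psi> z) n" "n \<ge> 1"
    using assms(1) by (rule positive_order_chart)
  interpret weyl_chart u v \<psi> by fact
  \<comment> \<open>\<open>v\<close> becomes \<open>x\<close>, of order 0 and derivative 1, so this
    coefficient is \<open>n\<close> times the leading coefficient of \<open>z\<close>.\<close>
  have "cf (\<psi> (ad z v)) (n + 0 - 1) \<noteq> 0"
    using cf_commutator[of "\<psi> z" n p_hat 0] \<psi>(2,3) by (simp add: hom_ad hom has_ord_def ord_le_hat)
  then have "ad z v \<noteq> 0" by auto
  then show thesis by (rule that)
qed

subsection \<open>Tensors\<close>

context k_algebra
begin

definition tensor_lift :: "('k weyl \<Rightarrow> 'k weyl \<Rightarrow> 'a) \<Rightarrow> 'k weyl2 \<Rightarrow> 'a"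
  where "tensor_lift B x = lin_ext scale (case_formal_tensor B) (rep_weyl2 x)"

context
  fixes B :: "'k weyl \<Rightarrow> 'k weyl \<Rightarrow> 'a"
  assumes bilinear: "\<And>a a' b. B (a + a') b = B a b + B a' b" "\<And>a b b'. B a (b + b') = B a b + B a b'"
    "\<And>c a b. B (scale1 c a) b = scale c (B a b)" "\<And>c a b. B a (scale1 c b) = scale c (B a b)"
begin

lemma lin_ext_tensor_null: "x \<in> tensor_null \<Longrightarrow> lin_ext scale (case_formal_tensor B) x = 0"
  by (induction x rule: tensor_null.induct)
    (simp_all add: lin_ext_add lin_ext_diff lin_ext_scale bilinear)

lemma tensor_lift_abs: "tensor_lift B (abs_weyl2 x) = lin_ext scale (case_formal_tensor B) x"
proof -
  have "tensor_rel (rep_weyl2 (abs_weyl2 x)) x"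
    using Quotient_rep_abs[OF Quotient_weyl2] by (simp add: equivp_reflp[OF tensor_rel_equivp])
  then have "lin_ext scale (case_formal_tensor B) (rep_weyl2 (abs_weyl2 x) - x) = 0"
    unfolding tensor_rel_def by (rule lin_ext_tensor_null)
  then show ?thesis by (simp add: tensor_lift_def lin_ext_diff)
qed

lemma tensor_lift_simps:
  "tensor_lift B (x + y) = tensor_lift B x + tensor_lift B y"
  "tensor_lift B (scale2 c x) = scale c (tensor_lift B x)"
  "tensor_lift B (a \<otimes>\<^sub>K b) = B a b"
proof -
  obtain X Y where xy: "x = abs_weyl2 X" "y = abs_weyl2 Y"
    by (metis Quotient_abs_rep[OF Quotient_weyl2])
  show "tensor_lift B (x + y) = tensor_lift B x + tensor_lift B y"
    by (simp add: xy plus_weyl2.abs_eq tensor_lift_abs lin_ext_add)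
  show "tensor_lift B (scale2 c x) = scale c (tensor_lift B x)"
    by (simp add: xy scale2.abs_eq tensor_lift_abs lin_ext_scale)
  show "tensor_lift B (a \<otimes>\<^sub>K b) = B a b"
    by (simp add: tensor.abs_eq tensor_lift_abs)
qed

end

end

lemma weyl2_subspace_eq_UNIV:
  fixes S :: "'k::field weyl2 set"
  assumes S: "A2.subspace S" "\<And>a b. a \<otimes>\<^sub>K b \<in> S"
  shows "S = UNIV"
proof -
  have "abs_weyl2 x \<in> S" for x
  proof (induction x rule: poly_mapping_single_induct)
    case zero
    then show ?case using A2.subspace_0[OF S(1)] by (simp add: zero_weyl2.abs_eq)
  next
    case (single t c)
    obtain a b where "t = Formal a b" by (cases t)
    then have "abs_weyl2 (Poly_Mapping.single t c) = scale2 c (a \<otimes>\<^sub>K b)"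
      by (simp add: scale2.abs_eq tensor.abs_eq mult_single)
    then show ?case using S by (simp add: A2.subspace_scale)
  next
    case (add x y)
    then show ?case using A2.subspace_add[OF S(1)] by (simp flip: plus_weyl2.abs_eq)
  qed
  then show ?thesis by (metis UNIV_eq_I Quotient_abs_rep[OF Quotient_weyl2])
qed

lemma tensor_zero [simp]: "0 \<otimes>\<^sub>K b = 0" "a \<otimes>\<^sub>K 0 = 0"
  using tensor_bilinear(1)[of 0 0 b] tensor_bilinear(2)[of a 0 0] by simp_all

lemma tensor_diff: "(a - a') \<otimes>\<^sub>K b = a \<otimes>\<^sub>K b - a' \<otimes>\<^sub>K b" "a \<otimes>\<^sub>K (b - b') = a \<otimes>\<^sub>K b - a \<otimes>\<^sub>K b'"
  by (simp_all add: eq_diff_eq flip: tensor_bilinear(1,2))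

lemma tensor_sum_left: "(\<Sum>i\<in>I. f i) \<otimes>\<^sub>K b = (\<Sum>i\<in>I. f i \<otimes>\<^sub>K b)"
  by (induction I rule: infinite_finite_induct) (simp_all add: tensor_bilinear)

lemma ad_tensor: "ad (a \<otimes>\<^sub>K b) (c \<otimes>\<^sub>K d) = ad a c \<otimes>\<^sub>K (b * d) + (c * a) \<otimes>\<^sub>K ad b d"
  by (simp add: ad_def tensor_mult tensor_diff)

lemma linear_ad: "A2.subspace S \<Longrightarrow> A2.subspace {x. ad z x \<in> S}"
  by (auto simp: A2.subspace_def ad_add A2.ad_scale)

section \<open>Exchange of the factors, contractions, and linear independence of tensors\<close>

definition swap :: "'k::field weyl2 \<Rightarrow> 'k weyl2"
  where "swap = A2.tensor_lift (\<lambda>a b. b \<otimes>\<^sub>K a)"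

lemma swap_simps [simp]:
  "swap (x + y) = swap x + swap y" "swap (scale2 c x) = scale2 c (swap x)" "swap (a \<otimes>\<^sub>K b) = b \<otimes>\<^sub>K a"
  unfolding swap_def by (rule A2.tensor_lift_simps; simp add: tensor_bilinear)+

lemma swap_zero [simp]: "swap 0 = 0"
  using swap_simps(1)[of 0 0] by simp

lemma swap_diff: "swap (x - y) = swap x - swap y"
  using swap_simps(1)[of "x - y" y] by simp

lemma swap_swap [simp]: "swap (swap x) = x"
proof -
  have "{x. swap (swap x) = x} = UNIV"
    by (rule weyl2_subspace_eq_UNIV) (auto simp: A2.subspace_def)
  then show ?thesis by blast
qed

lemma swap_mult: "swap (x * y) = swap x * swap y"
proof -
  have "{y. swap ((a \<otimes>\<^sub>K b) * y) = (b \<otimes>\<^sub>K a) * swap y} = UNIV" for a b :: "'a weyl"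
    by (rule weyl2_subspace_eq_UNIV)
      (auto simp: A2.subspace_def distrib_left A2.scale_mult_right tensor_mult)
  then have "swap ((a \<otimes>\<^sub>K b) * y) = swap (a \<otimes>\<^sub>K b) * swap y" for a b by auto
  moreover have "A2.subspace {x. swap (x * y) = swap x * swap y}"
    by (auto simp: A2.subspace_def distrib_right A2.scale_mult_left)
  ultimately have "{x. swap (x * y) = swap x * swap y} = UNIV"
    by (intro weyl2_subspace_eq_UNIV) auto
  then show ?thesis by blast
qed

lemma swap_ad: "swap (ad x y) = ad (swap x) (swap y)"
  by (simp add: ad_def swap_mult swap_diff)

lemma swap_ad_iter: "swap ((ad x ^^ m) y) = (ad (swap x) ^^ m) (swap y)"
  by (induction m) (simp_all add: swap_ad)

lemma swap_eq_0_iff [simp]: "swap x = 0 \<longleftrightarrow> x = 0"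
  by (metis swap_swap swap_zero)

lemma swap_N: "swap x \<in> A2.N (swap z) \<longleftrightarrow> x \<in> A2.N z"
  by (simp add: A2.N_def flip: swap_ad_iter)

lemma swap_C: "swap x \<in> A2.C (swap z) \<longleftrightarrow> x \<in> A2.C z"
  by (simp add: A2.C_def flip: swap_ad)

lemma tensor_subspace_subspace: "A2.subspace (tensor_subspace U V)"
  by (simp add: tensor_subspace_def)

lemma tensor_subspace_base: "u \<in> U \<Longrightarrow> v \<in> V \<Longrightarrow> u \<otimes>\<^sub>K v \<in> tensor_subspace U V"
  unfolding tensor_subspace_def by (rule A2.span_base) blast

lemma tensor_subspace_induct:
  assumes "x \<in> tensor_subspace U V" "A2.subspace S" "\<And>u v. u \<in> U \<Longrightarrow> v \<in> V \<Longrightarrow> u \<otimes>\<^sub>K v \<in> S"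
  shows "x \<in> S"
  using assms(1) unfolding tensor_subspace_def
  by (rule A2.span_in_subspace[OF _ assms(2)]) (use assms(3) in auto)

lemma tensor_subspace_UNIV: "tensor_subspace UNIV UNIV = UNIV"
  by (intro weyl2_subspace_eq_UNIV tensor_subspace_subspace tensor_subspace_base) auto

lemma swap_tensor_subspace: "swap x \<in> tensor_subspace V U \<longleftrightarrow> x \<in> tensor_subspace U V"
proof -
  have *: "swap x \<in> tensor_subspace V U" if "x \<in> tensor_subspace U V" for x :: "'a weyl2" and U V
  proof -
    have "A2.subspace {x. swap x \<in> tensor_subspace V U}"
      using tensor_subspace_subspace[of V U] by (auto simp: A2.subspace_def)
    then have "x \<in> {x. swap x \<in> tensor_subspace V U}"
      by (rule tensor_subspace_induct[OF that]) (simp add: tensor_subspace_base)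
    then show ?thesis by simp
  qed
  from *[of x U V] *[of "swap x" V U] show ?thesis by auto
qed

text \<open>Contraction of the second factor with the functional \<open>\<phi>\<close>.\<close>

definition slice :: "('k::field weyl \<Rightarrow> 'k) \<Rightarrow> 'k weyl2 \<Rightarrow> 'k weyl"
  where "slice \<phi> = A1.tensor_lift (\<lambda>a b. scale1 (\<phi> b) a)"

lemma slice_simps:
  assumes "\<And>a b. \<phi> (a + b) = \<phi> a + \<phi> b" "\<And>c a. \<phi> (scale1 c a) = c * \<phi> a"
  shows "slice \<phi> (x + y) = slice \<phi> x + slice \<phi> y" "slice \<phi> (scale2 c x) = scale1 c (slice \<phi> x)"
    "slice \<phi> (a \<otimes>\<^sub>K b) = scale1 (\<phi> b) a"
  unfolding slice_def
  by (rule A1.tensor_lift_simps;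
      simp add: assms A1.scale_left_distrib A1.scale_right_distrib mult.commute)+

lemma slice_in_subspace:
  assumes \<phi>: "\<And>a b. \<phi> (a + b) = \<phi> a + \<phi> b" "\<And>c a. \<phi> (scale1 c a) = c * \<phi> a"
    and U: "A1.subspace U" and x: "x \<in> tensor_subspace U V"
  shows "slice \<phi> x \<in> U"
proof -
  note s = slice_simps[of \<phi>, OF \<phi>]
  have "slice \<phi> 0 = 0" using s(1)[of 0 0] by simp
  then have "A2.subspace {x. slice \<phi> x \<in> U}" using U by (auto simp: A2.subspace_def A1.subspace_def s)
  then have "x \<in> {x. slice \<phi> x \<in> U}"
    by (rule tensor_subspace_induct[OF x]) (simp add: s A1.subspace_scale[OF U])
  then show ?thesis by simp
qed

text \<open>The number of terms is chosen least possible modulo \<open>U \<otimes> A\<^sub>1\<close>.\<close>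

lemma minimal_representation:
  fixes x :: "'k::field weyl2"
  assumes W: "A1.subspace W" and x: "x \<in> tensor_subspace W UNIV" and U: "A1.subspace U"
  obtains I :: "nat set" and a b where "finite I" "\<And>i. i \<in> I \<Longrightarrow> a i \<in> W" "\<And>i. i \<in> I \<Longrightarrow> b i \<noteq> 0"
    "x - (\<Sum>i\<in>I. a i \<otimes>\<^sub>K b i) \<in> tensor_subspace U UNIV"
    "\<And>k i. (\<Sum>i\<in>I. scale1 (k i) (a i)) \<in> U \<Longrightarrow> i \<in> I \<Longrightarrow> k i = 0"
proof -
  define T where "T = tensor_subspace U (UNIV :: 'k weyl set)"
  note T = tensor_subspace_subspace[of U UNIV, folded T_def]
  define Q where "Q n \<longleftrightarrow> (\<exists>(I::nat set) a b. finite I \<and> card I = n \<and> (\<forall>i\<in>I. a i \<in> W) \<and>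
    x - (\<Sum>i\<in>I. a i \<otimes>\<^sub>K b i) \<in> T)" for n
  define S where "S = {\<Sum>(a, b)\<leftarrow>xs. a \<otimes>\<^sub>K b | xs. fst ` set xs \<subseteq> W}"
  have "A2.subspace S"
  proof (rule A2.subspaceI)
    show "0 \<in> S" unfolding S_def mem_Collect_eq by (rule exI[of _ "[]"]) simp
    fix x y assume "x \<in> S" "y \<in> S"
    then obtain xs ys where xs: "x = (\<Sum>(a, b)\<leftarrow>xs. a \<otimes>\<^sub>K b)" "fst ` set xs \<subseteq> W"
      "y = (\<Sum>(a, b)\<leftarrow>ys. a \<otimes>\<^sub>K b)" "fst ` set ys \<subseteq> W"
      unfolding S_def by blast
    then show "x + y \<in> S" unfolding S_def mem_Collect_eq by (intro exI[of _ "xs @ ys"]) auto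
  next
    fix x c assume "x \<in> S"
    then obtain xs where xs: "x = (\<Sum>(a, b)\<leftarrow>xs. a \<otimes>\<^sub>K b)" "fst ` set xs \<subseteq> W"
      unfolding S_def by blast
    have "scale2 c (\<Sum>(a, b)\<leftarrow>xs. a \<otimes>\<^sub>K b) = (\<Sum>(a, b)\<leftarrow>map (\<lambda>(a, b). (scale1 c a, b)) xs. a \<otimes>\<^sub>K b)"
      by (induction xs) (auto simp: A2.scale_right_distrib tensor_bilinear)
    moreover have "fst ` set (map (\<lambda>(a, b). (scale1 c a, b)) xs) \<subseteq> W"
      using xs(2) A1.subspace_scale[OF W] by force
    ultimately show "scale2 c x \<in> S" unfolding S_def xs(1) by blast
  qed
  moreover have "a \<otimes>\<^sub>K b \<in> S" if "a \<in> W" for a b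
    unfolding S_def mem_Collect_eq using that by (intro exI[of _ "[(a, b)]"]) simp
  ultimately have "x \<in> S" using tensor_subspace_induct[OF x] by blast
  then obtain xs where xs: "x = (\<Sum>(a, b)\<leftarrow>xs. a \<otimes>\<^sub>K b)" "fst ` set xs \<subseteq> W" unfolding S_def by blast
  have "x = (\<Sum>i\<in>{0..<length xs}. fst (xs ! i) \<otimes>\<^sub>K snd (xs ! i))"
    unfolding xs(1) by (simp add: sum_list_sum_nth case_prod_unfold)
  then have "Q (length xs)"
    unfolding Q_def using xs(2) A2.subspace_0[OF T]
    by (intro exI[of _ "{0..<length xs}"] exI[of _ "\<lambda>i. fst (xs ! i)"] exI[of _ "\<lambda>i. snd (xs ! i)"]) auto
  then have "Q (LEAST n. Q n)" by (rule LeastI)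
  then obtain I :: "nat set" and a b where I: "finite I" "card I = (LEAST n. Q n)" "\<forall>i\<in>I. a i \<in> W"
    "x - (\<Sum>i\<in>I. a i \<otimes>\<^sub>K b i) \<in> T"
    unfolding Q_def by blast
  have min: False if i: "i \<in> I" and b': "x - (\<Sum>j\<in>I - {i}. a j \<otimes>\<^sub>K b' j) \<in> T" for i b'
  proof -
    have "Q (card (I - {i}))" unfolding Q_def using I b' by blast
    then have "card I \<le> card (I - {i})" unfolding I(2) by (rule Least_le)
    then show False using card_Diff1_less[OF I(1) i] by linarith
  qed
  show thesis
  proof (rule that[of I a b])
    show "b i \<noteq> 0" if i: "i \<in> I" for i
    proof
      assume "b i = 0"
      then have eq: "(\<Sum>j\<in>I. a j \<otimes>\<^sub>K b j) = (\<Sum>j\<in>I - {i}. a j \<otimes>\<^sub>K b j)"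
        using sum.remove[OF I(1) i, of "\<lambda>j. a j \<otimes>\<^sub>K b j"] by simp
      show False by (rule min[OF i, of b]) (use I(4) in \<open>simp only: eq\<close>)
    qed
    show "k i = 0" if k: "(\<Sum>i\<in>I. scale1 (k i) (a i)) \<in> U" and i: "i \<in> I" for k i
    proof (rule ccontr)
      assume ki: "k i \<noteq> 0"
      define \<nu> where "\<nu> = scale1 (1 / k i) (\<Sum>i\<in>I. scale1 (k i) (a i))"
      have \<nu>: "\<nu> \<in> U" unfolding \<nu>_def using k by (rule A1.subspace_scale[OF U])
      have "\<nu> = a i + (\<Sum>j\<in>I - {i}. scale1 (k j / k i) (a j))"
        unfolding \<nu>_def sum.remove[OF I(1) i] using ki
        by (simp add: A1.scale_right_distrib A1.scale_sum_right)
      then have ai: "a i = \<nu> - (\<Sum>j\<in>I - {i}. scale1 (k j / k i) (a j))" by simp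
      \<comment> \<open>A relation modulo \<open>U\<close> expresses \<open>a i\<close> by the other
        \<open>a j\<close>; distributing \<open>b i\<close> over their partners saves one term
        modulo \<open>U\<close> tensor \<open>A_1\<close>, contrary to minimality.\<close>
      define b' where "b' j = b j - scale1 (k j / k i) (b i)" for j
      have "(\<Sum>j\<in>I. a j \<otimes>\<^sub>K b j) = \<nu> \<otimes>\<^sub>K b i + (\<Sum>j\<in>I - {i}. a j \<otimes>\<^sub>K b' j)"
        unfolding sum.remove[OF I(1) i]
        by (subst ai) (simp add: tensor_diff tensor_sum_left tensor_bilinear b'_def sum_subtractf)
      then have "x - (\<Sum>j\<in>I - {i}. a j \<otimes>\<^sub>K b' j) = (x - (\<Sum>j\<in>I. a j \<otimes>\<^sub>K b j)) + \<nu> \<otimes>\<^sub>K b i"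
        by simp
      also have "\<dots> \<in> T"
        using I(4) tensor_subspace_base[OF \<nu>, of "b i" UNIV] by (intro A2.subspace_add[OF T]) (auto simp: T_def)
      finally show False by (rule min[OF i])
    qed
  qed (use I in \<open>auto simp: T_def\<close>)
qed

interpretation A1_field: vector_space_pair "scale1 :: 'k::field \<Rightarrow> 'k weyl \<Rightarrow> 'k weyl" "(*) :: 'k \<Rightarrow> 'k \<Rightarrow> 'k"
  by (simp add: vector_space_pair_def A1.vector_space_axioms vector_space_field)

text \<open>Contract with a functional that is 1 at \<open>a i\<close> and 0 at the other
  \<open>a j\<close>. As \<open>slice\<close> acts on the second factor, the tensors are exchanged
  first.\<close>

lemma tensor_independent:
  fixes a b :: "nat \<Rightarrow> 'k::field weyl"
  assumes fin: "finite I" and indep: "\<And>k i. (\<Sum>i\<in>I. scale1 (k i) (a i)) = 0 \<Longrightarrow> i \<in> I \<Longrightarrow> k i = 0"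
    and sum: "(\<Sum>i\<in>I. a i \<otimes>\<^sub>K b i) \<in> tensor_subspace UNIV V" and V: "A1.subspace V" and i: "i \<in> I"
  shows "b i \<in> V"
proof -
  have inj: "inj_on a I"
  proof (rule inj_onI, rule ccontr)
    fix i j assume ij: "i \<in> I" "j \<in> I" "a i = a j" "i \<noteq> j"
    let ?k = "\<lambda>t. if t = i then 1 else if t = j then - 1 else 0 :: 'k"
    have "(\<Sum>t\<in>I. scale1 (?k t) (a t)) = (\<Sum>t\<in>{i, j}. scale1 (?k t) (a t))"
      using ij fin by (intro sum.mono_neutral_right) auto
    also have "\<dots> = 0" using ij by simp
    finally have "?k i = 0" using indep[of ?k i] ij by blast
    then show False by simp
  qed
  have "A1.independent (a ` I)"
  proof (rule A1.independent_if_scalars_zero)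
    fix f x assume f: "(\<Sum>x\<in>a ` I. scale1 (f x) x) = 0" and x: "x \<in> a ` I"
    then have "(\<Sum>i\<in>I. scale1 (f (a i)) (a i)) = 0" using inj by (simp add: sum.reindex)
    then show "f x = 0" using x indep[of "f \<circ> a"] by auto
  qed (use fin in simp)
  then obtain \<phi> where \<phi>: "Vector_Spaces.linear scale1 (*) \<phi>" "\<And>x. x \<in> a ` I \<Longrightarrow> \<phi> x = (if x = a i then 1 else 0)"
    using A1_field.linear_independent_extend[of "a ` I" "\<lambda>x. if x = a i then 1 else 0"] by blast
  have lin: "\<phi> (c + d) = \<phi> c + \<phi> d" "\<phi> (scale1 t c) = t * \<phi> c" for c d t
    using \<phi>(1) by (simp_all add: A1_field.linear_add A1_field.linear_scale)
  note s = slice_simps[of \<phi>, OF lin]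
  have "slice \<phi> (\<Sum>i\<in>I. b i \<otimes>\<^sub>K a i) = (\<Sum>i\<in>I. scale1 (\<phi> (a i)) (b i))"
  proof (induction I rule: infinite_finite_induct)
    case empty
    show ?case using s(1)[of 0 0] by simp
  next
    case (infinite A)
    then show ?case using s(1)[of 0 0] by simp
  qed (simp add: s)
  also have "\<dots> = (\<Sum>j\<in>I. if j = i then b i else 0)"
  proof (rule sum.cong)
    fix j assume "j \<in> I"
    then show "scale1 (\<phi> (a j)) (b j) = (if j = i then b i else 0)"
      using \<phi>(2)[of "a j"] inj i by (auto dest: inj_onD)
  qed simp
  also have "\<dots> = b i" using i fin by simp
  finally have "slice \<phi> (\<Sum>i\<in>I. b i \<otimes>\<^sub>K a i) = b i" .
  moreover have "(\<Sum>i\<in>I. b i \<otimes>\<^sub>K a i) = swap (\<Sum>i\<in>I. a i \<otimes>\<^sub>K b i)"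
    by (induction I rule: infinite_finite_induct) simp_all
  then have "(\<Sum>i\<in>I. b i \<otimes>\<^sub>K a i) \<in> tensor_subspace V UNIV"
    using sum by (simp add: swap_tensor_subspace)
  then have "slice \<phi> (\<Sum>i\<in>I. b i \<otimes>\<^sub>K a i) \<in> V" by (rule slice_in_subspace[OF lin V])
  ultimately show ?thesis by simp
qed

lemma tensor_subspace_0: "tensor_subspace {0} V = {0}"
proof -
  have "x \<in> {0}" if "x \<in> tensor_subspace {0} V" for x
    by (rule tensor_subspace_induct[OF that]) auto
  then show ?thesis using A2.subspace_0[OF tensor_subspace_subspace] by blast
qed

lemma independent_representation:
  fixes x :: "'k::field weyl2"
  assumes "A1.subspace W" "x \<in> tensor_subspace W UNIV"
  obtains I :: "nat set" and a b where "finite I" "\<And>i. i \<in> I \<Longrightarrow> a i \<in> W"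
    "x = (\<Sum>i\<in>I. a i \<otimes>\<^sub>K b i)" "\<And>k i. (\<Sum>i\<in>I. scale1 (k i) (a i)) = 0 \<Longrightarrow> i \<in> I \<Longrightarrow> k i = 0"
proof (rule minimal_representation[OF assms A1.subspace_single_0])
  fix I :: "nat set" and a b
  assume "finite I" "\<And>i. i \<in> I \<Longrightarrow> a i \<in> W" "x - (\<Sum>i\<in>I. a i \<otimes>\<^sub>K b i) \<in> tensor_subspace {0} UNIV"
    "\<And>k i. (\<Sum>i\<in>I. scale1 (k i) (a i)) \<in> {0} \<Longrightarrow> i \<in> I \<Longrightarrow> k i = 0"
  then show thesis using that[of I a b] by (simp add: tensor_subspace_0)
qed

text \<open>With independent \<open>a i\<close> in \<open>U\<close>, membership in the other tensor
  subspace puts every partner \<open>b i\<close> into \<open>V\<close>.\<close>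

lemma tensor_subspace_Int:
  assumes "A1.subspace U" "A1.subspace V" "x \<in> tensor_subspace U UNIV" "x \<in> tensor_subspace UNIV V"
  shows "x \<in> tensor_subspace U V"
proof -
  obtain I :: "nat set" and a b where I: "finite I" "\<And>i. i \<in> I \<Longrightarrow> a i \<in> U" "x = (\<Sum>i\<in>I. a i \<otimes>\<^sub>K b i)"
    "\<And>k i. (\<Sum>i\<in>I. scale1 (k i) (a i)) = 0 \<Longrightarrow> i \<in> I \<Longrightarrow> k i = 0"
    using independent_representation[OF assms(1,3)] by blast
  have "b i \<in> V" if "i \<in> I" for i
  proof (rule tensor_independent[of I a b V i])
    show "k i = 0" if "(\<Sum>i\<in>I. scale1 (k i) (a i)) = 0" "i \<in> I" for k i using that by (rule I(4))
    show "(\<Sum>i\<in>I. a i \<otimes>\<^sub>K b i) \<in> tensor_subspace UNIV V" using I(3) assms(4) by simp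
  qed (use I(1) assms(2) that in auto)
  then show ?thesis
    unfolding I(3) using I(2) by (intro A2.subspace_sum tensor_subspace_subspace tensor_subspace_base)
qed

lemma tensor_eq_0_iff: "a \<otimes>\<^sub>K b = 0 \<longleftrightarrow> a = 0 \<or> b = 0"
proof -
  have "0 \<in> tensor_subspace UNIV {0 :: 'a weyl}" by (rule A2.subspace_0[OF tensor_subspace_subspace])
  then have "b = 0" if "a \<otimes>\<^sub>K b = 0" "a \<noteq> 0"
    using tensor_independent[of "{0}" "\<lambda>_. a" "\<lambda>_. b" "{0}" 0] that
    by (simp add: A1.subspace_single_0)
  then show ?thesis by auto
qed

subsection \<open>Tensor products of elements\<close>

context k_algebra
begin

definition ad_poly :: "'a \<Rightarrow> 'k poly \<Rightarrow> 'a \<Rightarrow> 'a"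
  where "ad_poly z p x = (\<Sum>i\<le>degree p. scale (coeff p i) ((ad z ^^ i) x))"

lemma ad_poly_upto:
  assumes "degree p \<le> n"
  shows "ad_poly z p x = (\<Sum>i\<le>n. scale (coeff p i) ((ad z ^^ i) x))"
  unfolding ad_poly_def using assms by (intro sum.mono_neutral_left) (auto simp: coeff_eq_0)

lemma ad_poly_linear_factor:
  "ad_poly z ([:- r, 1:] * q) x = ad_poly z q (ad z x) - scale r (ad_poly z q x)"
proof -
  define n where "n = degree q"
  have deg: "degree ([:- r, 1:] * q) \<le> Suc n"
    using degree_mult_le[of "[:- r, 1:]" q] by (simp add: n_def)
  have "ad_poly z ([:- r, 1:] * q) x =
      (\<Sum>i\<le>Suc n. scale (coeff (pCons 0 q) i) ((ad z ^^ i) x)) - (\<Sum>i\<le>Suc n. scale (r * coeff q i) ((ad z ^^ i) x))"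
    unfolding ad_poly_upto[OF deg] by (simp add: scale_left_diff_distrib sum_subtractf del: sum.atMost_Suc)
  also have "(\<Sum>i\<le>Suc n. scale (coeff (pCons 0 q) i) ((ad z ^^ i) x)) = ad_poly z q (ad z x)"
    unfolding sum.atMost_Suc_shift by (simp add: ad_poly_def n_def funpow_swap1)
  also have "(\<Sum>i\<le>Suc n. scale (r * coeff q i) ((ad z ^^ i) x)) = scale r (ad_poly z q x)"
    using ad_poly_upto[of q "Suc n" z x] by (simp add: n_def scale_sum_right del: sum.atMost_Suc)
  finally show ?thesis .
qed

lemma ad_ad_poly: "ad z (ad_poly z q x) = ad_poly z q (ad z x)"
  by (simp add: ad_poly_def ad_sum ad_scale funpow_swap1)

end

text \<open>A finite-dimensional orbit yields a polynomial in \<open>ad z\<close> that annihilates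
  \<open>x\<close>. Over an algebraically closed field its linear factors can be removed one at a
  time, by induction on the degree.\<close>

lemma F_eq_N_if_Ev_trivial:
  fixes z :: "'k::alg_closed_field weyl2"
  assumes Ev: "A2.Ev z = {0}"
  shows "A2.F z = A2.N z"
proof
  show "A2.N z \<subseteq> A2.F z"
  proof
    fix x assume "x \<in> A2.N z"
    then obtain m where m: "(ad z ^^ m) x = 0" by (auto simp: A2.N_def)
    let ?B = "(\<lambda>i. (ad z ^^ i) x) ` {..<m}"
    have "(ad z ^^ i) x \<in> A2.span ?B" for i
      using ad_iter_eq_0_mono[OF m, of i] by (cases "i < m") (auto intro: A2.span_base A2.span_zero)
    then have "A2.span (range (\<lambda>i. (ad z ^^ i) x)) \<subseteq> A2.span ?B"
      by (intro A2.span_minimal) auto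
    moreover have "A2.span ?B \<subseteq> A2.span (range (\<lambda>i. (ad z ^^ i) x))"
      by (rule A2.span_mono) auto
    ultimately have "A2.span (range (\<lambda>i. (ad z ^^ i) x)) = A2.span ?B" by blast
    then show "x \<in> A2.F z" unfolding A2.F_def by (intro CollectI exI[of _ ?B]) simp
  qed
  show "A2.F z \<subseteq> A2.N z"
  proof
    fix x assume "x \<in> A2.F z"
    then obtain B where B: "finite B" "A2.span (range (\<lambda>m. (ad z ^^ m) x)) = A2.span B"
      by (auto simp: A2.F_def)
    let ?I = "{..card B}"
    have sp: "(ad z ^^ i) x \<in> A2.span B" for i
      unfolding B(2)[symmetric] by (rule A2.span_base) simp
    obtain a where a: "\<exists>i\<in>?I. a i \<noteq> 0" "(\<Sum>i\<in>?I. scale2 (a i) ((ad z ^^ i) x)) = 0"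
      by (rule A2.dependent_family[of ?I B "\<lambda>i. (ad z ^^ i) x"]) (use B(1) sp in auto)
    define p where "p = (\<Sum>i\<le>card B. monom (a i) i)"
    have coeff: "coeff p i = (if i \<le> card B then a i else 0)" for i
    proof -
      have "coeff p i = (\<Sum>j\<le>card B. if j = i then a i else 0)"
        unfolding p_def coeff_sum by (rule sum.cong) auto
      then show ?thesis by simp
    qed
    have "p \<noteq> 0"
    proof
      assume "p = 0"
      then have "a i = 0" if "i \<le> card B" for i using coeff[of i] that by simp
      with a(1) show False by auto
    qed
    have "degree p \<le> card B" by (rule degree_le) (simp add: coeff)
    then have "A2.ad_poly z p x = 0" using a(2) by (simp add: A2.ad_poly_upto coeff)
    moreover have "x \<in> A2.N z" if "p \<noteq> 0" "A2.ad_poly z p x = 0" for p x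
      using that
    proof (induction "degree p" arbitrary: p x)
      case 0
      then have "coeff p 0 \<noteq> 0" by (metis leading_coeff_neq_0)
      with 0 have "x = 0" by (simp add: A2.ad_poly_def)
      then show ?case by (simp add: A2.subspace_0[OF A2.N_subspace])
    next
      case (Suc d)
      then obtain r where "poly p r = 0" using alg_closed_imp_poly_has_root[of p] by auto
      then obtain q where q: "p = [:- r, 1:] * q" by (metis poly_eq_0_iff_dvd dvdE)
      have "q \<noteq> 0" using Suc.prems(1) q by auto
      then have deg: "d = degree q" using Suc.hyps(2) unfolding q by (subst (asm) degree_mult_eq) auto
      have eq: "A2.ad_poly z q (ad z x) = scale2 r (A2.ad_poly z q x)"
        using Suc.prems(2) unfolding q A2.ad_poly_linear_factor by simp
      \<comment> \<open>For the root 0, \<open>q\<close> annihilates \<open>ad z x\<close>, and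
        \<open>N z\<close> contains preimages under \<open>ad z\<close>. For another root
        \<open>r\<close>, the value of \<open>q\<close> at \<open>x\<close> would be an eigenvector,
        so it vanishes.\<close>
      show ?case
      proof (cases "r = 0")
        case True
        then have "ad z x \<in> A2.N z" using Suc.hyps(1)[OF deg \<open>q \<noteq> 0\<close>] eq by simp
        then show ?thesis by (simp add: A2.ad_in_N_iff)
      next
        case False
        then have "A2.ad_poly z q x = 0"
          using Ev eq unfolding A2.ad_ad_poly[symmetric] A2.Ev_def by blast
        then show ?thesis by (rule Suc.hyps(1)[OF deg \<open>q \<noteq> 0\<close>])
      qed
    qed
    ultimately show "x \<in> A2.N z" using \<open>p \<noteq> 0\<close> by blast
  qed
qed

text \<open>In the second factor, left and right multiplication by \<open>z2\<close> have the same effect on leading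
  coefficients. So the leading coefficients of \<open>x\<close> with respect to the second factor are mapped by
  \<open>ad z1\<close> into \<open>N(z1)\<close>, and hence belong to \<open>N(z1)\<close>.\<close>

lemma tensor_eigen_left:
  fixes z1 z2 :: "'k::field_char_0 weyl"
  assumes z2: "z2 \<notin> A1.scalars"
    and x: "ad (z1 \<otimes>\<^sub>K z2) x - scale2 l x \<in> tensor_subspace (A1.N z1) UNIV"
  shows "x \<in> tensor_subspace (A1.N z1) UNIV"
proof -
  define T where "T = tensor_subspace (A1.N z1) (UNIV :: 'k weyl set)"
  note T = tensor_subspace_subspace[of "A1.N z1" UNIV, folded T_def]
  define \<Theta> where "\<Theta> x = ad (z1 \<otimes>\<^sub>K z2) x - scale2 l x" for x
  have \<Theta>_add: "\<Theta> (x + y) = \<Theta> x + \<Theta> y" for x y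
    by (simp add: \<Theta>_def ad_add A2.scale_right_distrib)
  have \<Theta>_diff: "\<Theta> (x - y) = \<Theta> x - \<Theta> y" for x y
    by (simp add: \<Theta>_def ad_diff A2.scale_right_diff_distrib)
  \<comment> \<open>This allows \<open>x\<close> to be replaced by a short representative modulo
    \<open>T\<close>.\<close>
  have \<Theta>_T: "\<Theta> x \<in> T" if "x \<in> T" for x
  proof -
    have "x \<in> {x. ad (z1 \<otimes>\<^sub>K z2) x \<in> T}"
      using that unfolding T_def
    proof (rule tensor_subspace_induct)
      show "A2.subspace {x. ad (z1 \<otimes>\<^sub>K z2) x \<in> tensor_subspace (A1.N z1) UNIV}"
        by (intro linear_ad tensor_subspace_subspace)
      fix a b :: "'k weyl" assume "a \<in> A1.N z1"
      then show "a \<otimes>\<^sub>K b \<in> {x. ad (z1 \<otimes>\<^sub>K z2) x \<in> tensor_subspace (A1.N z1) UNIV}"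
        by (simp add: ad_tensor A2.subspace_add[OF tensor_subspace_subspace] tensor_subspace_base
            A1.ad_in_N_iff A1.N_mult_C)
    qed
    then show ?thesis using that A2.subspace_diff[OF T] A2.subspace_scale[OF T] by (simp add: \<Theta>_def)
  qed
  have "x \<in> tensor_subspace UNIV UNIV" by (simp add: tensor_subspace_UNIV)
  then obtain I :: "nat set" and a b where I: "finite I" "\<And>i. i \<in> I \<Longrightarrow> b i \<noteq> 0"
    "x - (\<Sum>i\<in>I. a i \<otimes>\<^sub>K b i) \<in> T"
    and indep: "\<And>k i. (\<Sum>i\<in>I. scale1 (k i) (a i)) \<in> A1.N z1 \<Longrightarrow> i \<in> I \<Longrightarrow> k i = 0"
    unfolding T_def
    by (rule minimal_representation[OF A1.subspace_UNIV _ A1.N_subspace]) auto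
  define x' where "x' = (\<Sum>i\<in>I. a i \<otimes>\<^sub>K b i)"
  have "I = {}"
  proof (rule ccontr)
    assume "I \<noteq> {}"
    obtain u v \<psi> n where \<psi>: "weyl_chart u v \<psi>" "has_ord (\<psi> z2) n" "n \<ge> 1"
      using z2 by (rule positive_order_chart)
    interpret weyl_chart u v \<psi> by fact
    have "\<exists>m. has_ord (\<psi> (b i)) m" if "i \<in> I" for i
      using I(2)[OF that] by (metis inj has_ord_ex)
    then obtain m where m: "\<And>i. i \<in> I \<Longrightarrow> has_ord (\<psi> (b i)) (m i)" by metis
    define M where "M = Max (m ` I)"
    have "M \<in> m ` I" unfolding M_def using I(1) \<open>I \<noteq> {}\<close> by (intro Max_in) auto
    then obtain i0 where i0: "i0 \<in> I" "m i0 = M" by blast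
    have bM: "ord_le (\<psi> (b i)) M" if "i \<in> I" for i
      using m[OF that] I(1) that by (auto simp: has_ord_def M_def elim!: ord_le_mono intro!: Max_ge)
    define f where "f = cf (\<psi> z2) n"
    have f: "f \<noteq> 0" "ord_le (\<psi> z2) n" using \<psi>(2) by (simp_all add: f_def has_ord_def)
    have "cf (\<psi> (b i0)) M \<noteq> 0" using m[OF i0(1)] i0(2) by (simp add: has_ord_def)
    then obtain s where s: "fls_nth (cf (\<psi> (b i0)) M) s \<noteq> 0"
      by (metis fls_eqI fls_zero_nth)
    \<comment> \<open>Reads one coefficient of the symbol in order \<open>n + M\<close>, after
      division by the leading coefficient of \<open>z2\<close>. So \<open>z2 * b i\<close> and
      \<open>b i * z2\<close> have the same value \<open>k i\<close>, and \<open>s\<close> makes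
      \<open>k i0\<close> non-zero.\<close>
    define \<phi> where "\<phi> c = fls_nth (cf (\<psi> c) (n + M) / f) s" for c
    have \<phi>: "\<phi> (c + d) = \<phi> c + \<phi> d" "\<phi> (scale1 t c) = t * \<phi> c" for c d t
      by (simp_all add: \<phi>_def hom add_divide_distrib flip: times_divide_eq_right)
    note sl = slice_simps[of \<phi>, OF \<phi>]
    have sl_zero: "slice \<phi> 0 = 0" using sl(1)[of 0 0] by simp
    have sl_diff: "slice \<phi> (x - y) = slice \<phi> x - slice \<phi> y" for x y
      using sl(1)[of "x - y" y] by simp
    define k where "k i = fls_nth (cf (\<psi> (b i)) M) s" for i
    have "slice \<phi> (\<Theta> (a i \<otimes>\<^sub>K b i)) = scale1 (k i) (ad z1 (a i))" if i: "i \<in> I" for i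
    proof -
      have "cf (\<psi> (b i * z2)) (n + M) = f * cf (\<psi> (b i)) M"
        using cf_mult(1)[OF bM[OF i] f(2)] by (simp add: hom f_def add.commute[of n M] mult.commute)
      then have "\<phi> (b i * z2) = k i" using f(1) by (simp add: \<phi>_def k_def)
      moreover have "cf (\<psi> (z2 * b i)) (n + M) = f * cf (\<psi> (b i)) M"
        using cf_mult(1)[OF f(2) bM[OF i]] by (simp add: hom f_def)
      then have "\<phi> (z2 * b i) = k i" using f(1) by (simp add: \<phi>_def k_def)
      \<comment> \<open>As \<open>n >= 1\<close>, the order of \<open>b i\<close> is below
        \<open>n + M\<close>; this removes the term with the eigenvalue \<open>l\<close>.\<close>
      moreover have "\<phi> (b i) = 0" using bM[OF i] \<psi>(3) by (simp add: \<phi>_def ord_le_def)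
      ultimately show ?thesis
        by (simp add: \<Theta>_def ad_def[of "z1 \<otimes>\<^sub>K z2"] tensor_mult sl sl_diff ad_def[of z1] A1.scale_right_diff_distrib)
    qed
    then have "slice \<phi> (\<Theta> x') = (\<Sum>i\<in>I. scale1 (k i) (ad z1 (a i)))"
    proof -
      assume *: "\<And>i. i \<in> I \<Longrightarrow> slice \<phi> (\<Theta> (a i \<otimes>\<^sub>K b i)) = scale1 (k i) (ad z1 (a i))"
      have "slice \<phi> (\<Theta> (\<Sum>i\<in>J. a i \<otimes>\<^sub>K b i)) = (\<Sum>i\<in>J. slice \<phi> (\<Theta> (a i \<otimes>\<^sub>K b i)))" if "finite J" for J
        using that
      proof (induction J rule: finite_induct)
        case empty
        show ?case by (simp add: \<Theta>_def sl_zero)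
      qed (simp add: \<Theta>_add sl(1))
      with I(1) * show ?thesis by (simp add: x'_def)
    qed
    also have "\<dots> = ad z1 (\<Sum>i\<in>I. scale1 (k i) (a i))" by (simp add: A1.ad_sum A1.ad_scale)
    finally have "slice \<phi> (\<Theta> x') = ad z1 (\<Sum>i\<in>I. scale1 (k i) (a i))" .
    moreover have "\<Theta> x' \<in> T"
    proof -
      have "\<Theta> x' = \<Theta> x - \<Theta> (x - x')" by (simp add: \<Theta>_diff)
      then show ?thesis
        using A2.subspace_diff[OF T] x \<Theta>_T[OF I(3)] by (simp add: \<Theta>_def T_def x'_def)
    qed
    then have "slice \<phi> (\<Theta> x') \<in> A1.N z1"
      unfolding T_def by (rule slice_in_subspace[OF \<phi> A1.N_subspace])
    ultimately have "(\<Sum>i\<in>I. scale1 (k i) (a i)) \<in> A1.N z1" by (simp add: A1.ad_in_N_iff)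
    then have "k i0 = 0" using indep i0(1) by blast
    with s show False by (simp add: k_def)
  qed
  with I(3) show ?thesis by (simp add: T_def)
qed

lemma tensor_N_left:
  fixes z1 z2 :: "'k::field_char_0 weyl"
  assumes "z2 \<notin> A1.scalars" "x \<in> A2.N (z1 \<otimes>\<^sub>K z2)"
  shows "x \<in> tensor_subspace (A1.N z1) UNIV"
proof -
  obtain m where "(ad (z1 \<otimes>\<^sub>K z2) ^^ m) x = 0" using assms(2) by (auto simp: A2.N_def)
  then show ?thesis
  proof (induction m arbitrary: x)
    case 0
    then show ?case using A2.subspace_0[OF tensor_subspace_subspace] by simp
  next
    case (Suc m)
    then have "ad (z1 \<otimes>\<^sub>K z2) x \<in> tensor_subspace (A1.N z1) UNIV" by (simp add: funpow_swap1)
    then show ?case using tensor_eigen_left[OF assms(1), of z1 x 0] by simp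
  qed
qed

text \<open>Each term of the product rule lowers one of the two nilpotency indices; the extra
  factors \<open>z1\<close> and \<open>z2\<close> are harmless because they commute with the
  respective adjoint actions.\<close>

lemma tensor_N_subset:
  fixes z1 z2 :: "'k::field_char_0 weyl"
  shows "tensor_subspace (A1.N z1) (A1.N z2) \<subseteq> A2.N (z1 \<otimes>\<^sub>K z2)"
proof
  have *: "(ad (z1 \<otimes>\<^sub>K z2) ^^ m) (a \<otimes>\<^sub>K b) = 0"
    if "(ad z1 ^^ i) a = 0" "(ad z2 ^^ j) b = 0" "m = i + j" for a b i j m
    using that
  proof (induction m arbitrary: a b i j)
    case (Suc m)
    have z: "ad z1 z1 = 0" "ad z2 z2 = 0" by simp_all
    have "(ad (z1 \<otimes>\<^sub>K z2) ^^ m) (ad z1 a \<otimes>\<^sub>K (z2 * b)) = 0"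
    proof (cases i)
      case (Suc i')
      then show ?thesis using Suc.prems z
        by (intro Suc.IH[of i' _ j]) (simp_all add: funpow_swap1 ad_iter_mult_left)
    qed (use Suc.prems in simp)
    moreover have "(ad (z1 \<otimes>\<^sub>K z2) ^^ m) ((a * z1) \<otimes>\<^sub>K ad z2 b) = 0"
    proof (cases j)
      case (Suc j')
      then show ?thesis using Suc.prems z
        by (intro Suc.IH[of i _ j']) (simp_all add: funpow_swap1 ad_iter_mult_right)
    qed (use Suc.prems in simp)
    moreover have "ad (z1 \<otimes>\<^sub>K z2) (a \<otimes>\<^sub>K b) = ad z1 a \<otimes>\<^sub>K (z2 * b) + (a * z1) \<otimes>\<^sub>K ad z2 b"
      by (simp add: ad_def tensor_mult tensor_diff)
    ultimately show ?case by (simp add: funpow_swap1 ad_iter_add)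
  qed simp
  fix x assume "x \<in> tensor_subspace (A1.N z1) (A1.N z2)"
  then show "x \<in> A2.N (z1 \<otimes>\<^sub>K z2)"
  proof (rule tensor_subspace_induct[OF _ A2.N_subspace])
    fix a b assume "a \<in> A1.N z1" "b \<in> A1.N z2"
    then obtain i j where "(ad z1 ^^ i) a = 0" "(ad z2 ^^ j) b = 0" by (auto simp: A1.N_def)
    from *[OF this refl] show "a \<otimes>\<^sub>K b \<in> A2.N (z1 \<otimes>\<^sub>K z2)" by (auto simp: A2.N_def)
  qed
qed

context
  fixes z1 z2 :: "'k::field_char_0 weyl"
  assumes z1: "z1 \<notin> A1.scalars" and z2: "z2 \<notin> A1.scalars"
begin

lemma tensor_N: "A2.N (z1 \<otimes>\<^sub>K z2) = tensor_subspace (A1.N z1) (A1.N z2)"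
proof
  show "A2.N (z1 \<otimes>\<^sub>K z2) \<subseteq> tensor_subspace (A1.N z1) (A1.N z2)"
  proof
    fix x assume x: "x \<in> A2.N (z1 \<otimes>\<^sub>K z2)"
    then have "swap x \<in> A2.N (z2 \<otimes>\<^sub>K z1)" using swap_N[of x "z1 \<otimes>\<^sub>K z2"] by simp
    then have "swap x \<in> tensor_subspace (A1.N z2) UNIV" by (rule tensor_N_left[OF z1])
    then have "x \<in> tensor_subspace UNIV (A1.N z2)" by (simp add: swap_tensor_subspace)
    with tensor_N_left[OF z2 x] show "x \<in> tensor_subspace (A1.N z1) (A1.N z2)"
      by (rule tensor_subspace_Int[OF A1.N_subspace A1.N_subspace])
  qed
qed (rule tensor_N_subset)

text \<open>\<open>tensor_eigen_left\<close> holds for every \<open>l\<close>, so an eigenvector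
  lies in \<open>N\<close> by both one-sided inclusions; an eigenvector in \<open>N\<close> has
  eigenvalue 0.\<close>

lemma tensor_Ev: "A2.Ev (z1 \<otimes>\<^sub>K z2) = {0}"
proof -
  have "c = 0" if c: "c \<in> A2.Ev (z1 \<otimes>\<^sub>K z2)" for c
  proof -
    obtain x where x: "x \<noteq> 0" "ad (z1 \<otimes>\<^sub>K z2) x = scale2 c x" using c by (auto simp: A2.Ev_def)
    have 0: "0 \<in> tensor_subspace U V" for U V :: "'k weyl set"
      by (rule A2.subspace_0[OF tensor_subspace_subspace])
    have left: "x \<in> tensor_subspace (A1.N z1) UNIV"
      by (rule tensor_eigen_left[OF z2, where l = c]) (simp add: x 0)
    have "ad (z2 \<otimes>\<^sub>K z1) (swap x) = scale2 c (swap x)"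
      using swap_ad[of "z1 \<otimes>\<^sub>K z2" x] x by simp
    then have "swap x \<in> tensor_subspace (A1.N z2) UNIV"
      using tensor_eigen_left[OF z1, of z2 "swap x" c] by (simp add: 0)
    then have "x \<in> tensor_subspace UNIV (A1.N z2)" by (simp add: swap_tensor_subspace)
    with left have "x \<in> A2.N (z1 \<otimes>\<^sub>K z2)"
      unfolding tensor_N by (rule tensor_subspace_Int[OF A1.N_subspace A1.N_subspace])
    then obtain m where "(ad (z1 \<otimes>\<^sub>K z2) ^^ m) x = 0" by (auto simp: A2.N_def)
    moreover have "(ad (z1 \<otimes>\<^sub>K z2) ^^ m) x = scale2 (c ^ m) x"
      by (induction m) (simp_all add: A2.ad_scale x mult.commute)
    ultimately show "c = 0" using x(1) by simp
  qed
  moreover have "0 \<in> A2.Ev (z1 \<otimes>\<^sub>K z2)" by (rule A2.zero_in_Ev) simp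
  ultimately show ?thesis by blast
qed

lemma tensor_C_subset: "tensor_subspace (A1.C z1) (A1.C z2) \<subseteq> A2.C (z1 \<otimes>\<^sub>K z2)"
proof
  fix x assume "x \<in> tensor_subspace (A1.C z1) (A1.C z2)"
  then show "x \<in> A2.C (z1 \<otimes>\<^sub>K z2)"
    by (rule tensor_subspace_induct[OF _ A2.C_subspace])
      (simp add: A1.in_C_iff A2.in_C_iff tensor_mult)
qed

lemma tensor_C_neq_UNIV: "A2.C (z1 \<otimes>\<^sub>K z2) \<noteq> UNIV"
proof -
  obtain w where "ad z1 w \<noteq> 0" using nonscalar_not_central[OF z1] .
  moreover have "z2 \<noteq> 0" using z2 by (auto simp: A1.scalars_def image_iff intro!: exI[of _ 0])
  ultimately have "ad (z1 \<otimes>\<^sub>K z2) (w \<otimes>\<^sub>K 1) \<noteq> 0"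
    by (simp add: ad_def tensor_mult tensor_eq_0_iff flip: tensor_diff)
  then show ?thesis by (auto simp: A2.C_def)
qed

text \<open>The witness is \<open>w\<close> tensor 1: its second factor stays a power of
  \<open>z2\<close>, so only \<open>ad z1\<close> acts, and it needs exactly two steps to
  vanish.\<close>

lemma tensor_nilpotent_step:
  assumes "A1.C z1 \<noteq> A1.N z1"
  shows "A2.C (z1 \<otimes>\<^sub>K z2) \<noteq> A2.N (z1 \<otimes>\<^sub>K z2)"
proof -
  obtain x where "x \<in> A1.N z1" "x \<notin> A1.C z1" using assms A1.C_subset_N by blast
  then obtain w where w: "ad z1 w \<noteq> 0" "ad z1 (ad z1 w) = 0" by (rule A1.nilpotent_step)
  have "z2 \<noteq> 0" using z2 by (auto simp: A1.scalars_def image_iff intro!: exI[of _ 0])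
  have ad: "ad (z1 \<otimes>\<^sub>K z2) (a \<otimes>\<^sub>K z2 ^ k) = ad z1 a \<otimes>\<^sub>K z2 ^ Suc k" for a k
    by (simp add: ad_def tensor_mult tensor_diff power_commutes)
  have "ad (z1 \<otimes>\<^sub>K z2) (w \<otimes>\<^sub>K 1) = ad z1 w \<otimes>\<^sub>K z2" using ad[of w 0] by simp
  moreover have "ad (z1 \<otimes>\<^sub>K z2) (ad z1 w \<otimes>\<^sub>K z2) = 0" using ad[of "ad z1 w" 1] w(2) by simp
  ultimately have "w \<otimes>\<^sub>K 1 \<notin> A2.C (z1 \<otimes>\<^sub>K z2)" "(ad (z1 \<otimes>\<^sub>K z2) ^^ 2) (w \<otimes>\<^sub>K 1) = 0"
    using w(1) \<open>z2 \<noteq> 0\<close> by (auto simp: A2.C_def tensor_eq_0_iff numeral_2_eq_2)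
  then show ?thesis unfolding A2.N_def by blast
qed

text \<open>The one-sided inclusion puts the \<open>a i\<close> into \<open>C z1\<close>, so the
  commutator of \<open>x\<close> has the terms \<open>z1 * a i\<close> tensor
  \<open>ad z2 (b i)\<close>. In a domain the \<open>z1 * a i\<close> remain independent, which
  forces \<open>ad z2 (b i) = 0\<close>.\<close>

lemma tensor_C_if_C_eq_N:
  assumes "A1.C z1 = A1.N z1"
  shows "A2.C (z1 \<otimes>\<^sub>K z2) = tensor_subspace (A1.C z1) (A1.C z2)"
proof
  show "A2.C (z1 \<otimes>\<^sub>K z2) \<subseteq> tensor_subspace (A1.C z1) (A1.C z2)"
  proof
    fix x assume x: "x \<in> A2.C (z1 \<otimes>\<^sub>K z2)"
    then have "x \<in> tensor_subspace (A1.C z1) UNIV"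
      unfolding assms using A2.C_subset_N by (intro tensor_N_left[OF z2]) blast
    then obtain I :: "nat set" and a b where I: "finite I" "\<And>i. i \<in> I \<Longrightarrow> a i \<in> A1.C z1"
      "x = (\<Sum>i\<in>I. a i \<otimes>\<^sub>K b i)"
      "\<And>k i. (\<Sum>i\<in>I. scale1 (k i) (a i)) = 0 \<Longrightarrow> i \<in> I \<Longrightarrow> k i = 0"
      by (rule independent_representation[OF A1.C_subspace]) blast
    have "ad (z1 \<otimes>\<^sub>K z2) x = (\<Sum>i\<in>I. (z1 * a i) \<otimes>\<^sub>K ad z2 (b i))"
      unfolding I(3) A2.ad_sum
      by (rule sum.cong) (use I(2) in \<open>simp_all add: ad_def tensor_mult tensor_diff A1.in_C_iff\<close>)
    then have sum: "(\<Sum>i\<in>I. (z1 * a i) \<otimes>\<^sub>K ad z2 (b i)) = 0" using x by (simp add: A2.C_def)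
    have "z1 \<noteq> 0" using z1 by (auto simp: A1.scalars_def image_iff intro!: exI[of _ 0])
    have "ad z2 (b i) \<in> {0}" if "i \<in> I" for i
    proof (rule tensor_independent[of I "\<lambda>i. z1 * a i" "\<lambda>i. ad z2 (b i)" "{0}" i])
      fix k i assume k: "(\<Sum>i\<in>I. scale1 (k i) (z1 * a i)) = 0" and i: "i \<in> I"
      have "z1 * (\<Sum>i\<in>I. scale1 (k i) (a i)) = 0"
        using k by (simp add: sum_distrib_left A1.scale_mult_right)
      then have "(\<Sum>i\<in>I. scale1 (k i) (a i)) = 0" using \<open>z1 \<noteq> 0\<close> by simp
      then show "k i = 0" using i by (rule I(4))
    next
      show "(\<Sum>i\<in>I. (z1 * a i) \<otimes>\<^sub>K ad z2 (b i)) \<in> tensor_subspace UNIV {0}"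
        unfolding sum by (rule A2.subspace_0[OF tensor_subspace_subspace])
    qed (use I(1) that in \<open>simp_all add: A1.subspace_single_0\<close>)
    then have "b i \<in> A1.C z2" if "i \<in> I" for i using that by (simp add: A1.C_def)
    then show "x \<in> tensor_subspace (A1.C z1) (A1.C z2)"
      unfolding I(3) using I(2) by (intro A2.subspace_sum tensor_subspace_subspace tensor_subspace_base)
  qed
qed (rule tensor_C_subset)

lemma tensor_C_commutative:
  assumes "x \<in> tensor_subspace (A1.C z1) (A1.C z2)" "y \<in> tensor_subspace (A1.C z1) (A1.C z2)"
  shows "x * y = y * x"
proof -
  have 1: "y \<in> A2.C (a \<otimes>\<^sub>K b)" if "a \<in> A1.C z1" "b \<in> A1.C z2" for a b
    using assms(2)
  proof (rule tensor_subspace_induct[OF _ A2.C_subspace])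
    fix c d assume "c \<in> A1.C z1" "d \<in> A1.C z2"
    then show "c \<otimes>\<^sub>K d \<in> A2.C (a \<otimes>\<^sub>K b)"
      using that weyl_centralizer_commutative[OF z1] weyl_centralizer_commutative[OF z2]
      by (simp add: A2.in_C_iff tensor_mult)
  qed
  from assms(1) have "x \<in> A2.C y"
  proof (rule tensor_subspace_induct[OF _ A2.C_subspace])
    fix a b assume "a \<in> A1.C z1" "b \<in> A1.C z2"
    from 1[OF this] show "a \<otimes>\<^sub>K b \<in> A2.C y" by (simp add: A2.in_C_iff)
  qed
  then show ?thesis by (simp add: A2.in_C_iff)
qed

end

section \<open>The types expressed by \<open>N\<close> and \<open>C\<close>, and the
  conclusion\<close>

lemma nilpotent_iff: "A2.nilpotent z \<longleftrightarrow> A2.Ev z = {0} \<and> A2.C z \<noteq> A2.N z"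
  using A2.C_subset_N[of z] by (auto simp: A2.nilpotent_def A2.Omega1_def A2.Omega1'_def)

text \<open>A vector of \<open>N z\<close> outside \<open>C z\<close> excludes non-zero eigenvalues
  by \<open>N_eq_C_if_eigenvector\<close>, which yields \<open>Ev z = {0}\<close>.\<close>

lemma weyl_nilpotent_iff:
  fixes z :: "'k::field_char_0 weyl"
  shows "A1.nilpotent z \<longleftrightarrow> A1.C z \<noteq> A1.N z"
proof
  assume *: "A1.C z \<noteq> A1.N z"
  have "A1.Ev z = {0}"
  proof (rule ccontr)
    assume "A1.Ev z \<noteq> {0}"
    moreover have "0 \<in> A1.Ev z" by (rule A1.zero_in_Ev) simp
    ultimately obtain l where "l \<in> A1.Ev z" "l \<noteq> 0" by blast
    then show False using N_eq_C_if_eigenvector * by (auto simp: A1.Ev_def)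
  qed
  then show "A1.nilpotent z"
    using * A1.C_subset_N[of z] by (auto simp: A1.nilpotent_def A1.Omega1_def A1.Omega1'_def)
qed (auto simp: A1.nilpotent_def A1.Omega1_def A1.Omega1'_def)

lemma weyl_strictly_nilpotent_iff:
  fixes z :: "'k::field_char_0 weyl"
  assumes "z \<notin> A1.scalars"
  shows "A1.strictly_nilpotent z \<longleftrightarrow> A1.N z = UNIV"
proof
  assume N: "A1.N z = UNIV"
  obtain w where "ad z w \<noteq> 0" using nonscalar_not_central[OF assms] .
  then have "A1.C z \<noteq> A1.N z" by (auto simp: N A1.C_def)
  then have "A1.nilpotent z" by (simp add: weyl_nilpotent_iff)
  then show "A1.strictly_nilpotent z"
    using N by (auto simp: A1.strictly_nilpotent_def A1.nilpotent_def A1.Omega1'_def)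
qed (simp add: A1.strictly_nilpotent_def A1.Omega1_def)

lemma semisimple_C_eq_polynomials:
  fixes z :: "'k::field_char_0 weyl"
  assumes "A1.semisimple z"
  shows "A1.C z = A1.polynomials_in z" "\<not> A1.nilpotent z"
proof -
  have Ev: "{0} \<subset> A1.Ev z"
    using assms by (auto simp: A1.semisimple_def A1.Omega2_def A1.Omega2'_def)
  then obtain l y where "l \<noteq> 0" "y \<noteq> 0" "ad z y = scale1 l y" by (auto simp: A1.Ev_def)
  then show "A1.C z = A1.polynomials_in z" by (rule C_eq_polynomials_if_eigenvector[rotated])
  show "\<not> A1.nilpotent z"
    using Ev by (auto simp: A1.nilpotent_def A1.Omega1_def A1.Omega1'_def)
qed

theorem corollary5p8:
  fixes z1 z2 :: "'k::{field_char_0, alg_closed_field} weyl"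
  assumes "z1 \<notin> A1.scalars" and "z2 \<notin> A1.scalars"
  shows "(A1.nilpotent z1 \<or> A1.nilpotent z2 \<longrightarrow>
            A2.nilpotent (z1 \<otimes>\<^sub>K z2) \<and>
            (A2.strictly_nilpotent (z1 \<otimes>\<^sub>K z2) \<longleftrightarrow>
              A1.strictly_nilpotent z1 \<and> A1.strictly_nilpotent z2)) \<and>
         (\<not> A1.nilpotent z1 \<and> \<not> A1.nilpotent z2 \<longrightarrow> z1 \<otimes>\<^sub>K z2 \<in> A2.Omega0') \<and>
         (\<not> A1.nilpotent z1 \<or> \<not> A1.nilpotent z2 \<longrightarrow>
            A2.C (z1 \<otimes>\<^sub>K z2) = tensor_subspace (A1.C z1) (A1.C z2) \<and>
            (\<forall>x\<in>A2.C (z1 \<otimes>\<^sub>K z2). \<forall>y\<in>A2.C (z1 \<otimes>\<^sub>K z2). x * y = y * x)) \<and>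
         (A1.semisimple z1 \<and> A1.semisimple z2 \<longrightarrow>
            A2.C (z1 \<otimes>\<^sub>K z2) = tensor_subspace (A1.polynomials_in z1) (A1.polynomials_in z2))"
proof -
  note z = assms
  let ?z = "z1 \<otimes>\<^sub>K z2"
  have swapC: "x \<in> A2.C (z2 \<otimes>\<^sub>K z1) \<longleftrightarrow> swap x \<in> A2.C ?z" for x
    using swap_C[of x "z2 \<otimes>\<^sub>K z1"] by simp
  have swapN: "x \<in> A2.N (z2 \<otimes>\<^sub>K z1) \<longleftrightarrow> swap x \<in> A2.N ?z" for x
    using swap_N[of x "z2 \<otimes>\<^sub>K z1"] by simp
  have C: "A2.C ?z = tensor_subspace (A1.C z1) (A1.C z2)"
    if "\<not> A1.nilpotent z1 \<or> \<not> A1.nilpotent z2"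
  proof (cases "A1.nilpotent z1")
    case False
    then show ?thesis by (simp add: weyl_nilpotent_iff tensor_C_if_C_eq_N[OF z])
  next
    case True
    with that have "A2.C (z2 \<otimes>\<^sub>K z1) = tensor_subspace (A1.C z2) (A1.C z1)"
      by (simp add: weyl_nilpotent_iff tensor_C_if_C_eq_N[OF z(2,1)])
    then have "swap x \<in> tensor_subspace (A1.C z2) (A1.C z1) \<longleftrightarrow> x \<in> A2.C ?z" for x
      using swapC[of "swap x"] by simp
    then show ?thesis by (auto simp: swap_tensor_subspace)
  qed
  have nil: "A2.nilpotent ?z" if "A1.nilpotent z1 \<or> A1.nilpotent z2"
  proof (cases "A1.nilpotent z1")
    case True
    then show ?thesis
      by (simp add: weyl_nilpotent_iff nilpotent_iff tensor_Ev[OF z] tensor_nilpotent_step[OF z])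
  next
    case False
    with that have "A2.C (z2 \<otimes>\<^sub>K z1) \<noteq> A2.N (z2 \<otimes>\<^sub>K z1)"
      by (simp add: weyl_nilpotent_iff tensor_nilpotent_step[OF z(2,1)])
    then have "A2.C ?z \<noteq> A2.N ?z" by (auto simp: set_eq_iff swapC swapN)
    then show ?thesis by (simp add: nilpotent_iff tensor_Ev[OF z])
  qed
  have N_UNIV: "A2.N ?z = UNIV \<longleftrightarrow> A1.N z1 = UNIV \<and> A1.N z2 = UNIV"
  proof
    assume N: "A2.N ?z = UNIV"
    \<comment> \<open>Contracting \<open>a\<close> tensor 1 with a functional whose value at 1 is 1
      returns \<open>a\<close>.\<close>
    have left: "a \<in> A1.N w1" if "A2.N (w1 \<otimes>\<^sub>K w2) = UNIV" "w2 \<notin> A1.scalars" for a w1 w2 :: "'k weyl"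
    proof -
      have \<phi>: "weyl_functional (a + b) = weyl_functional a + weyl_functional b"
        "weyl_functional (scale1 c a) = c * weyl_functional a" for a b :: "'k weyl" and c
        by simp_all
      have "a \<otimes>\<^sub>K 1 \<in> tensor_subspace (A1.N w1) UNIV" using that by (intro tensor_N_left[of w2]) auto
      then have "slice weyl_functional (a \<otimes>\<^sub>K 1) \<in> A1.N w1"
        by (rule slice_in_subspace[OF \<phi> A1.N_subspace])
      then show ?thesis by (simp add: slice_simps)
    qed
    have "A2.N (z2 \<otimes>\<^sub>K z1) = UNIV" using N by (auto simp: swapN)
    then show "A1.N z1 = UNIV \<and> A1.N z2 = UNIV"
      using left[OF N z(2)] left[OF _ z(1)] by blast
  next
    assume "A1.N z1 = UNIV \<and> A1.N z2 = UNIV"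
    then show "A2.N ?z = UNIV" by (simp add: tensor_N[OF z] tensor_subspace_UNIV)
  qed
  have strict: "A2.strictly_nilpotent ?z \<longleftrightarrow> A1.strictly_nilpotent z1 \<and> A1.strictly_nilpotent z2"
    unfolding weyl_strictly_nilpotent_iff[OF z(1)] weyl_strictly_nilpotent_iff[OF z(2)] N_UNIV[symmetric]
    using tensor_C_neq_UNIV[OF z] tensor_Ev[OF z] A2.C_subset_N[of ?z]
    by (auto simp: A2.strictly_nilpotent_def A2.Omega1_def)
  have omega: "?z \<in> A2.Omega0'" if "\<not> A1.nilpotent z1" "\<not> A1.nilpotent z2"
  proof -
    have "A2.N ?z = A2.C ?z"
      using that C by (simp add: tensor_N[OF z] weyl_nilpotent_iff)
    then show ?thesis
      using tensor_C_neq_UNIV[OF z] F_eq_N_if_Ev_trivial[OF tensor_Ev[OF z]] tensor_Ev[OF z]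
      by (auto simp: A2.Omega0'_def)
  qed
  show ?thesis
    using nil strict omega C tensor_C_commutative[OF z] semisimple_C_eq_polynomials by metis
qed

end
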